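(* Let $n>2$, $0<r<1$, $D=\{x\in\mathbb{D}^n:|x|<r\}$, $\rho=\frac{n-2}{2}$, and let $P_r(x,y)$ be the Poisson kernel of $D$ for the hyperbolic Brownian motion on $\mathbb{D}^n$. Then for $|x|<r$ and $|y|=r$ $$P_r(x,y)=\frac{\Gamma(\frac n2)}{2\pi^{n/2}r^{n-1}}\sum_{k=0}^{\infty}\frac{k+\rho}{\rho}\left(\frac{|x|}{r}\right)^k\frac{F_k(|x|^2)}{F_k(r^2)}\,C_k^{(\rho)}(\cos\theta),$$ where $\theta$ is the angle $\angle x0y$.
   Context: $\mathbb{D}^n=\{x\in\mathbb{R}^n:|x|<1\}$ is the ball model of real hyperbolic space with metric $ds^2=|dx|^2/(1-|x|^2)^2$. The hyperbolic Brownian motion $X(t)$ is the diffusion on $\mathbb{D}^n$ with generator the Laplace–Beltrami operator $(1-|x|^2)^2\sum_i\frac{\partial^2}{\partial x_i^2}+2(n-2)(1-|x|^2)\sum_i x_i\frac{\partial}{\partial x_i}$. Let $\tau_D=\inf\{t\ge0:|X(t)|\ge r\}$. The Poisson kernel $P_r(x,y)$, $x\in D$, $y\in S_r=\{y:|y|=r\}$, is the (continuous in $y$) density, with respect to the $(n-1)$-dimensional (Euclidean) spherical measure $\sigma_r$ on $S_r$, of the harmonic measure $A\mapsto P^x(X(\tau_D)\in A)$, $A\subset S_r$ Borel. $C_k^{(v)}$ is the Gegenbauer polynomial: $(1-2zh+h^2)^{-v}=\sum_{k\ge0}C_k^{(v)}(z)h^k$. $F_k(z)=F(k,-\rho;k+\frac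 n2;z)$, where $F(\alpha,\beta;\gamma;z)=\sum_{i\ge0}\frac{(\alpha)_i(\beta)_i}{(\gamma)_i\,i!}z^i$ is the Gauss hypergeometric function and $(\alpha)_i=\Gamma(\alpha+i)/\Gamma(\alpha)$. If $x=0$, $\theta$ is $\angle u0y$ for an arbitrary fixed nonzero vector $u$, and $0^0=1$. *)

theory Defs
  imports
    "HOL-Probability.Probability"
    "HOL-Computational_Algebra.Formal_Power_Series"
begin

section \<open>The Laplace--Beltrami operator of the ball model\<close>

definition partial :: "'n \<Rightarrow> (real ^ 'n \<Rightarrow> real) \<Rightarrow> real ^ 'n \<Rightarrow> real" where
  "partial i f x = frechet_derivative f (at x) (axis i 1)"

definition C2 :: "(real ^ 'n \<Rightarrow> real) \<Rightarrow> bool" where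
  "C2 f \<longleftrightarrow>
     (\<forall>x. f differentiable (at x)) \<and>
     (\<forall>i x. partial i f differentiable (at x)) \<and>
     (\<forall>i j. continuous_on UNIV (partial j (partial i f)))"

text \<open>The space of twice continuously differentiable functions with compact support in the open
  unit ball, each identified with its extension by zero to the whole space.\<close>

definition C2_compact_support :: "(real ^ 'n \<Rightarrow> real) \<Rightarrow> bool" where
  "C2_compact_support f \<longleftrightarrow>
     C2 f \<and> (\<exists>K. compact K \<and> K \<subseteq> ball 0 1 \<and> (\<forall>x. x \<notin> K \<longrightarrow> f x = 0))"

definition laplace_beltrami :: "(real ^ 'n \<Rightarrow> real) \<Rightarrow> real ^ 'n \<Rightarrow> real" where
  "laplace_beltrami f x =
     (1 - (norm x)\<^sup>2)\<^sup>2 * (\<Sum>i\<in>UNIV. partial i (partial i f) x)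
     + 2 * (real CARD('n) - 2) * (1 - (norm x)\<^sup>2) * (\<Sum>i\<in>UNIV. x $ i * partial i f x)"


section \<open>Hyperbolic Brownian motion\<close>

definition natural_filtration :: "'w set \<Rightarrow> (real \<Rightarrow> 'w \<Rightarrow> 'b::topological_space) \<Rightarrow> real \<Rightarrow> 'w measure" where
  "natural_filtration \<Omega> X t = sigma \<Omega> (\<Union>s\<in>{0..t}. {X s -` B \<inter> \<Omega> | B. B \<in> sets borel})"

text \<open>A diffusion on the unit ball: a strong Markov family with continuous paths. The measurable
  space of paths is \<open>N\<close>, the law of the process \<open>X\<close> started at \<open>x\<close> is \<open>M x\<close>; nothing is
  required of \<open>M x\<close> for \<open>x\<close> outside the ball, nor of \<open>X t\<close> for negative \<open>t\<close>. Finite stopping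
  times suffice in the strong Markov property, since a general one can be truncated.\<close>

locale ball_diffusion =
  fixes N :: "'w measure"
    and M :: "real ^ 'n \<Rightarrow> 'w measure"
    and X :: "real \<Rightarrow> 'w \<Rightarrow> real ^ 'n"
  assumes prob_space_M: "x \<in> ball 0 1 \<Longrightarrow> prob_space (M x)"
    and sets_M: "x \<in> ball 0 1 \<Longrightarrow> sets (M x) = sets N"
    and measurable_X: "0 \<le> t \<Longrightarrow> X t \<in> N \<rightarrow>\<^sub>M borel"
    and X_in_ball: "0 \<le> t \<Longrightarrow> \<omega> \<in> space N \<Longrightarrow> X t \<omega> \<in> ball 0 1"
    and continuous_paths: "\<omega> \<in> space N \<Longrightarrow> continuous_on {0..} (\<lambda>t. X t \<omega>)"
    and start: "x \<in> ball 0 1 \<Longrightarrow> AE \<omega> in M x. X 0 \<omega> = x"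
    and transition_measurable: "0 \<le> t \<Longrightarrow> B \<in> sets borel \<Longrightarrow>
      (\<lambda>x. measure (M x) {\<omega> \<in> space N. X t \<omega> \<in> B}) \<in> borel_measurable (restrict_space borel (ball 0 1))"
    and strong_Markov: "x \<in> ball 0 1 \<Longrightarrow> stopping_time (natural_filtration (space N) X) T \<Longrightarrow>
      (\<And>\<omega>. \<omega> \<in> space N \<Longrightarrow> 0 \<le> T \<omega>) \<Longrightarrow>
      A \<in> sets (filtration.pre_sigma (space N) (natural_filtration (space N) X) T) \<Longrightarrow>
      0 \<le> t \<Longrightarrow> B \<in> sets borel \<Longrightarrow>
      measure (M x) {\<omega> \<in> A. X (T \<omega> + t) \<omega> \<in> B} =
        (LINT \<omega>:A|M x. measure (M (X (T \<omega>) \<omega>)) {\<omega>' \<in> space N. X t \<omega>' \<in> B})"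

text \<open>The generator is the derivative at time zero, in the supremum norm, of the semigroup
  \<open>f \<mapsto> E\<^sup>x f (X t)\<close>. That the differential operator is the generator means, as usual, that
  the generator is given by it on the compactly supported \<open>C2\<close> functions.\<close>

definition (in ball_diffusion) in_generator :: "(real ^ 'n \<Rightarrow> real) \<Rightarrow> (real ^ 'n \<Rightarrow> real) \<Rightarrow> bool" where
  "in_generator f g \<longleftrightarrow>
     uniform_limit (ball 0 1) (\<lambda>t x. ((LINT \<omega>|M x. f (X t \<omega>)) - f x) / t) g (at_right 0)"

locale hyperbolic_Brownian_motion = ball_diffusion N M X
  for N :: "'w measure"
    and M :: "real ^ 'n \<Rightarrow> 'w measure"
    and X :: "real \<Rightarrow> 'w \<Rightarrow> real ^ 'n" +
  assumes generator: "C2_compact_support f \<Longrightarrow> in_generator f (laplace_beltrami f)"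


section \<open>Harmonic measure and Poisson kernel\<close>

text \<open>On paths that never leave the ball of radius \<open>r\<close> the infimum of the empty set is an
  unspecified real; such paths are excluded explicitly in the harmonic measure.\<close>

definition exit_time :: "(real \<Rightarrow> 'w \<Rightarrow> real ^ 'n) \<Rightarrow> real \<Rightarrow> 'w \<Rightarrow> real" where
  "exit_time X r \<omega> = Inf {t. 0 \<le> t \<and> r \<le> norm (X t \<omega>)}"

definition harmonic_measure ::
  "(real ^ 'n \<Rightarrow> 'w measure) \<Rightarrow> (real \<Rightarrow> 'w \<Rightarrow> real ^ 'n) \<Rightarrow> real \<Rightarrow> real ^ 'n \<Rightarrow> (real ^ 'n) set \<Rightarrow> real" where
  "harmonic_measure M X r x A =
     measure (M x) {\<omega> \<in> space (M x). (\<exists>t\<ge>0. r \<le> norm (X t \<omega>)) \<and> X (exit_time X r \<omega>) \<omega> \<in> A}"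

text \<open>The surface measure on the sphere of radius \<open>r\<close>, through polar coordinates:
  \<open>\<sigma>\<^sub>r A = n / r * vol {s *\<^sub>R y |s y. 0 < s \<and> s \<le> 1 \<and> y \<in> A}\<close>; the total mass is
  \<open>n * r ^ (n - 1) * vol (ball 0 1)\<close>.\<close>

definition sphere_measure :: "real \<Rightarrow> (real ^ 'n) measure" where
  "sphere_measure r =
     scale_measure (ennreal (real CARD('n) / r))
       (distr (restrict_space lborel (cball 0 r - {0})) (restrict_space borel (sphere 0 r))
          (\<lambda>x. (r / norm x) *\<^sub>R x))"

definition poisson_kernel ::
  "(real ^ 'n \<Rightarrow> 'w measure) \<Rightarrow> (real \<Rightarrow> 'w \<Rightarrow> real ^ 'n) \<Rightarrow> real \<Rightarrow> (real ^ 'n \<Rightarrow> real ^ 'n \<Rightarrow> real) \<Rightarrow> bool" where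
  "poisson_kernel M X r P \<longleftrightarrow>
     (\<forall>x\<in>ball 0 r.
        continuous_on (sphere 0 r) (P x) \<and>
        (\<forall>y\<in>sphere 0 r. 0 \<le> P x y) \<and>
        (\<forall>A\<in>sets borel. A \<subseteq> sphere 0 r \<longrightarrow>
           ennreal (harmonic_measure M X r x A) = (\<integral>\<^sup>+y\<in>A. ennreal (P x y) \<partial>sphere_measure r)))"


section \<open>Special functions\<close>

text \<open>The Gegenbauer polynomials are the coefficients of the formal power series
  \<open>(1 - 2 z h + h\<^sup>2) powr (-v)\<close> in \<open>h\<close>, where \<open>fps_binomial a\<close> is \<open>(1 + h) powr a\<close>.\<close>

definition gegenbauer :: "real \<Rightarrow> nat \<Rightarrow> real \<Rightarrow> real" where
  "gegenbauer v k z = fps_nth (fps_binomial (- v) oo (fps_X\<^sup>2 - fps_const (2 * z) * fps_X)) k"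

text \<open>\<open>pochhammer a i\<close> is \<open>Gamma (a + i) / Gamma a\<close> where the latter makes sense, and its
  continuous extension at the poles of \<open>Gamma\<close>, which are met here by \<open>a = 0\<close>
  and, for even \<open>n\<close>, by \<open>a = - \<rho>\<close>.\<close>

definition hypergeometric :: "real \<Rightarrow> real \<Rightarrow> real \<Rightarrow> real \<Rightarrow> real" where
  "hypergeometric a b c z =
     (\<Sum>i. pochhammer a i * pochhammer b i / (pochhammer c i * fact i) * z ^ i)"

definition angle :: "real ^ 'n \<Rightarrow> real ^ 'n \<Rightarrow> real" where
  "angle u v = arccos (u \<bullet> v / (norm u * norm v))"

end

theory Submission
  imports Defs "HOL-Analysis.FPS_Convergence" "HOL-Real_Asymp.Real_Asymp"
begin

text \<open>
The process enters only through two facts. If \<open>f\<close> is of class \<open>C\<^sup>2\<close> with compact support and the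
differential operator \<open>L\<close> annihilates it on the ball of radius \<open>r\<close>, then \<open>f x\<close> is the expectation of \<open>f\<close> at
the exit position (\<open>expectation_exit_position\<close>); and the process leaves the ball almost surely
(\<open>AE_hits_sphere\<close>). Both come from one telescoping sum over the grid of step \<open>2\<^sup>-\<^sup>m\<close>: as long as the
path has stayed in a smaller ball, the Markov property turns the increment of \<open>f\<close> over one step
into the increment of the semigroup, which is \<open>2\<^sup>-\<^sup>m (L f + o(1))\<close> uniformly. The exit
position is a double limit of positions at grid times, which also makes it measurable.

Separation of variables supplies eigenfunctions to feed into this: with \<open>Z\<^sub>k\<close> the solid zonal
harmonic of degree \<open>k\<close> and pole \<open>y\<close>, the function \<open>x \<mapsto> F\<^sub>k (|x|\<^sup>2) Z\<^sub>k x\<close> is annihilated by \<open>L\<close> because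
the radial equation is the hypergeometric equation of \<open>F\<^sub>k\<close>. On the sphere \<open>Z\<^sub>k\<close> is a Gegenbauer
polynomial of the cosine of the angle with \<open>y\<close>, so all integrals of
\<open>P x z * C\<^sub>k (y \<bullet> z / r\<^sup>2)\<close> over \<open>z\<close> are known, for every \<open>y\<close> on the sphere
(\<open>poisson_kernel_zonal_integral\<close>).

To recover \<open>P x y\<close> from these moments, weight the moment of order \<open>k\<close> with \<open>(k + \<rho>) / \<rho> * h ^ k\<close> and
sum. By the generating function the moments then combine into the integral of \<open>P x\<close> against the
Euclidean Poisson kernel of the ball (\<open>poisson_kernel_abel_sums\<close>), which as \<open>h\<close> tends to 1 is an
approximate identity at \<open>y\<close> (\<open>euclid_poisson_tendsto\<close>). The integral tends to the area of the sphere times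
\<open>P x y\<close>, and the weighted sum to the asserted series by dominated convergence. The total mass of the Euclidean
kernel is obtained in the same spirit: it is the same for all poles by rotation invariance, and
averaging it over the pole with respect to the harmonic measure of the centre gives the area of
the sphere (\<open>euclid_poisson_total\<close>).
\<close>

section \<open>Partial derivatives and the Laplacian\<close>

lemma partial_eqI: "(f has_derivative f') (at x) \<Longrightarrow> partial i f x = f' (axis i 1)"
  unfolding partial_def by (simp add: frechet_derivative_at[symmetric])

lemma partial_add:
  assumes "f differentiable (at x)" "g differentiable (at x)"
  shows "partial i (\<lambda>x. f x + g x) x = partial i f x + partial i g x"
  using assms unfolding frechet_derivative_works
  by (subst partial_eqI[OF has_derivative_add]) (auto simp: partial_def)

lemma partial_mult:
  assumes "f differentiable (at x)" "g differentiable (at x)"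
  shows "partial i (\<lambda>x. f x * g x) x = f x * partial i g x + partial i f x * g x"
  using assms unfolding frechet_derivative_works
  by (subst partial_eqI[OF has_derivative_mult]) (auto simp: partial_def)

lemma partial_const [simp]: "partial i (\<lambda>x. c) = (\<lambda>x. 0)"
  by (rule ext, subst partial_eqI[OF has_derivative_const]) simp

lemma partial_inner [simp]: "partial i (\<lambda>x. x \<bullet> y) = (\<lambda>x. y $ i)"
  by (rule ext, subst partial_eqI[OF has_derivative_inner_left[OF has_derivative_ident]]) (simp add: inner_axis')

lemma partial_coordinate [simp]: "partial i (\<lambda>x. x $ j) = (\<lambda>x. if i = j then 1 else 0)"
  by (rule ext, subst partial_eqI[OF bounded_linear_imp_has_derivative[OF bounded_linear_vec_nth]]) (simp add: axis_def)

lemma differentiable_coordinate [simp]: "(\<lambda>x. x $ j :: real) differentiable (at x)"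
  by (rule differentiableI[OF bounded_linear_imp_has_derivative[OF bounded_linear_vec_nth]])

lemma C2_regularity:
  assumes "C2 f"
  shows "f differentiable (at x)" "partial i f differentiable (at x)"
    "continuous_on UNIV f" "continuous_on UNIV (partial i f)" "continuous_on UNIV (partial j (partial i f))"
  using assms unfolding C2_def
  by (auto simp: continuous_on_eq_continuous_within intro!: differentiable_imp_continuous_within)

lemma partial_mult_C2:
  assumes "C2 f" "C2 g"
  shows "partial i (\<lambda>x. f x * g x) = (\<lambda>x. f x * partial i g x + partial i f x * g x)"
    "partial j (partial i (\<lambda>x. f x * g x)) = (\<lambda>x. f x * partial j (partial i g) x + partial j f x * partial i g x
       + (partial i f x * partial j g x + partial j (partial i f) x * g x))"
proof -
  show 1: "partial i (\<lambda>x. f x * g x) = (\<lambda>x. f x * partial i g x + partial i f x * g x)"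
    by (rule ext) (intro partial_mult C2_regularity assms)
  show "partial j (partial i (\<lambda>x. f x * g x)) = (\<lambda>x. f x * partial j (partial i g) x + partial j f x * partial i g x
       + (partial i f x * partial j g x + partial j (partial i f) x * g x))"
    unfolding 1
    by (rule ext) (simp add: partial_add partial_mult differentiable_mult C2_regularity[OF assms(1)] C2_regularity[OF assms(2)])
qed

lemma partial_add_C2:
  assumes "C2 f" "C2 g"
  shows "partial i (\<lambda>x. f x + g x) = (\<lambda>x. partial i f x + partial i g x)"
    "partial j (partial i (\<lambda>x. f x + g x)) = (\<lambda>x. partial j (partial i f) x + partial j (partial i g) x)"
proof -
  show 1: "partial i (\<lambda>x. f x + g x) = (\<lambda>x. partial i f x + partial i g x)"
    by (rule ext) (intro partial_add C2_regularity assms)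
  show "partial j (partial i (\<lambda>x. f x + g x)) = (\<lambda>x. partial j (partial i f) x + partial j (partial i g) x)"
    unfolding 1 by (rule ext) (intro partial_add C2_regularity assms)
qed

lemma C2_mult:
  assumes f: "C2 f" and g: "C2 g"
  shows "C2 (\<lambda>x. f x * g x)"
  unfolding C2_def[of "\<lambda>x. f x * g x"] partial_mult_C2(2)[OF f g] unfolding partial_mult_C2(1)[OF f g]
  by (intro conjI allI differentiable_mult differentiable_add continuous_intros C2_regularity[OF f] C2_regularity[OF g])

lemma C2_add:
  assumes f: "C2 f" and g: "C2 g"
  shows "C2 (\<lambda>x. f x + g x)"
  unfolding C2_def[of "\<lambda>x. f x + g x"] partial_add_C2(2)[OF f g] unfolding partial_add_C2(1)[OF f g]
  by (intro conjI allI differentiable_add continuous_intros C2_regularity[OF f] C2_regularity[OF g])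

lemma C2_const: "C2 (\<lambda>x. c)"
  unfolding C2_def by simp

lemma C2_inner: "C2 (\<lambda>x. x \<bullet> y)"
  unfolding C2_def by (simp add: differentiableI[OF has_derivative_inner_left[OF has_derivative_ident]])

lemma radial_has_derivative:
  fixes G :: "real \<Rightarrow> real"
  assumes "\<forall>z\<ge>0. (G has_real_derivative G1 z) (at z)"
  shows "((\<lambda>x :: real ^ 'n. G ((norm x)\<^sup>2)) has_derivative (\<lambda>v. 2 * (x \<bullet> v) * G1 ((norm x)\<^sup>2))) (at x)"
proof -
  have n: "((\<lambda>x :: real ^ 'n. (norm x)\<^sup>2) has_derivative (\<lambda>v. 2 * (x \<bullet> v))) (at x)"
    unfolding power2_norm_eq_inner by (auto intro!: derivative_eq_intros simp: inner_commute)
  show ?thesis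
    using has_derivative_compose[OF n, of G "(*) (G1 ((norm x)\<^sup>2))"] assms[rule_format, of "(norm x)\<^sup>2"]
    by (simp add: has_field_derivative_def mult.commute)
qed

lemma partial_radial:
  fixes G :: "real \<Rightarrow> real"
  assumes "\<forall>z\<ge>0. (G has_real_derivative G1 z) (at z)"
  shows "partial i (\<lambda>x. G ((norm x)\<^sup>2)) = (\<lambda>x. 2 * x $ i * G1 ((norm x)\<^sup>2))"
  by (rule ext, subst partial_eqI[OF radial_has_derivative[OF assms]]) (auto simp: inner_axis)

lemma partial_partial_radial:
  fixes G G1 :: "real \<Rightarrow> real"
  assumes G: "\<forall>z\<ge>0. (G has_real_derivative G1 z) (at z)"
    and G1: "\<forall>z\<ge>0. (G1 has_real_derivative G2 z) (at z)"
  shows "partial j (partial i (\<lambda>x. G ((norm x)\<^sup>2))) =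
      (\<lambda>x. 4 * x $ i * x $ j * G2 ((norm x)\<^sup>2) + (if i = j then 2 else 0) * G1 ((norm x)\<^sup>2))"
  unfolding partial_radial[OF G]
  by (rule ext) (simp add: partial_mult partial_radial[OF G1] differentiableI[OF radial_has_derivative[OF G1]])

lemma C2_radial:
  fixes G G1 G2 :: "real \<Rightarrow> real"
  assumes G: "\<forall>z\<ge>0. (G has_real_derivative G1 z) (at z)"
    and G1: "\<forall>z\<ge>0. (G1 has_real_derivative G2 z) (at z)"
    and G2: "continuous_on {0..} G2"
  shows "C2 (\<lambda>x :: real ^ 'n. G ((norm x)\<^sup>2))"
proof -
  have d: "(\<lambda>x :: real ^ 'n. G ((norm x)\<^sup>2)) differentiable (at x)"
     "(\<lambda>x :: real ^ 'n. G1 ((norm x)\<^sup>2)) differentiable (at x)" for x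
    using radial_has_derivative[OF G] radial_has_derivative[OF G1] by (auto intro: differentiableI)
  have c1: "continuous_on UNIV (\<lambda>x :: real ^ 'n. G1 ((norm x)\<^sup>2))"
    using d by (auto simp: continuous_on_eq_continuous_within intro!: differentiable_imp_continuous_within)
  have c2: "continuous_on UNIV (\<lambda>x :: real ^ 'n. G2 ((norm x)\<^sup>2))"
    by (rule continuous_on_compose2[OF G2]) (auto intro!: continuous_intros)
  show ?thesis
    unfolding C2_def partial_partial_radial[OF G G1] unfolding partial_radial[OF G]
    by (intro conjI allI d differentiable_mult differentiable_const differentiable_coordinate continuous_intros c1 c2)
qed

lemma partial_norm_square: "partial i (\<lambda>x. (norm x)\<^sup>2) = (\<lambda>x. 2 * x $ i)"
  using partial_radial[of "\<lambda>z. z" "\<lambda>_. 1"] by simp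

lemma partial_partial_norm_square: "partial j (partial i (\<lambda>x. (norm x)\<^sup>2)) x = (if i = j then 2 else 0)"
  unfolding partial_norm_square by (auto simp: partial_mult)

lemma C2_norm_square: "C2 (\<lambda>x. (norm x)\<^sup>2)"
  using C2_radial[of "\<lambda>z. z" "\<lambda>_. 1" "\<lambda>_. 0"] by simp

definition laplacian :: "(real ^ 'n \<Rightarrow> real) \<Rightarrow> real ^ 'n \<Rightarrow> real" where
  "laplacian f x = (\<Sum>i\<in>UNIV. partial i (partial i f) x)"

lemma laplacian_add: "C2 f \<Longrightarrow> C2 g \<Longrightarrow> laplacian (\<lambda>x. f x + g x) x = laplacian f x + laplacian g x"
  unfolding laplacian_def by (simp only: partial_add_C2(2) sum.distrib)

lemma laplacian_mult:
  assumes "C2 f" "C2 g"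
  shows "laplacian (\<lambda>x. f x * g x) x =
    f x * laplacian g x + laplacian f x * g x + 2 * (\<Sum>i\<in>UNIV. partial i f x * partial i g x)"
  unfolding laplacian_def partial_mult_C2(2)[OF assms]
  by (simp add: sum.distrib sum_distrib_left sum_distrib_right)

lemma laplacian_const [simp]: "laplacian (\<lambda>x. c) x = 0"
  by (simp add: laplacian_def)

lemma laplacian_inner [simp]: "laplacian (\<lambda>x. x \<bullet> y) x = 0"
  by (simp add: laplacian_def)

lemma laplacian_norm_square: "laplacian (\<lambda>x. (norm x)\<^sup>2) x = 2 * real CARD('n)" for x :: "real ^ 'n"
  unfolding laplacian_def partial_partial_norm_square by simp

section \<open>Zonal harmonic polynomials\<close>

text \<open>The solid zonal harmonic \<open>(|x||y|)\<^sup>k C\<^sub>k (cos \<theta>)\<close> is built by the three-term recurrence of the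
  Gegenbauer polynomials, made homogeneous. This keeps it visibly polynomial, hence smooth at the
  origin, and reduces its differential identities to inductions over the recurrence step.\<close>

definition zonal_step :: "real ^ 'n \<Rightarrow> real \<Rightarrow> real \<Rightarrow> (real ^ 'n \<Rightarrow> real) \<Rightarrow> (real ^ 'n \<Rightarrow> real) \<Rightarrow> real ^ 'n \<Rightarrow> real" where
  "zonal_step y a b f g = (\<lambda>x. a * ((x \<bullet> y) * f x) + b * ((norm x)\<^sup>2 * g x))"

lemma C2_zonal_step:
  assumes f: "C2 f" and g: "C2 g" shows "C2 (zonal_step y a b f g)"
  unfolding zonal_step_def by (intro C2_add C2_mult C2_const C2_inner C2_norm_square assms)

lemma partial_zonal_step:
  assumes f: "C2 f" and g: "C2 g"
  shows "partial i (zonal_step y a b f g) x =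
    a * ((x \<bullet> y) * partial i f x + y $ i * f x) + b * ((norm x)\<^sup>2 * partial i g x + 2 * x $ i * g x)"
proof -
  note C = C2_mult[OF C2_inner f] C2_mult[OF C2_norm_square g]
  show ?thesis unfolding zonal_step_def
    by (simp only: partial_add_C2(1)[OF C2_mult[OF C2_const C(1)] C2_mult[OF C2_const C(2)]]
      partial_mult_C2(1)[OF C2_const C(1)] partial_mult_C2(1)[OF C2_const C(2)]
      partial_mult_C2(1)[OF C2_inner f] partial_mult_C2(1)[OF C2_norm_square g]
      partial_const partial_inner partial_norm_square mult_zero_left add_0_right)
qed

lemma directional_zonal_step:
  assumes f: "C2 f" and g: "C2 g"
  shows "(\<Sum>i\<in>UNIV. v $ i * partial i (zonal_step y a b f g) x) =
    a * ((x \<bullet> y) * (\<Sum>i\<in>UNIV. v $ i * partial i f x) + (v \<bullet> y) * f x)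
    + b * ((norm x)\<^sup>2 * (\<Sum>i\<in>UNIV. v $ i * partial i g x) + 2 * (v \<bullet> x) * g x)"
proof -
  have e: "v $ i * partial i (zonal_step y a b f g) x = a * (x \<bullet> y) * (v $ i * partial i f x) + a * f x * (v $ i * y $ i)
    + (b * (norm x)\<^sup>2 * (v $ i * partial i g x) + 2 * b * g x * (v $ i * x $ i))" for i
    unfolding partial_zonal_step[OF f g] by (simp add: algebra_simps)
  show ?thesis
    unfolding e sum.distrib sum_distrib_left[symmetric]
    unfolding inner_vec_def[of v] inner_real_def by (simp add: algebra_simps)
qed

lemma laplacian_zonal_step:
  fixes y :: "real ^ 'n"
  assumes f: "C2 f" and g: "C2 g"
  shows "laplacian (zonal_step y a b f g) x =
    a * ((x \<bullet> y) * laplacian f x + 2 * (\<Sum>i\<in>UNIV. y $ i * partial i f x))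
    + b * ((norm x)\<^sup>2 * laplacian g x + 2 * real CARD('n) * g x + 4 * (\<Sum>i\<in>UNIV. x $ i * partial i g x))"
proof -
  note C = C2_mult[OF C2_inner f] C2_mult[OF C2_norm_square g]
  have 4: "(\<Sum>i\<in>UNIV. 2 * x $ i * partial i g x) = 2 * (\<Sum>i\<in>UNIV. x $ i * partial i g x)"
    by (simp add: sum_distrib_left mult.assoc)
  show ?thesis unfolding zonal_step_def
    by (simp only: laplacian_add[OF C2_mult[OF C2_const C(1)] C2_mult[OF C2_const C(2)]]
      laplacian_mult[OF C2_const C(1)] laplacian_mult[OF C2_const C(2)]
      laplacian_mult[OF C2_inner f] laplacian_mult[OF C2_norm_square g] laplacian_const laplacian_inner
      laplacian_norm_square partial_const partial_inner partial_norm_square 4) simp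
qed

fun zonal :: "real \<Rightarrow> real ^ 'n \<Rightarrow> nat \<Rightarrow> real ^ 'n \<Rightarrow> real" where
  "zonal \<rho> y 0 = (\<lambda>x. 1)"
| "zonal \<rho> y (Suc 0) = (\<lambda>x. 2 * \<rho> * (x \<bullet> y))"
| "zonal \<rho> y (Suc (Suc k)) = zonal_step y (2 * (real k + 1 + \<rho>) / (real k + 2)) (- (real k + 2 * \<rho>) * (norm y)\<^sup>2 / (real k + 2))
     (zonal \<rho> y (Suc k)) (zonal \<rho> y k)"

lemma C2_zonal: "C2 (zonal \<rho> y k)"
proof (induction k rule: induct_nat_012)
  case 1
  then show ?case unfolding zonal.simps by (intro C2_mult C2_const C2_inner)
next
  case (ge2 k)
  then show ?case by (simp add: C2_zonal_step)
qed (simp add: C2_const)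

lemma directional_zonal_1:
  "(\<Sum>i\<in>UNIV. v $ i * partial i (zonal \<rho> y (Suc 0)) x) = 2 * \<rho> * (v \<bullet> y)"
  unfolding zonal.simps partial_mult_C2(1)[OF C2_const C2_inner] inner_vec_def[of v]
  by (simp add: sum_distrib_left mult_ac)

text \<open>Euler's identity for a homogeneous polynomial of degree \<open>k\<close>.\<close>

lemma zonal_Euler: "(\<Sum>i\<in>UNIV. x $ i * partial i (zonal \<rho> y k) x) = k * zonal \<rho> y k x"
proof (induction k rule: induct_nat_012)
  case 0
  then show ?case by simp
next
  case 1
  then show ?case unfolding directional_zonal_1 by simp
next
  case (ge2 k)
  have 1: "x \<bullet> x = (norm x)\<^sup>2" by (simp add: power2_norm_eq_inner)
  show ?case
    unfolding zonal.simps directional_zonal_step[OF C2_zonal C2_zonal] ge2 1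
    unfolding zonal_step_def of_nat_Suc by algebra
qed

text \<open>The derivative along the pole lowers the degree by one. In the induction step the recurrence for
  degree \<open>k + 2\<close>, used backwards, absorbs the terms of degree \<open>k + 1\<close> and \<open>k\<close>.\<close>

lemma zonal_directional_axis:
  "(\<Sum>i\<in>UNIV. y $ i * partial i (zonal \<rho> y (Suc k)) x) = (k + 2 * \<rho>) * (norm y)\<^sup>2 * zonal \<rho> y k x"
proof (induction k rule: induct_nat_012)
  case 0
  then show ?case
    unfolding directional_zonal_1 by (simp add: power2_norm_eq_inner)
next
  case 1
  have 1: "y \<bullet> y = (norm y)\<^sup>2" by (simp add: power2_norm_eq_inner)
  show ?case
    unfolding zonal.simps(3) directional_zonal_step[OF C2_zonal C2_zonal] directional_zonal_1 1
    by (simp add: inner_commute[of y x] field_simps)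
next
  case (ge2 k)
  have 1: "y \<bullet> y = (norm y)\<^sup>2" by (simp add: power2_norm_eq_inner)
  define s where "s = x \<bullet> y"
  define u where "u = (norm x)\<^sup>2"
  define w where "w = (norm y)\<^sup>2"
  define Z0 where "Z0 = zonal \<rho> y k x"
  define Z1 where "Z1 = zonal \<rho> y (Suc k) x"
  have Z2: "zonal \<rho> y (Suc (Suc k)) x = (2 * (real k + 1 + \<rho>) / (real k + 2)) * (s * Z1) + (- (real k + 2 * \<rho>) * w / (real k + 2)) * (u * Z0)"
    by (simp only: zonal.simps zonal_step_def s_def u_def w_def Z0_def Z1_def)
  have "(\<Sum>i\<in>UNIV. y $ i * partial i (zonal \<rho> y (Suc (Suc (Suc k)))) x) =
     (2 * (real (Suc k) + 1 + \<rho>) / (real (Suc k) + 2)) * (s * ((real (Suc k) + 2 * \<rho>) * w * Z1) + w * zonal \<rho> y (Suc (Suc k)) x)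
     + (- (real (Suc k) + 2 * \<rho>) * w / (real (Suc k) + 2)) * (u * ((k + 2 * \<rho>) * w * Z0) + 2 * s * Z1)"
    unfolding zonal.simps(3)[of _ _ "Suc k"] directional_zonal_step[OF C2_zonal C2_zonal] ge2 1 inner_commute[of y x]
    unfolding s_def u_def w_def Z0_def Z1_def by simp
  also have "\<dots> = (real (Suc (Suc k)) + 2 * \<rho>) * w * zonal \<rho> y (Suc (Suc k)) x"
  proof -
    have k: "real k + 2 \<noteq> 0" "real k + 3 \<noteq> 0" by simp_all
    show ?thesis unfolding Z2 of_nat_Suc using k
      by (simp add: divide_simps) algebra
  qed
  finally show ?case by (simp add: w_def)
qed

text \<open>The recurrence step produces a derivative along the pole and a radial derivative; the value
  \<open>2 * \<rho> = n - 2\<close> is exactly what makes the two cancel.\<close>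

lemma zonal_harmonic:
  fixes y :: "real ^ 'n"
  assumes "2 * \<rho> = real CARD('n) - 2"
  shows "laplacian (zonal \<rho> y k) x = 0"
proof (induction k rule: induct_nat_012)
  case 0
  then show ?case by simp
next
  case 1
  then show ?case unfolding zonal.simps laplacian_mult[OF C2_const C2_inner] by simp
next
  case (ge2 k)
  have n: "real CARD('n) = 2 * \<rho> + 2" using assms by simp
  show ?case
    unfolding zonal.simps(3) laplacian_zonal_step[OF C2_zonal C2_zonal] ge2 zonal_directional_axis zonal_Euler n
    by (simp add: field_simps)
qed

text \<open>Separation of variables: the bracket is the hypergeometric operator in \<open>z = |x|\<^sup>2\<close> with parameters
  \<open>k\<close>, \<open>- \<rho>\<close> and \<open>k + n / 2\<close>.\<close>

lemma laplace_beltrami_radial_times_zonal: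
  fixes G G1 G2 :: "real \<Rightarrow> real" and y x :: "real ^ 'n"
  assumes G: "\<forall>z\<ge>0. (G has_real_derivative G1 z) (at z)"
    and G1: "\<forall>z\<ge>0. (G1 has_real_derivative G2 z) (at z)"
    and G2: "continuous_on {0..} G2"
    and \<rho>: "2 * \<rho> = real CARD('n) - 2" and z: "z = (norm x)\<^sup>2"
  shows "laplace_beltrami (\<lambda>x. G ((norm x)\<^sup>2) * zonal \<rho> y k x) x =
    4 * (1 - z) * zonal \<rho> y k x *
      (z * (1 - z) * G2 z + (k + real CARD('n) / 2 - (k - \<rho> + 1) * z) * G1 z + k * \<rho> * G z)"
proof -
  let ?Z = "zonal \<rho> y k" and ?g = "\<lambda>x :: real ^ 'n. G ((norm x)\<^sup>2)"
  note C = C2_radial[OF G G1 G2] C2_zonal[of \<rho> y k]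
  have xx: "(\<Sum>i\<in>UNIV. x $ i * x $ i) = z"
    by (simp add: z power2_norm_eq_inner inner_vec_def)
  have lg: "laplacian ?g x = 4 * z * G2 z + 2 * real CARD('n) * G1 z"
  proof -
    have "laplacian ?g x = (\<Sum>i\<in>UNIV. 4 * G2 z * (x $ i * x $ i) + 2 * G1 z)"
      unfolding laplacian_def partial_partial_radial[OF G G1] z by (simp add: mult_ac)
    also have "\<dots> = 4 * G2 z * z + 2 * real CARD('n) * G1 z"
      unfolding sum.distrib sum_distrib_left[symmetric] xx by simp
    finally show ?thesis by simp
  qed
  have "(\<Sum>i\<in>UNIV. partial i ?g x * partial i ?Z x) = 2 * G1 z * (\<Sum>i\<in>UNIV. x $ i * partial i ?Z x)"
    unfolding partial_radial[OF G] z by (simp add: sum_distrib_left mult_ac)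
  then have l: "laplacian (\<lambda>x. ?g x * ?Z x) x = (4 * z * G2 z + 2 * real CARD('n) * G1 z) * ?Z x + 4 * G1 z * k * ?Z x"
    by (simp add: laplacian_mult[OF C] zonal_harmonic[OF \<rho>] lg zonal_Euler)
  have "(\<Sum>i\<in>UNIV. x $ i * partial i (\<lambda>x. ?g x * ?Z x) x)
     = (\<Sum>i\<in>UNIV. G z * (x $ i * partial i ?Z x) + 2 * G1 z * ?Z x * (x $ i * x $ i))"
    unfolding partial_mult_C2(1)[OF C] unfolding partial_radial[OF G] z by (simp add: algebra_simps)
  also have "\<dots> = G z * (k * ?Z x) + 2 * G1 z * ?Z x * z"
    unfolding sum.distrib sum_distrib_left[symmetric] xx zonal_Euler ..
  finally have d: "(\<Sum>i\<in>UNIV. x $ i * partial i (\<lambda>x. ?g x * ?Z x) x) = G z * (k * ?Z x) + 2 * G1 z * ?Z x * z" .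
  have n: "real CARD('n) = 2 * \<rho> + 2" using \<rho> by simp
  show ?thesis
    unfolding laplace_beltrami_def laplacian_def[symmetric] l d n z[symmetric]
    by (simp add: field_simps power2_eq_square)
qed

section \<open>Gegenbauer polynomials\<close>

definition gegenbauer_fps :: "real \<Rightarrow> real \<Rightarrow> real fps" where
  "gegenbauer_fps v z = fps_binomial (- v) oo (fps_X\<^sup>2 - fps_const (2 * z) * fps_X)"

lemma gegenbauer_eq_nth: "gegenbauer v k z = fps_nth (gegenbauer_fps v z) k"
  by (simp add: gegenbauer_def gegenbauer_fps_def)

lemma gegenbauer_0 [simp]: "gegenbauer v 0 z = 1"
  by (simp add: gegenbauer_def)

text \<open>The differential equation of the generating function \<open>G\<close>, namely
  \<open>(1 - 2 z h + h\<^sup>2) G' = 2 v (z - h) G\<close>; the recurrence, the bounds and the closed form all come from it.\<close>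

lemma gegenbauer_fps_deriv:
  "(1 + (fps_X\<^sup>2 - fps_const (2 * z) * fps_X)) * fps_deriv (gegenbauer_fps v z) =
     fps_const (2 * v) * (fps_const z - fps_X) * gegenbauer_fps v z"
proof -
  let ?A = "fps_binomial (- v)" and ?b = "fps_X\<^sup>2 - fps_const (2 * z) * fps_X :: real fps"
  have b0: "fps_nth ?b 0 = 0" by (simp add: power2_eq_square)
  have x10: "fps_nth (1 + fps_X :: real fps) 0 \<noteq> 0" by simp
  have "(1 + fps_X) * fps_deriv ?A = fps_const (- v) * ?A * ((1 + fps_X) * inverse (1 + fps_X))"
    unfolding fps_binomial_deriv fps_divide_unit[OF x10] by (simp add: mult_ac)
  also have "(1 + fps_X) * inverse (1 + fps_X) = (1 :: real fps)"
    using inverse_mult_eq_1[OF x10] by (simp add: mult.commute)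
  finally have "((1 + fps_X) * fps_deriv ?A) oo ?b = (fps_const (- v) * ?A) oo ?b" by simp
  then have 1: "(1 + ?b) * (fps_deriv ?A oo ?b) = fps_const (- v) * (?A oo ?b)"
    by (simp add: fps_compose_mult_distrib[OF b0] fps_compose_add_distrib b0)
  have 2: "fps_deriv ?b = fps_const 2 * (fps_X - fps_const z)"
    by (rule fps_ext) (auto simp: power2_eq_square numeral_fps_const)
  have "(1 + ?b) * fps_deriv (gegenbauer_fps v z) = ((1 + ?b) * (fps_deriv ?A oo ?b)) * fps_deriv ?b"
    unfolding gegenbauer_fps_def fps_compose_deriv[OF b0] by (simp only: mult.assoc)
  also have "\<dots> = fps_const (- v) * (?A oo ?b) * (fps_const 2 * (fps_X - fps_const z))"
    by (simp only: 1 2)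
  also have "\<dots> = (fps_const (- v) * (fps_const 2 * (fps_X - fps_const z))) * gegenbauer_fps v z"
    unfolding gegenbauer_fps_def by (simp only: mult_ac)
  also have "fps_const (- v) * (fps_const 2 * (fps_X - fps_const z)) = fps_const (2 * v) * (fps_const z - fps_X)"
    by (rule fps_ext) (simp add: algebra_simps)
  finally show ?thesis .
qed

lemma gegenbauer_1: "gegenbauer v (Suc 0) z = 2 * v * z"
  using arg_cong[OF gegenbauer_fps_deriv[of z v], of "\<lambda>f. fps_nth f 0"]
  by (simp add: gegenbauer_eq_nth[symmetric] power2_eq_square)

lemma gegenbauer_recurrence:
  "(real k + 2) * gegenbauer v (Suc (Suc k)) z =
     2 * (real k + 1 + v) * z * gegenbauer v (Suc k) z - (real k + 2 * v) * gegenbauer v k z"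
proof -
  let ?G = "gegenbauer_fps v z"
  have n: "fps_nth ((1 + (fps_X\<^sup>2 - fps_const (2 * z) * fps_X)) * f) (Suc k) =
      fps_nth f (Suc k) + (if k = 0 then 0 else fps_nth f (k - 1)) - 2 * z * fps_nth f k"
    for f :: "real fps"
    by (simp add: distrib_right left_diff_distrib mult.assoc power2_eq_square)
  have m: "fps_nth (fps_const (2 * v) * (fps_const z - fps_X) * f) (Suc k) = 2 * v * (z * fps_nth f (Suc k) - fps_nth f k)" for f :: "real fps"
    by (simp add: left_diff_distrib right_diff_distrib mult.assoc)
  show ?thesis
    using arg_cong[OF gegenbauer_fps_deriv[of z v], of "\<lambda>f. fps_nth f (Suc k)"]
    unfolding n m gegenbauer_eq_nth fps_deriv_nth by (cases k) (simp_all add: algebra_simps)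
qed

lemma continuous_on_gegenbauer: "continuous_on UNIV (gegenbauer v k)"
proof (induction k rule: induct_nat_012)
  case (ge2 k)
  have "gegenbauer v (Suc (Suc k)) = (\<lambda>z. (2 * (real k + 1 + v) * z * gegenbauer v (Suc k) z - (real k + 2 * v) * gegenbauer v k z) / (real k + 2))"
    using gegenbauer_recurrence[of k v] by (auto simp: fun_eq_iff field_simps)
  then show ?case using ge2 by (auto intro!: continuous_intros)
next
  case 1
  have "gegenbauer v (Suc 0) = (\<lambda>z. 2 * v * z)" by (simp add: fun_eq_iff gegenbauer_1)
  then show ?case by (simp add: continuous_intros)
next
  case 0
  have "gegenbauer v 0 = (\<lambda>z. 1)" by (simp add: fun_eq_iff)
  then show ?case by simp
qed

text \<open>Since \<open>(cos \<theta> - h) / (1 - 2 h cos \<theta> + h\<^sup>2)\<close> has the coefficients \<open>cos ((j + 1) \<theta>)\<close>, dividing the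
  differential equation by the quadratic gives a recursion in which, for \<open>v \<ge> 0\<close>, every
  cosine can be bounded by its value at \<open>\<theta> = 0\<close>.\<close>

lemma gegenbauer_cos_sum:
  "real (Suc k) * gegenbauer v (Suc k) (cos \<theta>) =
     2 * v * (\<Sum>j\<le>k. cos (real (Suc j) * \<theta>) * gegenbauer v (k - j) (cos \<theta>))"
proof -
  let ?q = "1 + (fps_X\<^sup>2 - fps_const (2 * cos \<theta>) * fps_X)" and ?G = "gegenbauer_fps v (cos \<theta>)"
  let ?T = "Abs_fps (\<lambda>j. cos (real (Suc j) * \<theta>))"
  have T: "?q * ?T = fps_const (cos \<theta>) - fps_X"
  proof (rule fps_ext)
    fix m
    consider "m = 0" | "m = Suc 0" | j where "m = Suc (Suc j)"
      by (metis not0_implies_Suc)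
    then show "fps_nth (?q * ?T) m = fps_nth (fps_const (cos \<theta>) - fps_X) m"
    proof cases
      case 1
      then show ?thesis by (simp add: power2_eq_square)
    next
      case 2
      have "cos (2 * \<theta>) = 2 * (cos \<theta>)\<^sup>2 - 1" by (rule cos_double_cos)
      with 2 show ?thesis
        by (simp add: distrib_right left_diff_distrib mult.assoc power2_eq_square)
    next
      case 3
      have "cos (real (Suc (Suc (Suc j))) * \<theta>) + cos (real (Suc j) * \<theta>) = 2 * cos \<theta> * cos (real (Suc (Suc j)) * \<theta>)"
      proof -
        have a: "real (Suc (Suc (Suc j))) * \<theta> = real (Suc (Suc j)) * \<theta> + \<theta>"
          "real (Suc j) * \<theta> = real (Suc (Suc j)) * \<theta> - \<theta>" by (simp_all add: algebra_simps)
        show ?thesis unfolding a cos_add cos_diff by simp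
      qed
      with 3 show ?thesis
        by (simp add: distrib_right left_diff_distrib mult.assoc power2_eq_square)
    qed
  qed
  have q0: "?q \<noteq> 0"
  proof
    assume "?q = 0"
    then have "fps_nth ?q 0 = fps_nth 0 0" by (rule arg_cong)
    then show False by (simp add: power2_eq_square)
  qed
  have "?q * fps_deriv ?G = ?q * (fps_const (2 * v) * ?T * ?G)"
    unfolding gegenbauer_fps_deriv T[symmetric] by (simp only: mult_ac)
  then have "fps_deriv ?G = fps_const (2 * v) * (?T * ?G)" using q0 by (simp add: mult.assoc)
  from arg_cong[OF this, of "\<lambda>f. fps_nth f k"] show ?thesis
    unfolding fps_deriv_nth fps_mult_left_const_nth fps_mult_nth[of ?T] fps_nth_Abs_fps
    by (simp add: gegenbauer_eq_nth atMost_atLeast0 del: of_nat_Suc)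
qed

lemma pochhammer_fact_sum:
  "real (Suc k) * (pochhammer a (Suc k) / fact (Suc k)) = a * (\<Sum>j\<le>k. pochhammer a (k - j) / fact (k - j))" for a :: real
proof (induction k)
  case 0
  then show ?case by simp
next
  case (Suc k)
  let ?P = "\<lambda>k. pochhammer a k / fact k"
  have "(\<Sum>j\<le>Suc k. ?P (Suc k - j)) = ?P (Suc k) + (\<Sum>j\<le>k. ?P (k - j))"
    by (subst sum.atMost_Suc_shift) (simp only: diff_zero diff_Suc_Suc)
  then have "a * (\<Sum>j\<le>Suc k. ?P (Suc k - j)) = a * ?P (Suc k) + a * (\<Sum>j\<le>k. ?P (k - j))"
    by (simp only: distrib_left)
  also have "\<dots> = (a + real (Suc k)) * ?P (Suc k)"
    by (simp only: Suc[symmetric] distrib_right)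
  also have "\<dots> = real (Suc (Suc k)) * ?P (Suc (Suc k))"
    unfolding pochhammer_Suc[of a "Suc k"] fact_Suc[of "Suc k"] of_nat_mult by simp
  finally show ?case by (rule sym)
qed

lemma gegenbauer_one: "gegenbauer v k 1 = pochhammer (2 * v) k / fact k"
proof (induction k rule: less_induct)
  case (less k)
  show ?case
  proof (cases k)
    case (Suc m)
    have "real (Suc m) * gegenbauer v (Suc m) 1 = 2 * v * (\<Sum>j\<le>m. gegenbauer v (m - j) 1)"
      using gegenbauer_cos_sum[of m v 0] by simp
    also have "(\<Sum>j\<le>m. gegenbauer v (m - j) 1) = (\<Sum>j\<le>m. pochhammer (2 * v) (m - j) / fact (m - j))"
      using Suc by (intro sum.cong refl less) auto
    also have "2 * v * \<dots> = real (Suc m) * (pochhammer (2 * v) (Suc m) / fact (Suc m))"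
      by (rule pochhammer_fact_sum[symmetric])
    finally have "gegenbauer v (Suc m) 1 = pochhammer (2 * v) (Suc m) / fact (Suc m)"
      by (subst (asm) mult_left_cancel) (simp_all only: of_nat_eq_0_iff nat.distinct not_False_eq_True)
    then show ?thesis using Suc by (simp only:)
  qed simp
qed

text \<open>Bounding every cosine by 1 in the recursion turns it into the recursion for the values at 1.\<close>

lemma abs_gegenbauer_cos_le:
  assumes "0 \<le> v"
  shows "\<bar>gegenbauer v k (cos \<theta>)\<bar> \<le> gegenbauer v k 1"
proof (induction k rule: less_induct)
  case (less k)
  show ?case
  proof (cases k)
    case (Suc m)
    have "real (Suc m) * \<bar>gegenbauer v (Suc m) (cos \<theta>)\<bar> = 2 * v * \<bar>\<Sum>j\<le>m. cos (real (Suc j) * \<theta>) * gegenbauer v (m - j) (cos \<theta>)\<bar>"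
      using arg_cong[OF gegenbauer_cos_sum[of m v \<theta>], of abs] assms by (simp add: abs_mult)
    also have "\<dots> \<le> 2 * v * (\<Sum>j\<le>m. \<bar>cos (real (Suc j) * \<theta>) * gegenbauer v (m - j) (cos \<theta>)\<bar>)"
      using assms by (intro mult_left_mono sum_abs) auto
    also have "\<dots> \<le> 2 * v * (\<Sum>j\<le>m. 1 * gegenbauer v (m - j) 1)"
      unfolding abs_mult using assms Suc
      by (intro mult_left_mono sum_mono mult_mono less) (auto simp: abs_cos_le_one)
    also have "\<dots> = real (Suc m) * gegenbauer v (Suc m) 1"
      using gegenbauer_cos_sum[of m v 0] by simp
    finally show ?thesis using Suc by (simp del: of_nat_Suc)
  qed simp
qed

lemma abs_gegenbauer_le:
  assumes "0 \<le> v" "\<bar>t\<bar> \<le> 1"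
  shows "\<bar>gegenbauer v k t\<bar> \<le> gegenbauer v k 1"
  using abs_gegenbauer_cos_le[OF assms(1), of k "arccos t"] assms(2) by (simp add: cos_arccos_abs)

lemma gegenbauer_one_pos: "0 < v \<Longrightarrow> 0 < gegenbauer v k 1"
  unfolding gegenbauer_one by (intro divide_pos_pos pochhammer_pos) auto

text \<open>The values at 1 grow polynomially, so that the ratio of consecutive terms tends to \<open>q\<close>.\<close>

lemma gegenbauer_majorant_summable:
  assumes v: "0 < v" and q: "0 \<le> q" "q < 1"
  shows "summable (\<lambda>k. (real k + v) / v * gegenbauer v k 1 * q ^ k)"
proof -
  let ?m = "\<lambda>k. (real k + v) / v * gegenbauer v k 1 * q ^ k"
  let ?R = "\<lambda>k. ((2 * v + real k) * (real k + 1 + v) / ((real k + 1) * (real k + v)) * q)"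
  have "(\<lambda>k. (2 * v + real k) * (real k + 1 + v) / ((real k + 1) * (real k + v))) \<longlonglongrightarrow> 1" by real_asymp
  from tendsto_mult_right[OF this, of q]
  have "?R \<longlonglongrightarrow> q" by simp
  then have "\<forall>\<^sub>F k in sequentially. ?R k < (1 + q) / 2"
    by (rule order_tendstoD) (use q in simp)
  then obtain N where N: "\<And>k. N \<le> k \<Longrightarrow> ?R k \<le> (1 + q) / 2"
    by (auto simp: eventually_sequentially intro: less_imp_le)
  show ?thesis
  proof (rule summable_ratio_test[of "(1 + q) / 2" N])
    fix n assume "N \<le> n"
    then have "?R n \<le> (1 + q) / 2" by (rule N)
    moreover have "?m (Suc n) =
      ?R n * ?m n"
      using v unfolding gegenbauer_one pochhammer_Suc fact_Suc
      by (simp add: divide_simps) (simp add: algebra_simps)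
    moreover have A: "0 \<le> ?m n"
      using v q gegenbauer_one_pos[OF v, of n] by simp
    moreover have "0 \<le> ?R n" using v q by simp
    ultimately have "?m (Suc n)
        \<le> (1 + q) / 2 * ?m n"
      "0 \<le> ?m (Suc n)"
      by (simp_all only: mult_right_mono mult_nonneg_nonneg)
    with A show "norm (?m (Suc n))
      \<le> (1 + q) / 2 * norm (?m n)"
      by (simp only: real_norm_def abs_of_nonneg)
  qed (use q in simp)
qed

lemma gegenbauer_fps_conv_radius:
  assumes "0 < v" "\<bar>t\<bar> \<le> 1"
  shows "1 \<le> fps_conv_radius (gegenbauer_fps v t)"
  unfolding fps_conv_radius_def
proof (rule conv_radius_geI_ex)
  fix q :: real assume q: "0 < q" "ereal q < 1"
  have "summable (\<lambda>k. fps_nth (gegenbauer_fps v t) k * q ^ k)"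
  proof (rule summable_comparison_test'[OF gegenbauer_majorant_summable[of v q]])
    fix k :: nat
    have "norm (fps_nth (gegenbauer_fps v t) k * q ^ k) \<le> 1 * gegenbauer v k 1 * q ^ k"
      using abs_gegenbauer_le[of v t k] assms q
      by (auto simp: gegenbauer_eq_nth abs_mult intro!: mult_right_mono)
    also have "\<dots> \<le> (real k + v) / v * gegenbauer v k 1 * q ^ k"
      using assms q gegenbauer_one_pos[of v k] by (intro mult_right_mono) (auto simp: field_simps)
    finally show "norm (fps_nth (gegenbauer_fps v t) k * q ^ k) \<le> (real k + v) / v * gegenbauer v k 1 * q ^ k" .
  qed (use assms q in auto)
  then show "\<exists>z. norm z = q \<and> summable (\<lambda>k. fps_nth (gegenbauer_fps v t) k * z ^ k)"
    using q by (intro exI[of _ q]) auto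
qed

lemma generating_quadratic_pos:
  fixes t h :: real
  assumes "\<bar>t\<bar> \<le> 1" "\<bar>h\<bar> < 1"
  shows "0 < 1 - 2 * t * h + h\<^sup>2"
proof -
  have "t * h \<le> \<bar>h\<bar>" using mult_right_mono[OF assms(1), of "\<bar>h\<bar>"] by (simp add: abs_mult[symmetric] abs_le_iff)
  then have "(1 - \<bar>h\<bar>)\<^sup>2 \<le> 1 - 2 * t * h + h\<^sup>2" by (simp add: power2_eq_square algebra_simps)
  moreover have "0 < (1 - \<bar>h\<bar>)\<^sup>2" using assms by simp
  ultimately show ?thesis by linarith
qed

text \<open>By the differential equation, the quotient of the series by the expected power is constant.\<close>

lemma eval_gegenbauer_fps:
  assumes v: "0 < v" and t: "\<bar>t\<bar> \<le> 1" and h: "\<bar>h\<bar> < 1"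
  shows "eval_fps (gegenbauer_fps v t) h = (1 - 2 * t * h + h\<^sup>2) powr (- v)"
    and "eval_fps (fps_deriv (gegenbauer_fps v t)) h =
      2 * v * (t - h) / (1 - 2 * t * h + h\<^sup>2) * (1 - 2 * t * h + h\<^sup>2) powr (- v)"
proof -
  let ?G = "gegenbauer_fps v t" and ?Q = "\<lambda>h. 1 - 2 * t * h + h\<^sup>2"
  have r: "ereal \<bar>x\<bar> < fps_conv_radius ?G" "ereal \<bar>x\<bar> < fps_conv_radius (fps_deriv ?G)" if "\<bar>x\<bar> < 1" for x
  proof -
    have "ereal \<bar>x\<bar> < 1" using that by simp
    also have "1 \<le> fps_conv_radius ?G" by (rule gegenbauer_fps_conv_radius[OF v t])
    finally show "ereal \<bar>x\<bar> < fps_conv_radius ?G" .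
    then show "ereal \<bar>x\<bar> < fps_conv_radius (fps_deriv ?G)"
      using fps_conv_radius_deriv[of ?G] by (rule less_le_trans)
  qed
  have ode: "?Q x * eval_fps (fps_deriv ?G) x = 2 * v * (t - x) * eval_fps ?G x" if "\<bar>x\<bar> < 1" for x
  proof -
    let ?p = "fps_of_poly [:1, - 2 * t, 1:] :: real fps" and ?s = "fps_of_poly [:2 * v * t, - 2 * v:] :: real fps"
    have p: "1 + (fps_X\<^sup>2 - fps_const (2 * t) * fps_X) = ?p"
      by (rule fps_ext) (auto simp: coeff_pCons power2_eq_square split: nat.split)
    have s: "fps_const (2 * v) * (fps_const t - fps_X) = ?s"
      by (rule fps_ext) (auto simp: coeff_pCons split: nat.split)
    have "?p * fps_deriv ?G = ?s * ?G"
      using gegenbauer_fps_deriv[of t v] unfolding p s .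
    then have "eval_fps (?p * fps_deriv ?G) x = eval_fps (?s * ?G) x" by simp
    then show ?thesis
      using r[OF that] by (simp add: eval_fps_mult power2_eq_square algebra_simps)
  qed
  define \<phi> where "\<phi> x = eval_fps ?G x * ?Q x powr v" for x
  have d: "(\<phi> has_real_derivative 0) (at x within ball 0 1)" if "x \<in> ball 0 1" for x
  proof -
    have x: "\<bar>x\<bar> < 1" using that by simp
    have Q: "0 < ?Q x" by (rule generating_quadratic_pos[OF t x])
    have dQ: "(?Q has_real_derivative (2 * x - 2 * t)) (at x)"
      by (auto intro!: derivative_eq_intros)
    note dp = DERIV_chain2[OF has_real_derivative_powr[OF Q, of v] dQ]
    have Qv: "?Q x powr v = ?Q x * ?Q x powr (v - 1)"
      using powr_mult_base[of "?Q x" "v - 1"] Q by simp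
    have "(\<phi> has_real_derivative
        eval_fps (fps_deriv ?G) x * ?Q x powr v + v * ?Q x powr (v - 1) * (2 * x - 2 * t) * eval_fps ?G x) (at x)"
      unfolding \<phi>_def
      by (rule DERIV_mult[OF has_field_derivative_eval_fps dp]) (use r[OF x] in simp)
    also have "eval_fps (fps_deriv ?G) x * ?Q x powr v + v * ?Q x powr (v - 1) * (2 * x - 2 * t) * eval_fps ?G x =
      ?Q x powr (v - 1) * (?Q x * eval_fps (fps_deriv ?G) x - 2 * v * (t - x) * eval_fps ?G x)"
      unfolding Qv by (simp only: algebra_simps)
    also have "\<dots> = 0" using ode[OF x] by simp
    finally show ?thesis by (rule has_field_derivative_at_within)
  qed
  have "\<phi> h = \<phi> 0"
  proof -
    obtain c where "\<And>x. x \<in> ball 0 1 \<Longrightarrow> \<phi> x = c"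
      using has_field_derivative_zero_constant[OF convex_ball d] by blast
    then show ?thesis using h by simp
  qed
  also have "\<phi> 0 = 1"
    by (simp add: \<phi>_def eval_fps_at_0 gegenbauer_eq_nth[symmetric])
  finally have "eval_fps ?G h * ?Q h powr v = 1" by (simp add: \<phi>_def)
  then show 1: "eval_fps ?G h = ?Q h powr (- v)"
    using generating_quadratic_pos[OF t h] by (simp add: powr_minus inverse_eq_divide nonzero_eq_divide_eq)
  show "eval_fps (fps_deriv ?G) h = 2 * v * (t - h) / ?Q h * ?Q h powr (- v)"
  proof -
    have e: "E = a / Q * w" if "Q * E = a * w" "0 < Q" for E a Q w :: real
      using that by (simp add: field_simps)
    show ?thesis
      by (rule e[OF _ generating_quadratic_pos[OF t h]]) (simp only: ode[OF h] 1)
  qed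
qed

text \<open>Apply \<open>1 + (h / v) d/dh\<close> to the generating function. The outcome is the expansion of the Euclidean
  Poisson kernel.\<close>

lemma gegenbauer_poisson_sums:
  assumes v: "0 < v" and t: "\<bar>t\<bar> \<le> 1" and h: "\<bar>h\<bar> < 1"
  shows "(\<lambda>k. (real k + v) / v * h ^ k * gegenbauer v k t) sums
    ((1 - h\<^sup>2) / (1 - 2 * t * h + h\<^sup>2) powr (v + 1))"
proof -
  let ?G = "gegenbauer_fps v t" and ?Q = "1 - 2 * t * h + h\<^sup>2"
  have Q: "0 < ?Q" by (rule generating_quadratic_pos[OF t h])
  have r: "ereal (norm h) < fps_conv_radius ?G"
  proof -
    have "ereal (norm h) < 1" using h by simp
    also have "1 \<le> fps_conv_radius ?G" by (rule gegenbauer_fps_conv_radius[OF v t])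
    finally show ?thesis .
  qed
  have r': "ereal (norm h) < fps_conv_radius (fps_X * fps_deriv ?G)"
  proof -
    have "ereal (norm h) < fps_conv_radius (fps_deriv ?G)"
      using r fps_conv_radius_deriv[of ?G] by (rule less_le_trans)
    also have "\<dots> \<le> fps_conv_radius (fps_X * fps_deriv ?G)"
      using fps_conv_radius_mult[of fps_X "fps_deriv ?G"] by simp
    finally show ?thesis .
  qed
  have d: "ereal (norm h) < fps_conv_radius (fps_deriv ?G)"
    using r fps_conv_radius_deriv[of ?G] by (rule less_le_trans)
  have s1: "(\<lambda>k. fps_nth ?G k * h ^ k) sums eval_fps ?G h"
    unfolding eval_fps_def by (rule summable_sums[OF summable_fps[OF r]])
  have s2: "(\<lambda>k. fps_nth (fps_X * fps_deriv ?G) k * h ^ k) sums eval_fps (fps_X * fps_deriv ?G) h"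
    unfolding eval_fps_def by (rule summable_sums[OF summable_fps[OF r']])
  have S: "(\<lambda>k. fps_nth (fps_X * fps_deriv ?G) k * h ^ k / v + fps_nth ?G k * h ^ k) sums
      (eval_fps (fps_X * fps_deriv ?G) h / v + eval_fps ?G h)"
    by (rule sums_add[OF sums_divide[OF s2] s1])
  have c: "fps_nth (fps_X * fps_deriv ?G) k * h ^ k / v + fps_nth ?G k * h ^ k = (real k + v) / v * h ^ k * gegenbauer v k t" for k
  proof -
    have "fps_nth (fps_X * fps_deriv ?G) k = real k * gegenbauer v k t"
      by (cases k) (simp_all add: gegenbauer_eq_nth)
    then show ?thesis
      using v by (simp add: gegenbauer_eq_nth[symmetric] divide_simps) (simp add: algebra_simps)
  qed
  have e: "eval_fps (fps_X * fps_deriv ?G) h / v + eval_fps ?G h = (1 - h\<^sup>2) / ?Q powr (v + 1)"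
  proof -
    have "eval_fps (fps_X * fps_deriv ?G) h = h * eval_fps (fps_deriv ?G) h"
      using d by (subst eval_fps_mult) auto
    also have "\<dots> / v + eval_fps ?G h = (2 * h * (t - h) + ?Q) / ?Q * ?Q powr (- v)"
    proof -
      have e: "h * (2 * v * d / Q * w) / v + w = (2 * h * d + Q) / Q * w" if "0 < Q" for d Q w
        using that v by (simp add: field_simps)
      show ?thesis unfolding eval_gegenbauer_fps[OF v t h] by (rule e[OF Q])
    qed
    also have "2 * h * (t - h) + ?Q = 1 - h\<^sup>2" by (simp add: power2_eq_square algebra_simps)
    also have "(1 - h\<^sup>2) / ?Q * ?Q powr (- v) = (1 - h\<^sup>2) / ?Q powr (v + 1)"
      unfolding powr_add powr_minus using Q by (simp add: inverse_eq_divide)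
    finally show ?thesis by simp
  qed
  show ?thesis using S unfolding c e .
qed

section \<open>The hypergeometric factor\<close>

definition hyp_fps :: "real \<Rightarrow> real \<Rightarrow> real \<Rightarrow> real fps" where
  "hyp_fps a b c = Abs_fps (\<lambda>i. pochhammer a i * pochhammer b i / (pochhammer c i * fact i))"

lemma hypergeometric_eq_eval: "hypergeometric a b c = eval_fps (hyp_fps a b c)"
  by (simp add: fun_eq_iff hypergeometric_def eval_fps_def hyp_fps_def)

text \<open>Stated without division, so that vanishing coefficients cause no case distinction.\<close>

lemma hyp_fps_Suc:
  assumes "0 < c"
  shows "(real i + 1) * (c + real i) * fps_nth (hyp_fps a b c) (Suc i) = (a + real i) * (b + real i) * fps_nth (hyp_fps a b c) i"
proof -
  have "pochhammer c i \<noteq> 0" using pochhammer_pos[OF assms, of i] by simp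
  moreover have "c + real i \<noteq> 0" using assms by simp
  ultimately show ?thesis
    unfolding hyp_fps_def fps_nth_Abs_fps pochhammer_Suc fact_Suc
    by (simp add: divide_simps)
qed

lemma hyp_fps_conv_radius:
  assumes c: "0 < c"
  shows "1 \<le> fps_conv_radius (hyp_fps a b c)"
  unfolding fps_conv_radius_def
proof (rule conv_radius_geI_ex)
  fix q :: real assume q: "0 < q" "ereal q < 1"
  then have q1: "q < 1" by simp
  let ?h = "fps_nth (hyp_fps a b c)"
  let ?R = "\<lambda>i. (a + real i) * (b + real i) / ((real i + 1) * (c + real i))"
  have "?R \<longlonglongrightarrow> 1" by real_asymp
  then have "(\<lambda>i. \<bar>?R i\<bar> * q) \<longlonglongrightarrow> \<bar>1\<bar> * q" by (intro tendsto_intros)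
  then have "\<forall>\<^sub>F i in sequentially. \<bar>?R i\<bar> * q < (1 + q) / 2"
    by (rule order_tendstoD) (use q1 in simp)
  then obtain N where N: "\<And>i. N \<le> i \<Longrightarrow> \<bar>?R i\<bar> * q \<le> (1 + q) / 2"
    by (auto simp: eventually_sequentially intro: less_imp_le)
  have "summable (\<lambda>i. ?h i * q ^ i)"
  proof (rule summable_ratio_test[of "(1 + q) / 2" N])
    fix i assume "N \<le> i"
    have "?h (Suc i) = ?R i * ?h i"
    proof -
      have "(real i + 1) * (c + real i) \<noteq> 0" using c by simp
      with hyp_fps_Suc[OF c, of i a b] show ?thesis by (simp add: field_simps)
    qed
    then have "norm (?h (Suc i) * q ^ Suc i) = \<bar>?R i\<bar> * q * norm (?h i * q ^ i)"
      using q by (simp only: abs_mult real_norm_def power_Suc mult_ac abs_of_pos)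
    also have "\<dots> \<le> (1 + q) / 2 * norm (?h i * q ^ i)"
      using N[OF \<open>N \<le> i\<close>] by (rule mult_right_mono) simp
    finally show "norm (?h (Suc i) * q ^ Suc i) \<le> (1 + q) / 2 * norm (?h i * q ^ i)" .
  qed (use q1 in simp)
  then show "\<exists>z. norm z = q \<and> summable (\<lambda>k. ?h k * z ^ k)"
    using q by (intro exI[of _ q]) auto
qed

lemma hyp_fps_ODE:
  assumes c: "0 < c"
  shows "fps_X * (1 - fps_X) * fps_deriv (fps_deriv (hyp_fps a b c)) +
     (fps_const c - fps_const (a + b + 1) * fps_X) * fps_deriv (hyp_fps a b c) = fps_const (a * b) * hyp_fps a b c"
proof (rule fps_ext)
  fix i
  show "fps_nth (fps_X * (1 - fps_X) * fps_deriv (fps_deriv (hyp_fps a b c)) +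
     (fps_const c - fps_const (a + b + 1) * fps_X) * fps_deriv (hyp_fps a b c)) i = fps_nth (fps_const (a * b) * hyp_fps a b c) i"
  proof (cases i)
    case 0
    then show ?thesis
      using hyp_fps_Suc[OF c, of 0 a b] by (simp add: mult.assoc left_diff_distrib)
  next
    case (Suc j)
    then show ?thesis
      using hyp_fps_Suc[OF c, of "Suc j" a b]
      by (cases j) (simp_all add: mult.assoc left_diff_distrib right_diff_distrib algebra_simps)
  qed
qed

lemma hyp_conv_radius_less:
  fixes z :: real
  assumes c: "0 < c" and z: "\<bar>z\<bar> < 1"
  shows "ereal (norm z) < fps_conv_radius (hyp_fps a b c)"
    "ereal (norm z) < fps_conv_radius (fps_deriv (hyp_fps a b c))"
    "ereal (norm z) < fps_conv_radius (fps_deriv (fps_deriv (hyp_fps a b c)))"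
proof -
  have "ereal (norm z) < 1" using z by simp
  also have "1 \<le> fps_conv_radius (hyp_fps a b c)" by (rule hyp_fps_conv_radius[OF c])
  finally show 0: "ereal (norm z) < fps_conv_radius (hyp_fps a b c)" .
  then show 1: "ereal (norm z) < fps_conv_radius (fps_deriv (hyp_fps a b c))"
    using fps_conv_radius_deriv by (rule less_le_trans)
  then show "ereal (norm z) < fps_conv_radius (fps_deriv (fps_deriv (hyp_fps a b c)))"
    using fps_conv_radius_deriv by (rule less_le_trans)
qed

lemma hypergeometric_ODE:
  fixes a b c z :: real
  assumes c: "0 < c" and z: "\<bar>z\<bar> < 1"
  defines "F \<equiv> hyp_fps a b c"
  shows "z * (1 - z) * eval_fps (fps_deriv (fps_deriv F)) z +
     (c - (a + b + 1) * z) * eval_fps (fps_deriv F) z = a * b * eval_fps F z"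
proof -
  note r = hyp_conv_radius_less[OF c z, of a b, folded F_def]
  have p: "fps_X * (1 - fps_X) = fps_of_poly [:0, 1, -1 :: real:]"
    by (rule fps_ext) (auto simp: coeff_pCons split: nat.split)
  have s: "fps_const c - fps_const (a + b + 1) * fps_X = fps_of_poly [:c, - (a + b + 1):]"
    by (rule fps_ext) (auto simp: coeff_pCons split: nat.split)
  have k: "fps_const (a * b) = fps_of_poly [:a * b:]"
    by (rule fps_ext) (auto simp: coeff_pCons split: nat.split)
  have r': "ereal (norm z) < fps_conv_radius (fps_of_poly q * f)" if "ereal (norm z) < fps_conv_radius f" for q and f :: "real fps"
  proof -
    have "fps_conv_radius f \<le> fps_conv_radius (fps_of_poly q * f)"
      using fps_conv_radius_mult[of "fps_of_poly q" f] by simp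
    with that show ?thesis by (rule less_le_trans)
  qed
  have e: "eval_fps (fps_of_poly q * f) z = poly q z * eval_fps f z" if "ereal (norm z) < fps_conv_radius f" for q f
    using that by (subst eval_fps_mult) simp_all
  let ?L = "eval_fps (fps_of_poly [:0, 1, -1:] * fps_deriv (fps_deriv F) + fps_of_poly [:c, - (a + b + 1):] * fps_deriv F) z"
  have "?L
     = eval_fps (fps_of_poly [:a * b:] * F) z"
    using hyp_fps_ODE[OF c, of a b] unfolding F_def p s k by (rule arg_cong)
  moreover have "?L
     = poly [:0, 1, -1:] z * eval_fps (fps_deriv (fps_deriv F)) z + poly [:c, - (a + b + 1):] z * eval_fps (fps_deriv F) z"
    by (simp only: eval_fps_add[OF r'[OF r(3)] r'[OF r(2)]] e[OF r(3)] e[OF r(2)])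
  moreover have "eval_fps (fps_of_poly [:a * b:] * F) z = poly [:a * b:] z * eval_fps F z"
    by (rule e[OF r(1)])
  ultimately show ?thesis by (simp add: algebra_simps)
qed

lemma hypergeometric_0 [simp]: "hypergeometric a b c 0 = 1"
  by (simp add: hypergeometric_eq_eval eval_fps_at_0 hyp_fps_def)

lemma hypergeometric_0_left: "hypergeometric 0 b c z = 1"
proof -
  have "(\<lambda>i. fps_nth (hyp_fps 0 b c) i * z ^ i) = (\<lambda>i. if i = 0 then 1 else 0)"
    by (auto simp: hyp_fps_def fun_eq_iff pochhammer_0_left)
  moreover have "(\<lambda>i. if i = 0 then 1 else 0 :: real) sums 1"
    using sums_single[of 0 "\<lambda>_. 1 :: real"] by simp
  ultimately show ?thesis
    by (simp add: hypergeometric_eq_eval eval_fps_def sums_iff)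
qed

lemma pochhammer_ratio_le_1:
  fixes a c :: real
  assumes "0 \<le> a" "a \<le> c" "0 < c"
  shows "0 \<le> pochhammer a i / pochhammer c i" "pochhammer a i / pochhammer c i \<le> 1"
proof -
  have "0 \<le> pochhammer a i \<and> pochhammer a i \<le> pochhammer c i"
  proof (induction i)
    case (Suc i)
    then show ?case using assms by (auto simp: pochhammer_Suc intro!: mult_mono)
  qed simp
  with pochhammer_pos[OF assms(3), of i]
  show "0 \<le> pochhammer a i / pochhammer c i" "pochhammer a i / pochhammer c i \<le> 1" by auto
qed

text \<open>The coefficients are dominated by those of the binomial series, to which they converge. This bounds
  quotients of values of \<open>F\<^sub>k\<close> uniformly in \<open>k\<close>, because the limit is not zero.\<close>

lemma hypergeometric_large_parameter:
  assumes d: "0 \<le> d" and z: "0 \<le> z" "z < 1"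
  shows "(\<lambda>k. hypergeometric (real k) b (real k + d) z) \<longlonglongrightarrow> (1 - z) powr (- b)"
proof -
  let ?M = "\<lambda>i. norm (pochhammer b i / fact i * z ^ i)"
  let ?a = "\<lambda>i k. pochhammer (real k) i * pochhammer b i / (pochhammer (real k + d) i * fact i) * z ^ i"
  have B: "(\<lambda>i. pochhammer b i / fact i * z ^ i) sums (1 - z) powr (- b)"
  proof -
    have "(- b gchoose i) * (- z) ^ i = pochhammer b i / fact i * z ^ i" for i
    proof -
      have "(- 1) ^ i * (- 1) ^ i = (1 :: real)" by (simp flip: power_mult_distrib)
      then have "(- b gchoose i) * (- z) ^ i = ((- 1) ^ i * (- 1) ^ i) * (pochhammer b i / fact i * z ^ i)"
        unfolding gbinomial_pochhammer power_minus[of z] by (simp only: minus_minus times_divide_eq_left times_divide_eq_right mult_ac)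
      with \<open>(- 1) ^ i * (- 1) ^ i = 1\<close> show ?thesis by (simp only: mult_1_left)
    qed
    then show ?thesis using gen_binomial_real[of "- z" "- b"] z by simp
  qed
  have r: "(\<lambda>k. pochhammer (real k) i / pochhammer (real k + d) i) \<longlonglongrightarrow> 1" for i
  proof (induction i)
    case (Suc i)
    have "(\<lambda>k. (real k + real i) / (real k + d + real i)) \<longlonglongrightarrow> 1" by real_asymp
    from tendsto_mult[OF Suc this] show ?case by (simp add: pochhammer_Suc)
  qed simp
  have M: "summable ?M"
  proof -
    have "ereal (norm z) < fps_conv_radius (hyp_fps 1 b 1)"
      using hyp_conv_radius_less(1)[of 1 z 1 b] z by simp
    from norm_summable_fps[OF this] show ?thesis
      by (simp add: hyp_fps_def pochhammer_fact[symmetric])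
  qed
  have "((\<lambda>k. \<Sum>i. ?a i k) \<longlongrightarrow> (\<Sum>i. pochhammer b i / fact i * z ^ i)) sequentially"
  proof (rule tannerys_theorem[THEN conjunct2, THEN conjunct2])
    show "?a i \<longlonglongrightarrow> pochhammer b i / fact i * z ^ i" for i
      using tendsto_mult_right[OF r[of i], of "pochhammer b i / fact i * z ^ i"] by (simp add: mult.assoc)
    show "summable ?M" by (rule M)
    \<comment> \<open>For \<open>k = 0\<close> and \<open>d = 0\<close> the quotient of Pochhammer symbols would be \<open>0 / 0\<close>.\<close>
    have "norm (?a i k) \<le> ?M i" if "1 \<le> k" for i k
    proof -
      have "?a i k = (pochhammer (real k) i / pochhammer (real k + d) i) * (pochhammer b i / fact i * z ^ i)"
        by (simp add: mult_ac)
      moreover have "0 \<le> pochhammer (real k) i / pochhammer (real k + d) i"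
        using that d by (intro pochhammer_ratio_le_1) auto
      ultimately have "norm (?a i k) = (pochhammer (real k) i / pochhammer (real k + d) i) * ?M i"
        by (simp only: abs_mult real_norm_def abs_of_nonneg)
      also have "\<dots> \<le> 1 * ?M i"
        using that d by (intro mult_right_mono pochhammer_ratio_le_1) auto
      finally show ?thesis by simp
    qed
    then show "\<forall>\<^sub>F (i, k) in at_top \<times>\<^sub>F sequentially. norm (?a i k) \<le> ?M i"
      unfolding eventually_prod_filter
      by (intro exI[of _ "\<lambda>_. True"] exI[of _ "\<lambda>k. 1 \<le> k"]) (auto intro: eventually_ge_at_top)
  qed simp
  moreover have "(\<Sum>i. pochhammer b i / fact i * z ^ i) = (1 - z) powr (- b)"
    using B by (rule sums_unique[symmetric])
  ultimately show ?thesis by (simp add: hypergeometric_def)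
qed

section \<open>Test functions for the generator\<close>

lemma max_power_has_derivative:
  assumes "0 < n"
  shows "((\<lambda>u::real. max 0 u ^ Suc n) has_real_derivative (real (Suc n) * max 0 u ^ n)) (at u)"
proof (cases u "0::real" rule: linorder_cases)
  case less
  show ?thesis
  proof (rule has_field_derivative_transform_within_open[of "\<lambda>_. 0" _ _ "{..<0}"])
    show "((\<lambda>_. 0) has_real_derivative real (Suc n) * max 0 u ^ n) (at u)"
      using less assms by (simp add: zero_power)
  qed (use less in auto)
next
  case greater
  show ?thesis
  proof (rule has_field_derivative_transform_within_open[of "\<lambda>u. u ^ Suc n" _ _ "{0<..}"])
    show "((\<lambda>u. u ^ Suc n) has_real_derivative real (Suc n) * max 0 u ^ n) (at u)"
      using greater by (auto intro!: derivative_eq_intros simp del: power_Suc of_nat_Suc)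
  qed (use greater in auto)
next
  case equal
  have "(\<lambda>h::real. max 0 h ^ Suc n / h) \<midarrow>0\<rightarrow> 0"
  proof (rule Lim_null_comparison)
    show "\<forall>\<^sub>F h::real in at 0. norm (max 0 h ^ Suc n / h) \<le> \<bar>h\<bar> ^ n"
      by (intro always_eventually allI) (auto simp: max_def abs_mult power_abs)
    have "((\<lambda>h::real. \<bar>h\<bar> ^ n) \<longlongrightarrow> \<bar>0\<bar> ^ n) (at 0)" by (intro tendsto_intros)
    moreover have "\<bar>0 :: real\<bar> ^ n = 0" using assms by simp
    ultimately show "((\<lambda>h::real. \<bar>h\<bar> ^ n) \<longlongrightarrow> 0) (at 0)" by (simp only:)
  qed
  then show ?thesis using equal assms by (simp add: DERIV_def zero_power)
qed

text \<open>The generator is known only on compactly supported functions, whereas \<open>F\<^sub>k\<close> lives on the unit interval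
  and must be kept unchanged up to \<open>a\<close>. With \<open>p t = (max 0 t)\<^sup>3\<close>, which is of class \<open>C\<^sup>2\<close>, the function
  \<open>p (1 - p u)\<close> is 1 for \<open>u \<le> 0\<close> and 0 for \<open>u \<ge> 1\<close>, and it inherits its smoothness from \<open>p\<close> by the chain
  rule. The result concerns the half line \<open>z \<ge> 0\<close>, where \<open>z = |x|\<^sup>2\<close> takes its values.\<close>

lemma C2_cutoff:
  fixes F F1 F2 :: "real \<Rightarrow> real"
  assumes F: "\<And>z. \<bar>z\<bar> < 1 \<Longrightarrow> (F has_real_derivative F1 z) (at z)"
    and F1: "\<And>z. \<bar>z\<bar> < 1 \<Longrightarrow> (F1 has_real_derivative F2 z) (at z)"
    and F2: "\<And>z. \<bar>z\<bar> < 1 \<Longrightarrow> isCont F2 z"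
    and ab: "0 < a" "a < b" "b < 1"
  obtains G G1 G2 where "\<forall>z\<ge>0. (G has_real_derivative G1 z) (at z)"
    "\<forall>z\<ge>0. (G1 has_real_derivative G2 z) (at z)" "continuous_on {0..} G2"
    "\<And>z. z \<le> a \<Longrightarrow> G z = F z" "\<And>z. z \<le> a \<Longrightarrow> G1 z = F1 z" "\<And>z. z \<le> a \<Longrightarrow> G2 z = F2 z"
    "\<And>z. b \<le> z \<Longrightarrow> G z = (0::real)"
proof -
  define u where "u z = (z - a) / (b - a)" for z
  define p p1 p2 :: "real \<Rightarrow> real" where "p u = max 0 u ^ 3" and "p1 u = 3 * (max 0 u)\<^sup>2"
    and "p2 u = 6 * max 0 u" for u
  define \<psi> where "\<psi> z = p (1 - p (u z))" for z
  define \<psi>1 where "\<psi>1 z = - (p1 (1 - p (u z)) * (p1 (u z) / (b - a)))" for z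
  define \<psi>2 where "\<psi>2 z = p2 (1 - p (u z)) * (p1 (u z) / (b - a)) * (p1 (u z) / (b - a))
     - p1 (1 - p (u z)) * (p2 (u z) / (b - a) / (b - a))" for z
  have p: "(p has_real_derivative p1 u) (at u)" for u
    using max_power_has_derivative[of 2 u] by (simp add: p_def[abs_def] p1_def)
  have p1: "(p1 has_real_derivative p2 u) (at u)" for u
    using DERIV_cmult[OF max_power_has_derivative[of 1 u], of 3] by (simp add: p2_def p1_def[abs_def] power2_eq_square)
  have u: "(u has_real_derivative 1 / (b - a)) (at z)" for z
    unfolding u_def[abs_def] using ab by (auto intro!: derivative_eq_intros)
  have pu: "((\<lambda>z. 1 - p (u z)) has_real_derivative - (p1 (u z) / (b - a))) (at z)" for z
    using DERIV_diff[OF DERIV_const DERIV_chain2[OF p u], of 1 z] by simp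
  have p1u: "((\<lambda>z. p1 (u z) / (b - a)) has_real_derivative (p2 (u z) / (b - a) / (b - a))) (at z)" for z
    using DERIV_cdivide[OF DERIV_chain2[OF p1 u[of z]], of "b - a"] by simp
  have \<psi>: "(\<psi> has_real_derivative \<psi>1 z) (at z)" for z
    using DERIV_chain2[OF p pu, of z] by (simp add: \<psi>_def[abs_def] \<psi>1_def)
  have \<psi>1: "(\<psi>1 has_real_derivative \<psi>2 z) (at z)" for z
    using DERIV_minus[OF DERIV_mult[OF DERIV_chain2[OF p1 pu] p1u], of z]
    by (simp add: \<psi>1_def[abs_def] \<psi>2_def algebra_simps)
  have cont_p: "isCont p u" "isCont p1 u" "isCont p2 u" for u
    unfolding p_def[abs_def] p1_def[abs_def] p2_def[abs_def] by (intro continuous_intros)+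
  have cu: "isCont u z" for z by (rule DERIV_isCont[OF u])
  have cpu: "isCont (\<lambda>z. 1 - p (u z)) z" for z by (rule DERIV_isCont[OF pu])
  have c\<psi>2: "isCont \<psi>2 z" for z
    unfolding \<psi>2_def[abs_def]
    by (intro continuous_intros isCont_o2[OF cpu cont_p(3)] isCont_o2[OF cpu cont_p(2)]
        isCont_o2[OF cu cont_p(2)] isCont_o2[OF cu cont_p(3)]) (use ab in auto)
  have below: "\<psi> z = 1" "\<psi>1 z = 0" "\<psi>2 z = 0" if "z \<le> a" for z
  proof -
    have "u z \<le> 0" using that ab by (simp add: u_def divide_nonpos_pos)
    then show "\<psi> z = 1" "\<psi>1 z = 0" "\<psi>2 z = 0"
      by (simp_all add: \<psi>_def \<psi>1_def \<psi>2_def p_def p1_def p2_def max_def)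
  qed
  have above: "\<psi> z = 0" "\<psi>1 z = 0" "\<psi>2 z = 0" if "b \<le> z" for z
  proof -
    have "1 \<le> u z" using that ab by (simp add: u_def)
    then have "1 \<le> p (u z)" unfolding p_def by (intro one_le_power) auto
    then show "\<psi> z = 0" "\<psi>1 z = 0" "\<psi>2 z = 0"
      by (simp_all add: \<psi>_def \<psi>1_def \<psi>2_def p_def[of "1 - p (u z)"] p1_def[of "1 - p (u z)"] p2_def[of "1 - p (u z)"])
  qed
  \<comment> \<open>Beyond \<open>b\<close> the factors \<open>\<psi>\<close>, \<open>\<psi>1\<close>, \<open>\<psi>2\<close> vanish, whatever the values of \<open>F\<close>, \<open>F1\<close>, \<open>F2\<close> there.\<close>
  define G where "G z = \<psi> z * F z" for z
  define G1 where "G1 z = \<psi>1 z * F z + \<psi> z * F1 z" for z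
  define G2 where "G2 z = \<psi>2 z * F z + 2 * \<psi>1 z * F1 z + \<psi> z * F2 z" for z
  have G0: "G z = 0" "G1 z = 0" "G2 z = 0" if "b \<le> z" for z
    using above[OF that] by (simp_all add: G_def G1_def G2_def)
  have zero: "(H has_real_derivative 0) (at z)" if "1 \<le> z" "\<And>z. b \<le> z \<Longrightarrow> H z = 0" for H z
    by (rule has_field_derivative_transform_within_open[of "\<lambda>_. 0" _ _ "{b<..}"]) (use that ab in auto)
  have dG: "(G has_real_derivative G1 z) (at z)" if "0 \<le> z" for z
  proof (cases "z < 1")
    case True
    then have z: "\<bar>z\<bar> < 1" using that by simp
    show ?thesis
      using DERIV_mult[OF \<psi> F[OF z]] by (simp add: G_def[abs_def] G1_def mult.commute add.commute)
  next
    case False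
    with zero[of z G] G0 ab show ?thesis by simp
  qed
  have dG1: "(G1 has_real_derivative G2 z) (at z)" if "0 \<le> z" for z
  proof (cases "z < 1")
    case True
    then have z: "\<bar>z\<bar> < 1" using that by simp
    show ?thesis
      using DERIV_add[OF DERIV_mult[OF \<psi>1 F[OF z]] DERIV_mult[OF \<psi> F1[OF z]]]
      by (simp add: G1_def[abs_def] G2_def algebra_simps)
  next
    case False
    with zero[of z G1] G0 ab show ?thesis by simp
  qed
  have cG2: "isCont G2 z" if "0 \<le> z" for z
  proof (cases "z < 1")
    case True
    then have z: "\<bar>z\<bar> < 1" using that by simp
    show ?thesis unfolding G2_def[abs_def]
      by (intro continuous_intros c\<psi>2 F2 z DERIV_isCont[OF F] DERIV_isCont[OF F1] DERIV_isCont[OF \<psi>] DERIV_isCont[OF \<psi>1])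
  next
    case False
    with zero[of z G2] G0 ab show ?thesis by (auto intro: DERIV_isCont)
  qed
  show thesis
  proof (rule that[of G G1 G2])
    show "continuous_on {0..} G2" using cG2 by (auto intro: continuous_at_imp_continuous_on)
    show "G z = F z" "G1 z = F1 z" "G2 z = F2 z" if "z \<le> a" for z
      using below[OF that] by (simp_all add: G_def G1_def G2_def)
  qed (use dG dG1 G0 in auto)
qed

text \<open>For \<open>x = 0\<close> every \<open>t\<close> is admissible: only degree 0 survives.\<close>

lemma zonal_eq_gegenbauer:
  assumes "x \<bullet> y = norm x * norm y * t"
  shows "zonal \<rho> y k x = (norm x * norm y) ^ k * gegenbauer \<rho> k t"
proof (induction k rule: induct_nat_012)
  case 0
  then show ?case by simp
next
  case 1
  then show ?case by (simp add: gegenbauer_1 assms)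
next
  case (ge2 k)
  define s where "s = norm x * norm y"
  have e: "A / (real k + 2) * (s * t * (s ^ Suc k * C1)) + - B * (norm y)\<^sup>2 / (real k + 2) * ((norm x)\<^sup>2 * (s ^ k * C0))
      = s ^ Suc (Suc k) * ((A * t * C1 - B * C0) / (real k + 2))" for A B C0 C1
    by (simp add: s_def diff_divide_distrib power_mult_distrib power2_eq_square algebra_simps)
  have g: "gegenbauer \<rho> (Suc (Suc k)) t =
     (2 * (real k + 1 + \<rho>) * t * gegenbauer \<rho> (Suc k) t - (real k + 2 * \<rho>) * gegenbauer \<rho> k t) / (real k + 2)"
    using gegenbauer_recurrence[of k \<rho> t] by (simp add: field_simps)
  show ?case
    unfolding zonal.simps zonal_step_def ge2 assms s_def[symmetric] g e ..
qed

text \<open>Cut \<open>F\<close> off between \<open>r\<^sup>2\<close> and \<open>(1 + r\<^sup>2) / 2\<close>.\<close>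

lemma ex_test_function:
  fixes F F1 F2 :: "real \<Rightarrow> real" and y :: "real ^ 'n"
  assumes F: "\<And>z. \<bar>z\<bar> < 1 \<Longrightarrow> (F has_real_derivative F1 z) (at z)"
    and F1: "\<And>z. \<bar>z\<bar> < 1 \<Longrightarrow> (F1 has_real_derivative F2 z) (at z)"
    and F2: "\<And>z. \<bar>z\<bar> < 1 \<Longrightarrow> isCont F2 z"
    and r: "0 < r" "r < 1" and \<rho>: "2 * \<rho> = real CARD('n) - 2"
  obtains f where "C2_compact_support f"
    "\<And>x. norm x \<le> r \<Longrightarrow> f x = F ((norm x)\<^sup>2) * zonal \<rho> y k x"
    "\<And>x z. norm x \<le> r \<Longrightarrow> z = (norm x)\<^sup>2 \<Longrightarrow> laplace_beltrami f x = 4 * (1 - z) * zonal \<rho> y k x *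
      (z * (1 - z) * F2 z + (k + real CARD('n) / 2 - (k - \<rho> + 1) * z) * F1 z + k * \<rho> * F z)"
proof -
  define b where "b = (1 + r\<^sup>2) / 2"
  have r2: "0 < r\<^sup>2" "r\<^sup>2 < 1" using r by (auto simp: abs_square_less_1)
  then have b: "r\<^sup>2 < b" "b < 1" by (auto simp: b_def)
  obtain G G1 G2 where G: "\<forall>z\<ge>0. (G has_real_derivative G1 z) (at z)"
    "\<forall>z\<ge>0. (G1 has_real_derivative G2 z) (at z)" "continuous_on {0..} G2"
    "\<And>z. z \<le> r\<^sup>2 \<Longrightarrow> G z = F z" "\<And>z. z \<le> r\<^sup>2 \<Longrightarrow> G1 z = F1 z" "\<And>z. z \<le> r\<^sup>2 \<Longrightarrow> G2 z = F2 z"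
    "\<And>z. b \<le> z \<Longrightarrow> G z = 0"
    using C2_cutoff[OF F F1 F2 r2(1) b] by blast
  let ?f = "\<lambda>x. G ((norm x)\<^sup>2) * zonal \<rho> y k x"
  show thesis
  proof (rule that[of ?f])
    show "C2_compact_support ?f"
      unfolding C2_compact_support_def
    proof (intro conjI exI)
      show "C2 ?f" by (intro C2_mult C2_zonal C2_radial[OF G(1,2,3)])
      show "compact (cball (0 :: real ^ 'n) (sqrt b))" by simp
      show "cball 0 (sqrt b) \<subseteq> ball (0 :: real ^ 'n) 1"
      proof
        fix x :: "real ^ 'n" assume "x \<in> cball 0 (sqrt b)"
        then have "norm x \<le> sqrt b" by simp
        also have "sqrt b < 1" using b by simp
        finally show "x \<in> ball 0 1" by simp
      qed
      show "\<forall>x. x \<notin> cball 0 (sqrt b) \<longrightarrow> ?f x = 0"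
      proof (intro allI impI)
        fix x :: "real ^ 'n" assume "x \<notin> cball 0 (sqrt b)"
        then have "sqrt b \<le> norm x" by simp
        moreover have b0: "0 \<le> b" using b(1) r2(1) by linarith
        ultimately have "(sqrt b)\<^sup>2 \<le> (norm x)\<^sup>2" by (intro power_mono) simp_all
        then have "b \<le> (norm x)\<^sup>2" using b0 by simp
        then show "?f x = 0" by (simp add: G)
      qed
    qed
    fix x :: "real ^ 'n" and z :: real assume x: "norm x \<le> r"
    then have le: "(norm x)\<^sup>2 \<le> r\<^sup>2" by (simp add: power_mono)
    show "?f x = F ((norm x)\<^sup>2) * zonal \<rho> y k x" by (simp add: G le)
    assume z: "z = (norm x)\<^sup>2"
    then have "z \<le> r\<^sup>2" using le by simp
    with laplace_beltrami_radial_times_zonal[OF G(1,2,3) \<rho> z, of y k]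
    show "laplace_beltrami ?f x = 4 * (1 - z) * zonal \<rho> y k x *
      (z * (1 - z) * F2 z + (k + real CARD('n) / 2 - (k - \<rho> + 1) * z) * F1 z + k * \<rho> * F z)"
      by (simp add: G)
  qed
qed

lemma ex_harmonic_test_function:
  fixes y :: "real ^ 'n"
  assumes r: "0 < r" "r < 1" and \<rho>: "2 * \<rho> = real CARD('n) - 2"
  obtains f where "C2_compact_support f" "\<And>x. norm x < r \<Longrightarrow> laplace_beltrami f x = 0"
    "\<And>x. norm x \<le> r \<Longrightarrow> f x = hypergeometric (real k) (- \<rho>) (real k + real CARD('n) / 2) ((norm x)\<^sup>2) * zonal \<rho> y k x"
proof -
  let ?c = "real k + real CARD('n) / 2"
  let ?F = "hyp_fps (real k) (- \<rho>) ?c"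
  have c: "0 < ?c" by (simp add: add_nonneg_pos)
  have d: "(eval_fps ?F has_real_derivative eval_fps (fps_deriv ?F) z) (at z)"
    "(eval_fps (fps_deriv ?F) has_real_derivative eval_fps (fps_deriv (fps_deriv ?F)) z) (at z)"
    "isCont (eval_fps (fps_deriv (fps_deriv ?F))) z" if "\<bar>z\<bar> < 1" for z
    using hyp_conv_radius_less[OF c that, of "real k" "- \<rho>"]
    by (auto intro!: has_field_derivative_eval_fps DERIV_isCont[OF has_field_derivative_eval_fps])
  obtain f where f: "C2_compact_support f"
    "\<And>x. norm x \<le> r \<Longrightarrow> f x = eval_fps ?F ((norm x)\<^sup>2) * zonal \<rho> y k x"
    "\<And>x z. norm x \<le> r \<Longrightarrow> z = (norm x)\<^sup>2 \<Longrightarrow> laplace_beltrami f x = 4 * (1 - z) * zonal \<rho> y k x *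
      (z * (1 - z) * eval_fps (fps_deriv (fps_deriv ?F)) z
       + (k + real CARD('n) / 2 - (k - \<rho> + 1) * z) * eval_fps (fps_deriv ?F) z + k * \<rho> * eval_fps ?F z)"
    using ex_test_function[OF d r \<rho>] by metis
  show thesis
  proof (rule that[OF f(1)])
    fix x :: "real ^ 'n" assume x: "norm x < r"
    define z where "z = (norm x)\<^sup>2"
    have "\<bar>z\<bar> < 1" using x r by (simp add: z_def abs_square_less_1)
    from hypergeometric_ODE[OF c this, of "real k" "- \<rho>"]
    have "z * (1 - z) * eval_fps (fps_deriv (fps_deriv ?F)) z
       + (k + real CARD('n) / 2 - (k - \<rho> + 1) * z) * eval_fps (fps_deriv ?F) z + k * \<rho> * eval_fps ?F z = 0"
      by (simp add: algebra_simps)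
    with f(3)[OF less_imp_le[OF x] z_def] show "laplace_beltrami f x = 0" by simp
  next
    show "\<And>x. norm x \<le> r \<Longrightarrow> f x = hypergeometric (real k) (- \<rho>) ?c ((norm x)\<^sup>2) * zonal \<rho> y k x"
      using f(2) by (simp add: hypergeometric_eq_eval)
  qed
qed

text \<open>The function \<open>|x|\<^sup>2\<close>, cut off outside the ball. On it the operator takes the value
  \<open>4 (1 - z) ((1 - z) + \<rho> (1 + z))\<close> with \<open>z = |x|\<^sup>2\<close>.\<close>

lemma ex_subharmonic_test_function:
  assumes r: "0 < r" "r < 1" and n: "2 < CARD('n)"
  obtains f :: "real ^ 'n \<Rightarrow> real" and c where "C2_compact_support f" "0 < c" "\<And>x. norm x \<le> r \<Longrightarrow> c \<le> laplace_beltrami f x"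
proof -
  define \<rho> where "\<rho> = (real CARD('n) - 2) / 2"
  have \<rho>: "2 * \<rho> = real CARD('n) - 2" "0 < \<rho>" using n by (simp_all add: \<rho>_def)
  obtain f :: "real ^ 'n \<Rightarrow> real" where f: "C2_compact_support f"
    "\<And>x z. norm x \<le> r \<Longrightarrow> z = (norm x)\<^sup>2 \<Longrightarrow> laplace_beltrami f x = 4 * (1 - z) * zonal \<rho> 0 0 x *
      (z * (1 - z) * 0 + (real 0 + real CARD('n) / 2 - (real 0 - \<rho> + 1) * z) * 1 + real 0 * \<rho> * z)"
    by (rule ex_test_function[of "\<lambda>z. z" "\<lambda>_. 1" "\<lambda>_. 0" r \<rho> "0 :: real ^ 'n" 0, OF _ _ _ r \<rho>(1)])
      (simp_all only: DERIV_ident DERIV_const continuous_const)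
  have r2: "r\<^sup>2 < 1" using r by (simp add: abs_square_less_1)
  show thesis
  proof (rule that[OF f(1), of "4 * (1 - r\<^sup>2)\<^sup>2"])
    show "0 < 4 * (1 - r\<^sup>2)\<^sup>2" using r2 by simp
    fix x :: "real ^ 'n" assume x: "norm x \<le> r"
    define z where "z = (norm x)\<^sup>2"
    have z: "0 \<le> z" "z \<le> r\<^sup>2" using x by (auto simp: z_def power_mono)
    have "0 \<le> \<rho> * (1 + z)" using \<rho> z by simp
    then have 1: "1 - r\<^sup>2 \<le> (1 - z) + \<rho> * (1 + z)" using z by linarith
    have 2: "1 - r\<^sup>2 \<le> 1 - z" "0 \<le> 1 - r\<^sup>2" "0 \<le> 1 - z" using z r2 by simp_all
    have "4 * (1 - r\<^sup>2)\<^sup>2 = 4 * ((1 - r\<^sup>2) * (1 - r\<^sup>2))" by (simp only: power2_eq_square)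
    also have "\<dots> \<le> 4 * ((1 - z) * ((1 - z) + \<rho> * (1 + z)))"
      by (rule mult_left_mono[OF mult_mono[OF 2(1) 1 2(3,2)]]) simp
    also have "\<dots> = laplace_beltrami f x"
    proof -
      have n: "real CARD('n) / 2 = \<rho> + 1" using \<rho> by simp
      show ?thesis unfolding f(2)[OF x z_def] n zonal.simps by (simp add: algebra_simps)
    qed
    finally show "4 * (1 - r\<^sup>2)\<^sup>2 \<le> laplace_beltrami f x" .
  qed
qed

section \<open>Exit times of continuous paths\<close>

text \<open>The index \<open>k\<close> stands for the time \<open>k / 2\<^sup>m\<close>. Dyadic grids are nested, so the times found decrease
  with \<open>m\<close> and converge; stopping at time \<open>T\<close> keeps them bounded.\<close>

definition grid_exit_index :: "(real \<Rightarrow> 'b::real_normed_vector) \<Rightarrow> real \<Rightarrow> nat \<Rightarrow> nat \<Rightarrow> nat" where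
  "grid_exit_index c q T m = (LEAST k. k = T * 2 ^ m \<or> q < norm (c (real k / 2 ^ m)))"

definition grid_exit :: "(real \<Rightarrow> 'b::real_normed_vector) \<Rightarrow> real \<Rightarrow> nat \<Rightarrow> nat \<Rightarrow> real" where
  "grid_exit c q T m = real (grid_exit_index c q T m) / 2 ^ m"

definition exit_above :: "(real \<Rightarrow> 'b::real_normed_vector) \<Rightarrow> real \<Rightarrow> nat \<Rightarrow> real" where
  "exit_above c q T = lim (grid_exit c q T)"

lemma grid_exit_index_le: "grid_exit_index c q T m \<le> T * 2 ^ m"
  unfolding grid_exit_index_def by (rule Least_le) simp

lemma grid_exit_index_le': "q < norm (c (real k / 2 ^ m)) \<Longrightarrow> grid_exit_index c q T m \<le> k"
  unfolding grid_exit_index_def by (rule Least_le) simp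

lemma less_grid_exit_index_iff:
  assumes "k < T * 2 ^ m"
  shows "k < grid_exit_index c q T m \<longleftrightarrow> (\<forall>i\<le>k. norm (c (real i / 2 ^ m)) \<le> q)"
proof
  assume k: "k < grid_exit_index c q T m"
  show "\<forall>i\<le>k. norm (c (real i / 2 ^ m)) \<le> q"
    using grid_exit_index_le'[of q c _ m T] k by (metis leD le_less_trans not_le)
next
  assume *: "\<forall>i\<le>k. norm (c (real i / 2 ^ m)) \<le> q"
  have "grid_exit_index c q T m = T * 2 ^ m \<or> q < norm (c (real (grid_exit_index c q T m) / 2 ^ m))"
    unfolding grid_exit_index_def by (rule LeastI[of _ "T * 2 ^ m"]) simp
  then show "k < grid_exit_index c q T m"
    using * assms by (metis not_le)
qed

lemma grid_exit_index_cases: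
  "grid_exit_index c q T m = T * 2 ^ m \<or> q < norm (c (grid_exit c q T m))"
  unfolding grid_exit_def grid_exit_index_def by (rule LeastI[of _ "T * 2 ^ m"]) simp

lemma grid_exit_nonneg: "0 \<le> grid_exit c q T m"
  by (simp add: grid_exit_def)

lemma grid_exit_le: "grid_exit c q T m \<le> T"
proof -
  have "real (grid_exit_index c q T m) \<le> real (T * 2 ^ m)"
    using grid_exit_index_le[of c q T m] by (simp only: of_nat_le_iff)
  then show ?thesis by (simp add: grid_exit_def field_simps)
qed

text \<open>Whether the increment from step \<open>k\<close> to step \<open>k + 1\<close> is counted depends on the path up to step \<open>k\<close>
  only; this is what the Markov property needs.\<close>

lemma grid_exit_telescope:
  fixes h :: "'b::real_normed_vector \<Rightarrow> 'a::real_vector"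
  shows "h (c (grid_exit c q T m)) = h (c 0) + (\<Sum>k<T * 2 ^ m.
     (if \<forall>i\<le>k. norm (c (real i / 2 ^ m)) \<le> q then 1 else 0) *\<^sub>R
        (h (c (real (Suc k) / 2 ^ m)) - h (c (real k / 2 ^ m))))"
proof -
  let ?K = "grid_exit_index c q T m"
  have "(\<Sum>k<T * 2 ^ m. (if \<forall>i\<le>k. norm (c (real i / 2 ^ m)) \<le> q then 1 else 0) *\<^sub>R
        (h (c (real (Suc k) / 2 ^ m)) - h (c (real k / 2 ^ m))))
     = (\<Sum>k<T * 2 ^ m. if k < ?K then h (c (real (Suc k) / 2 ^ m)) - h (c (real k / 2 ^ m)) else 0)"
    by (intro sum.cong refl) (auto simp: less_grid_exit_index_iff simp del: of_nat_Suc)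
  also have "\<dots> = (\<Sum>k<?K. h (c (real (Suc k) / 2 ^ m)) - h (c (real k / 2 ^ m)))"
    by (intro sum.mono_neutral_cong_right) (use grid_exit_index_le[of c q T m] in auto)
  also have "\<dots> = h (c (real ?K / 2 ^ m)) - h (c (real 0 / 2 ^ m))"
    by (rule sum_lessThan_telescope)
  finally show ?thesis by (simp add: grid_exit_def)
qed

lemma grid_exit_decseq: "decseq (grid_exit c q T)"
proof (rule decseq_SucI)
  fix m
  have "grid_exit_index c q T (Suc m) \<le> 2 * grid_exit_index c q T m"
    using grid_exit_index_cases[of c q T m]
  proof
    assume "grid_exit_index c q T m = T * 2 ^ m"
    then show ?thesis using grid_exit_index_le[of c q T "Suc m"] by simp
  next
    assume "q < norm (c (grid_exit c q T m))"
    then show ?thesis by (intro grid_exit_index_le') (simp add: grid_exit_def field_simps)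
  qed
  then have "real (grid_exit_index c q T (Suc m)) \<le> 2 * real (grid_exit_index c q T m)" by linarith
  then show "grid_exit c q T (Suc m) \<le> grid_exit c q T m"
    by (simp add: grid_exit_def field_simps)
qed

lemma grid_exit_tendsto: "grid_exit c q T \<longlonglongrightarrow> exit_above c q T"
proof -
  obtain L where "grid_exit c q T \<longlonglongrightarrow> L"
    using decseq_convergent[OF grid_exit_decseq, of 0] grid_exit_nonneg by metis
  then have "convergent (grid_exit c q T)" by (rule convergentI)
  then show ?thesis unfolding exit_above_def by (simp add: convergent_LIMSEQ_iff)
qed

lemma exit_above_bounds: "0 \<le> exit_above c q T" "exit_above c q T \<le> T" "exit_above c q T \<le> grid_exit c q T m"
  using LIMSEQ_le_const[OF grid_exit_tendsto] LIMSEQ_le_const2[OF grid_exit_tendsto] grid_exit_nonneg grid_exit_le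
    decseq_ge[OF grid_exit_decseq grid_exit_tendsto] by blast+

lemma continuous_on_grid_exit_tendsto:
  assumes "continuous_on {0..} c"
  shows "(\<lambda>m. c (grid_exit c q T m)) \<longlonglongrightarrow> c (exit_above c q T)"
  by (rule continuous_on_tendsto_compose[OF assms grid_exit_tendsto])
    (auto simp: exit_above_bounds grid_exit_nonneg)

lemma dyadic_approx_tendsto: "(\<lambda>m. real (nat \<lceil>t * 2 ^ m\<rceil>) / 2 ^ m) \<longlonglongrightarrow> t" if "0 \<le> t"
proof (rule tendsto_sandwich[of "\<lambda>_. t" _ _ "\<lambda>m. t + (1/2) ^ m"])
  have *: "real (nat \<lceil>t * 2 ^ m\<rceil>) = of_int \<lceil>t * 2 ^ m\<rceil>" for m
    using that by simp
  show "\<forall>\<^sub>F m in sequentially. t \<le> real (nat \<lceil>t * 2 ^ m\<rceil>) / 2 ^ m"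
    unfolding * by (intro always_eventually) (simp add: field_simps)
  show "\<forall>\<^sub>F m in sequentially. real (nat \<lceil>t * 2 ^ m\<rceil>) / 2 ^ m \<le> t + (1/2) ^ m"
    unfolding *
  proof (intro always_eventually allI)
    fix m
    have "of_int \<lceil>t * 2 ^ m\<rceil> \<le> t * 2 ^ m + 1" by linarith
    then show "of_int \<lceil>t * 2 ^ m\<rceil> / 2 ^ m \<le> t + (1/2) ^ m"
      by (simp add: field_simps power_one_over)
  qed
  have "(\<lambda>m. t + (1/2) ^ m) \<longlonglongrightarrow> t + 0"
    by (intro tendsto_intros LIMSEQ_power_zero) simp
  then show "(\<lambda>m. t + (1/2) ^ m) \<longlonglongrightarrow> t" by simp
qed simp

lemma ex_dyadic_norm_greater:
  assumes c: "continuous_on {0..} c" and t: "0 \<le> t" "q < norm (c t)" and e: "0 < e"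
  obtains k m where "real k / 2 ^ m < t + e" "q < norm (c (real k / 2 ^ m))"
proof -
  have "(\<lambda>m. norm (c (real (nat \<lceil>t * 2 ^ m\<rceil>) / 2 ^ m))) \<longlonglongrightarrow> norm (c t)"
  proof (intro tendsto_norm continuous_on_tendsto_compose[OF c dyadic_approx_tendsto])
    have "0 \<le> real (nat \<lceil>t * 2 ^ m\<rceil>) / 2 ^ m" for m
      by (rule divide_nonneg_nonneg) simp_all
    then show "\<forall>\<^sub>F m in sequentially. real (nat \<lceil>t * 2 ^ m\<rceil>) / 2 ^ m \<in> {0..}"
      by (auto simp del: of_nat_nat)
  qed (use t in auto)
  then have "\<forall>\<^sub>F m in sequentially. q < norm (c (real (nat \<lceil>t * 2 ^ m\<rceil>) / 2 ^ m))"
    using t(2) by (rule order_tendstoD)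
  moreover have "\<forall>\<^sub>F m in sequentially. real (nat \<lceil>t * 2 ^ m\<rceil>) / 2 ^ m < t + e"
    using dyadic_approx_tendsto[OF t(1)] by (rule order_tendstoD) (use e in simp)
  ultimately have "\<forall>\<^sub>F m in sequentially. q < norm (c (real (nat \<lceil>t * 2 ^ m\<rceil>) / 2 ^ m)) \<and>
    real (nat \<lceil>t * 2 ^ m\<rceil>) / 2 ^ m < t + e"
    by eventually_elim simp
  then show thesis using that by (auto simp: eventually_sequentially)
qed

lemma exit_above_le:
  assumes c: "continuous_on {0..} c" and t: "0 \<le> t" "q < norm (c t)"
  shows "exit_above c q T \<le> t"
proof (rule field_le_epsilon)
  fix e :: real assume "0 < e"
  obtain k m where km: "real k / 2 ^ m < t + e" "q < norm (c (real k / 2 ^ m))"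
    using ex_dyadic_norm_greater[OF c t \<open>0 < e\<close>] .
  have "grid_exit c q T m \<le> real k / 2 ^ m"
    using grid_exit_index_le'[of q c k m T] km(2) by (simp add: grid_exit_def divide_right_mono)
  then show "exit_above c q T \<le> t + e"
    using exit_above_bounds(3)[of c q T m] km by linarith
qed

lemma exit_above_ge:
  assumes c: "continuous_on {0..} c" and s: "s \<le> T" "\<And>t. 0 \<le> t \<Longrightarrow> t < s \<Longrightarrow> norm (c t) \<le> q"
  shows "s \<le> exit_above c q T"
proof (rule LIMSEQ_le_const[OF grid_exit_tendsto], intro exI allI impI)
  fix m
  show "s \<le> grid_exit c q T m"
    using grid_exit_index_cases[of c q T m]
  proof
    assume "grid_exit_index c q T m = T * 2 ^ m"
    then show ?thesis using s by (simp add: grid_exit_def)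
  next
    assume "q < norm (c (grid_exit c q T m))"
    then show ?thesis using s(2)[of "grid_exit c q T m"] grid_exit_nonneg[of c q T m] by force
  qed
qed

text \<open>A path may touch the sphere of radius \<open>r\<close> for an instant and turn back, which no grid time need
  notice. It then exceeds a lower level on an open set of times, so the sphere is approached through
  levels \<open>q j < r\<close>; the time bound \<open>j\<close> is removed in the same limit.\<close>

lemma exit_above_tendsto:
  assumes c: "continuous_on {0..} c" and \<tau>: "0 \<le> \<tau>" "r \<le> norm (c \<tau>)"
    and below: "\<And>t. 0 \<le> t \<Longrightarrow> t < \<tau> \<Longrightarrow> norm (c t) < r"
    and q: "q \<longlonglongrightarrow> r" "\<And>j. q j < r"
  shows "(\<lambda>j. exit_above c (q j) j) \<longlonglongrightarrow> \<tau>"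
proof (rule order_tendstoI)
  fix u assume "\<tau> < u"
  have "exit_above c (q j) j \<le> \<tau>" for j
    using q(2)[of j] \<tau> by (intro exit_above_le[OF c]) auto
  then show "\<forall>\<^sub>F j in sequentially. exit_above c (q j) j < u"
    using \<open>\<tau> < u\<close> by (intro always_eventually) (auto intro: le_less_trans)
next
  fix l assume l: "l < \<tau>"
  show "\<forall>\<^sub>F j in sequentially. l < exit_above c (q j) j"
  proof (cases "\<tau> \<le> 0")
    case True
    have "l < exit_above c (q j) j" for j
      using exit_above_bounds(1)[of c "q j" j] l True by linarith
    then show ?thesis by simp
  next
    case False
    define s where "s = (max l 0 + \<tau>) / 2"
    have s: "l < s" "0 \<le> s" "s < \<tau>" using l False by (auto simp: s_def max_def)
    have "continuous_on {0..s} (\<lambda>t. norm (c t))"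
      using c by (intro continuous_intros) (rule continuous_on_subset, auto)
    then obtain t0 where t0: "t0 \<in> {0..s}" "\<And>t. t \<in> {0..s} \<Longrightarrow> norm (c t) \<le> norm (c t0)"
      using continuous_attains_sup[of "{0..s}" "\<lambda>t. norm (c t)"] s by auto
    have "norm (c t0) < r" using below t0 s by auto
    then have "\<forall>\<^sub>F j in sequentially. norm (c t0) < q j" using q(1) by (rule order_tendstoD(1)[rotated])
    moreover have "\<forall>\<^sub>F j in sequentially. s \<le> real j"
      using eventually_ge_at_top[of "nat \<lceil>s\<rceil>"] by eventually_elim linarith
    ultimately show ?thesis
    proof eventually_elim
      case (elim j)
      have "s \<le> exit_above c (q j) j"
        using elim t0(2) by (intro exit_above_ge[OF c]) (auto intro: order.trans less_imp_le)
      then show ?case using s by simp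
    qed
  qed
qed

text \<open>By compactness of \<open>{0..T}\<close>, reaching the sphere is a countable condition on the values at dyadic
  times, hence a measurable event.\<close>

lemma hits_sphere_iff:
  assumes c: "continuous_on {0..} c" and q: "q \<longlonglongrightarrow> r" "\<And>j::nat. q j < r"
  shows "(\<exists>t\<ge>0. r \<le> norm (c t)) \<longleftrightarrow>
    (\<exists>T::nat. \<forall>j. \<exists>m k. real k / 2 ^ m \<le> T \<and> q j < norm (c (real k / 2 ^ m)))"
proof
  assume "\<exists>t\<ge>0. r \<le> norm (c t)"
  then obtain t where t: "0 \<le> t" "r \<le> norm (c t)" by auto
  have "\<exists>m k. real k / 2 ^ m \<le> nat \<lceil>t + 1\<rceil> \<and> q j < norm (c (real k / 2 ^ m))" for j
  proof -
    have "q j < norm (c t)" using q(2)[of j] t by simp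
    from ex_dyadic_norm_greater[OF c t(1) this zero_less_one]
    obtain k m where km: "real k / 2 ^ m < t + 1" "q j < norm (c (real k / 2 ^ m))" .
    then have "real k / 2 ^ m \<le> nat \<lceil>t + 1\<rceil>" using t by linarith
    with km(2) show ?thesis by blast
  qed
  then show "\<exists>T::nat. \<forall>j. \<exists>m k. real k / 2 ^ m \<le> T \<and> q j < norm (c (real k / 2 ^ m))" by blast
next
  assume "\<exists>T::nat. \<forall>j. \<exists>m k. real k / 2 ^ m \<le> T \<and> q j < norm (c (real k / 2 ^ m))"
  then obtain T :: nat where "\<forall>j. \<exists>s\<in>{0..real T}. q j < norm (c s)"
    by (metis atLeastAtMost_iff divide_nonneg_nonneg of_nat_0_le_iff zero_le_numeral zero_le_power)
  then obtain s where s: "\<And>j. s j \<in> {0..real T}" "\<And>j. q j < norm (c (s j))" by metis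
  obtain l \<phi> where l: "l \<in> {0..real T}" "strict_mono \<phi>" "(s \<circ> \<phi>) \<longlonglongrightarrow> l"
    using compact_Icc[of 0 "real T", unfolded compact_def] s(1) by blast
  have "(\<lambda>j. norm (c ((s \<circ> \<phi>) j))) \<longlonglongrightarrow> norm (c l)"
    using l s(1) by (intro tendsto_norm continuous_on_tendsto_compose[OF c l(3)]) auto
  moreover have "(q \<circ> \<phi>) \<longlonglongrightarrow> r" by (rule LIMSEQ_subseq_LIMSEQ[OF q(1) l(2)])
  ultimately have "r \<le> norm (c l)"
    using s(2) by (intro LIMSEQ_le[of "q \<circ> \<phi>" r]) (auto intro!: exI[of _ 0] less_imp_le)
  then show "\<exists>t\<ge>0. r \<le> norm (c t)" using l(1) by auto
qed

lemma exit_time_properties: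
  assumes c: "continuous_on {0..} (\<lambda>t. X t \<omega>)" and ex: "\<exists>t\<ge>0. r \<le> norm (X t \<omega>)"
    and 0: "norm (X 0 \<omega>) \<le> r"
  shows "0 \<le> exit_time X r \<omega>" "norm (X (exit_time X r \<omega>) \<omega>) = r"
    "\<And>t. 0 \<le> t \<Longrightarrow> t < exit_time X r \<omega> \<Longrightarrow> norm (X t \<omega>) < r"
proof -
  let ?S = "{t. 0 \<le> t \<and> r \<le> norm (X t \<omega>)}"
  have ne: "?S \<noteq> {}" using ex by auto
  have bdd: "bdd_below ?S" by (auto intro!: bdd_belowI)
  have n: "continuous_on {0..} (\<lambda>t. norm (X t \<omega>))" using c by (rule continuous_on_norm)
  have "closed ?S"
    using continuous_closed_preimage[OF n, of "{r..}"] by (auto simp: vimage_def Int_def)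
  then have "Inf ?S \<in> ?S" by (rule closed_contains_Inf[OF ne bdd])
  then show 1: "0 \<le> exit_time X r \<omega>" and 2: "norm (X (exit_time X r \<omega>) \<omega>) = r"
    and 3: "\<And>t. 0 \<le> t \<Longrightarrow> t < exit_time X r \<omega> \<Longrightarrow> norm (X t \<omega>) < r"
  proof -
    assume *: "Inf ?S \<in> ?S"
    show 1: "0 \<le> exit_time X r \<omega>" using * by (simp add: exit_time_def)
    show 3: "norm (X t \<omega>) < r" if "0 \<le> t" "t < exit_time X r \<omega>" for t
      using cInf_lower[OF _ bdd, of t] that unfolding exit_time_def by force
    show "norm (X (exit_time X r \<omega>) \<omega>) = r"
    proof (rule antisym)
      show "r \<le> norm (X (exit_time X r \<omega>) \<omega>)" using * by (simp add: exit_time_def)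
      show "norm (X (exit_time X r \<omega>) \<omega>) \<le> r"
      proof (rule ccontr)
        assume "\<not> ?thesis"
        then have gt: "r < norm (X (exit_time X r \<omega>) \<omega>)" by simp
        have "continuous_on {0..exit_time X r \<omega>} (\<lambda>t. norm (X t \<omega>))"
          by (rule continuous_on_subset[OF n]) auto
        then obtain t where t: "0 \<le> t" "t \<le> exit_time X r \<omega>" "norm (X t \<omega>) = r"
          using IVT'[of "\<lambda>t. norm (X t \<omega>)" 0 r "exit_time X r \<omega>"] 0 gt 1 by auto
        then show False using 3[of t] gt by (cases "t = exit_time X r \<omega>") auto
      qed
    qed
  qed
qed

section \<open>The Markov property\<close>

lemma filtration_natural_filtration: "filtration \<Omega> (natural_filtration \<Omega> X)"
proof
  show "space (natural_filtration \<Omega> X i) = \<Omega>" for i :: real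
    unfolding natural_filtration_def by (rule space_measure_of) auto
  show "sets (natural_filtration \<Omega> X i) \<subseteq> sets (natural_filtration \<Omega> X j)" if "i \<le> j" for i j :: real
    unfolding natural_filtration_def
  proof (subst (1 2) sets_measure_of)
    show "sigma_sets \<Omega> (\<Union>s\<in>{0..i}. {X s -` B \<inter> \<Omega> |B. B \<in> sets borel})
      \<subseteq> sigma_sets \<Omega> (\<Union>s\<in>{0..j}. {X s -` B \<inter> \<Omega> |B. B \<in> sets borel})"
      using that by (intro sigma_sets_mono' UN_mono) auto
  qed auto
qed

lemma measurable_natural_filtration:
  assumes "0 \<le> s" "s \<le> t"
  shows "X s \<in> natural_filtration \<Omega> X t \<rightarrow>\<^sub>M borel"
proof (rule measurableI)
  fix A :: "'b set" assume "A \<in> sets borel"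
  have sp: "space (natural_filtration \<Omega> X t) = \<Omega>"
    using filtration.space_F[OF filtration_natural_filtration] .
  show "X s -` A \<inter> space (natural_filtration \<Omega> X t) \<in> sets (natural_filtration \<Omega> X t)"
    unfolding sp unfolding natural_filtration_def
    by (rule in_measure_of) (use assms \<open>A \<in> sets borel\<close> in \<open>auto intro!: bexI[of _ s]\<close>)
qed auto

context ball_diffusion
begin

lemma space_M: "x \<in> ball 0 1 \<Longrightarrow> space (M x) = space N"
  using sets_M sets_eq_imp_space_eq by blast

lemma measurable_M: "x \<in> ball 0 1 \<Longrightarrow> M x \<rightarrow>\<^sub>M K = N \<rightarrow>\<^sub>M K"
  using sets_M measurable_cong_sets by blast

lemma measurable_X_M: "x \<in> ball 0 1 \<Longrightarrow> 0 \<le> t \<Longrightarrow> X t \<in> M x \<rightarrow>\<^sub>M borel"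
  by (simp add: measurable_M measurable_X)

lemma sets_natural_filtration:
  assumes "A \<in> sets (natural_filtration (space N) X s)"
  shows "A \<in> sets N"
proof -
  have "sets (natural_filtration (space N) X s) \<subseteq> sets N"
    unfolding natural_filtration_def
  proof (subst sets_measure_of)
    show "sigma_sets (space N) (\<Union>s\<in>{0..s}. {X s -` B \<inter> space N |B. B \<in> sets borel}) \<subseteq> sets N"
      by (rule sets.sigma_sets_subset) (auto intro: measurable_sets[OF measurable_X])
  qed auto
  then show ?thesis using assms by auto
qed

lemma emeasure_transition:
  assumes z: "z \<in> ball 0 1" and t: "0 \<le> t" and B: "B \<in> sets borel"
  shows "emeasure (distr (M z) borel (X t)) B = ennreal (measure (M z) {\<omega> \<in> space N. X t \<omega> \<in> B})"
proof -
  interpret prob_space "M z" by (rule prob_space_M[OF z])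
  have "X t -` B \<inter> space (M z) = {\<omega> \<in> space N. X t \<omega> \<in> B}" by (auto simp: space_M[OF z])
  then show ?thesis
    by (simp add: emeasure_distr[OF measurable_X_M[OF z t] B] emeasure_eq_measure)
qed

lemma transition_kernel:
  assumes t: "0 \<le> t"
  shows "(\<lambda>z. distr (M z) borel (X t)) \<in> restrict_space borel (ball 0 1) \<rightarrow>\<^sub>M subprob_algebra borel"
proof (rule measurable_subprob_algebra)
  fix z assume "z \<in> space (restrict_space borel (ball 0 1 :: (real ^ 'n) set))"
  then have z: "z \<in> ball 0 1" by (simp add: space_restrict_space)
  show "subprob_space (distr (M z) borel (X t))"
    by (intro prob_space_imp_subprob_space prob_space.prob_space_distr prob_space_M measurable_X_M z t)
next
  fix B :: "(real ^ 'n) set" assume B: "B \<in> sets borel"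
  have "(\<lambda>z. ennreal (measure (M z) {\<omega> \<in> space N. X t \<omega> \<in> B})) \<in> borel_measurable (restrict_space borel (ball 0 1))"
    using transition_measurable[OF t B] by measurable
  then show "(\<lambda>z. emeasure (distr (M z) borel (X t)) B) \<in> borel_measurable (restrict_space borel (ball 0 1))"
    by (subst measurable_cong[where g = "\<lambda>z. ennreal (measure (M z) {\<omega> \<in> space N. X t \<omega> \<in> B})"])
      (simp_all add: space_restrict_space emeasure_transition t B)
qed simp

lemma measurable_X_ball:
  assumes "x \<in> ball 0 1" "0 \<le> s"
  shows "X s \<in> M x \<rightarrow>\<^sub>M restrict_space borel (ball 0 1)"
  using assms X_in_ball[OF assms(2)]
  by (intro measurable_restrict_space2 measurable_X_M Pi_I) (auto simp: space_M[OF assms(1)] simp del: mem_ball_0)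

text \<open>The strong Markov property at the constant time \<open>s\<close>.\<close>

lemma Markov_property_emeasure:
  assumes x: "x \<in> ball 0 1" and s: "0 \<le> s" and t: "0 \<le> t"
    and A: "A \<in> sets (natural_filtration (space N) X s)" and B: "B \<in> sets borel"
  shows "emeasure (M x) {\<omega> \<in> A. X (s + t) \<omega> \<in> B} =
    (\<integral>\<^sup>+\<omega>. indicator A \<omega> * emeasure (distr (M (X s \<omega>)) borel (X t)) B \<partial>M x)"
proof -
  interpret F: filtration "space N" "natural_filtration (space N) X"
    by (rule filtration_natural_filtration)
  interpret prob_space "M x" by (rule prob_space_M[OF x])
  have st: "stopping_time (natural_filtration (space N) X) (\<lambda>_. s)"
    by (rule stopping_time_const)
  have A': "A \<in> sets (F.pre_sigma (\<lambda>_. s))"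
  proof (rule F.sets_pre_sigmaI[OF st])
    fix u
    show "{\<omega> \<in> A. s \<le> u} \<in> sets (natural_filtration (space N) X u)"
      using F.sets_F_mono[of s u] A by (cases "s \<le> u") auto
  qed
  let ?p = "\<lambda>z. measure (M z) {\<omega>' \<in> space N. X t \<omega>' \<in> B}"
  have AM: "A \<in> sets (M x)" using sets_natural_filtration[OF A] sets_M[OF x] by simp
  have Xs: "X s \<omega> \<in> ball 0 1" if "\<omega> \<in> space (M x)" for \<omega>
    using X_in_ball[OF s] that by (simp only: space_M[OF x])
  have pm: "(\<lambda>\<omega>. ?p (X s \<omega>)) \<in> borel_measurable (M x)"
    by (rule measurable_compose[OF measurable_X_ball[OF x s] transition_measurable[OF t B]])
  have "emeasure (M x) {\<omega> \<in> A. X (s + t) \<omega> \<in> B} = ennreal (LINT \<omega>:A|M x. ?p (X s \<omega>))"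
    using strong_Markov[OF x st _ A' t B] s by (simp add: emeasure_eq_measure)
  also have "\<dots> = (\<integral>\<^sup>+\<omega>. ennreal (indicator A \<omega> * ?p (X s \<omega>)) \<partial>M x)"
    unfolding set_lebesgue_integral_def real_scaleR_def
  proof (rule nn_integral_eq_integral[symmetric])
    show "integrable (M x) (\<lambda>\<omega>. indicator A \<omega> * ?p (X s \<omega>))"
    proof (rule integrable_const_bound[where B=1])
      show "AE \<omega> in M x. norm (indicator A \<omega> * ?p (X s \<omega>)) \<le> 1"
        using prob_space.prob_le_1[OF prob_space_M[OF Xs]] by (intro AE_I2) (auto simp: indicator_def)
    qed (intro borel_measurable_times borel_measurable_indicator AM pm)
  qed auto
  also have "\<dots> = (\<integral>\<^sup>+\<omega>. indicator A \<omega> * emeasure (distr (M (X s \<omega>)) borel (X t)) B \<partial>M x)"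
    by (intro nn_integral_cong) (auto simp: emeasure_transition[OF Xs t B] indicator_def)
  finally show ?thesis .
qed

text \<open>The preceding identity says that the law of \<open>X (s + t)\<close> on the event \<open>A\<close> is that of \<open>X s\<close> on \<open>A\<close>, bound to the
  transition kernel; integrate \<open>f\<close> against both.\<close>

lemma Markov_property:
  fixes f :: "real ^ 'n \<Rightarrow> real"
  assumes x: "x \<in> ball 0 1" and s: "0 \<le> s" and t: "0 \<le> t"
    and A: "A \<in> sets (natural_filtration (space N) X s)" and f: "f \<in> borel_measurable borel"
    and bd: "\<And>z. \<bar>f z\<bar> \<le> C"
  shows "(LINT \<omega>|M x. indicator A \<omega> * f (X (s + t) \<omega>)) =
      (LINT \<omega>|M x. indicator A \<omega> * (LINT \<omega>'|M (X s \<omega>). f (X t \<omega>')))" (is ?eq)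
    and "(\<lambda>\<omega>. LINT \<omega>'|M (X s \<omega>). f (X t \<omega>')) \<in> borel_measurable (M x)" (is ?m)
proof -
  interpret prob_space "M x" by (rule prob_space_M[OF x])
  have AM: "A \<in> sets (M x)" using sets_natural_filtration[OF A] sets_M[OF x] by simp
  have X1: "X (s + t) \<in> M x \<rightarrow>\<^sub>M borel" using s t by (intro measurable_X_M[OF x]) auto
  let ?K = "\<lambda>\<omega>. distr (M (X s \<omega>)) borel (X t)" and ?D = "density (M x) (\<lambda>\<omega>. ennreal (indicator A \<omega>))"
  have K: "?K \<in> M x \<rightarrow>\<^sub>M subprob_algebra borel"
    by (rule measurable_compose[OF measurable_X_ball[OF x s] transition_kernel[OF t]])
  have I: "(LINT z|?K \<omega>. f z) = (LINT \<omega>'|M (X s \<omega>). f (X t \<omega>'))" if "\<omega> \<in> space (M x)" for \<omega>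
    using X_in_ball[OF s, of \<omega>] that by (intro integral_distr f measurable_X_M t) (simp only: space_M[OF x])
  have KI: "(\<lambda>\<omega>. LINT z|?K \<omega>. f z) \<in> borel_measurable (M x)"
    by (rule measurable_compose[OF K integral_measurable_subprob_algebra[OF f]])
  then show ?m using I by (subst measurable_cong[where g = "\<lambda>\<omega>. LINT z|?K \<omega>. f z"]) simp_all
  have im: "(\<lambda>\<omega>. indicator A \<omega>) \<in> borel_measurable (M x)" using AM by (rule borel_measurable_indicator)
  have KD: "?K \<in> ?D \<rightarrow>\<^sub>M subprob_algebra borel" using K by simp
  have ne: "space ?D \<noteq> {}" using not_empty by simp
  have "distr ?D borel (X (s + t)) = Giry_Monad.bind ?D ?K"
  proof (rule measure_eqI)
    show "sets (distr ?D borel (X (s + t))) = sets (Giry_Monad.bind ?D ?K)"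
      using sets_bind[of ?D ?K borel] ne by simp
    fix B assume "B \<in> sets (distr ?D borel (X (s + t)))"
    then have B: "B \<in> sets borel" by simp
    have V: "X (s + t) -` B \<inter> space (M x) \<in> sets (M x)" by (rule measurable_sets[OF X1 B])
    have "emeasure (distr ?D borel (X (s + t))) B = emeasure ?D (X (s + t) -` B \<inter> space (M x))"
      using X1 B by (simp add: emeasure_distr)
    also have "\<dots> = (\<integral>\<^sup>+\<omega>. ennreal (indicator A \<omega>) * indicator (X (s + t) -` B \<inter> space (M x)) \<omega> \<partial>M x)"
      using im V by (intro emeasure_density) auto
    also have "\<dots> = (\<integral>\<^sup>+\<omega>. indicator {\<omega> \<in> A. X (s + t) \<omega> \<in> B} \<omega> \<partial>M x)"
      by (intro nn_integral_cong) (auto simp: indicator_def)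
    also have "\<dots> = emeasure (M x) {\<omega> \<in> A. X (s + t) \<omega> \<in> B}"
    proof (rule nn_integral_indicator)
      have "{\<omega> \<in> A. X (s + t) \<omega> \<in> B} = A \<inter> (X (s + t) -` B \<inter> space (M x))"
        using sets.sets_into_space[OF AM] by auto
      then show "{\<omega> \<in> A. X (s + t) \<omega> \<in> B} \<in> sets (M x)" using AM V by simp
    qed
    also have "\<dots> = (\<integral>\<^sup>+\<omega>. ennreal (indicator A \<omega>) * emeasure (?K \<omega>) B \<partial>M x)"
      unfolding Markov_property_emeasure[OF x s t A B] by (simp add: ennreal_indicator)
    also have "\<dots> = (\<integral>\<^sup>+\<omega>. emeasure (?K \<omega>) B \<partial>?D)"
      using im measurable_compose[OF K measurable_emeasure_subprob_algebra[OF B]] by (intro nn_integral_density[symmetric]) auto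
    also have "\<dots> = emeasure (Giry_Monad.bind ?D ?K) B"
      by (rule emeasure_bind[OF ne KD B, symmetric])
    finally show "emeasure (distr ?D borel (X (s + t))) B = emeasure (Giry_Monad.bind ?D ?K) B" .
  qed
  note D = this
  have "(LINT \<omega>|M x. indicator A \<omega> * f (X (s + t) \<omega>)) = (LINT \<omega>|?D. f (X (s + t) \<omega>))"
    using im measurable_compose[OF X1 f] by (subst integral_density) auto
  also have "\<dots> = (LINT z|distr ?D borel (X (s + t)). f z)"
    using X1 by (intro integral_distr[symmetric] f) simp
  also have "\<dots> = (LINT z|Giry_Monad.bind ?D ?K. f z)" unfolding D ..
  also have "\<dots> = (LINT \<omega>|?D. LINT z|?K \<omega>. f z)"
  proof (rule integral_bind[OF f])
    show "\<bar>f z\<bar> \<le> C" for z by (rule bd)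
    show "finite_measure ?D"
      by (rule finite_measureI) (simp add: ennreal_indicator emeasure_restricted[OF AM] emeasure_eq_measure)
    show "AE \<omega> in ?D. emeasure (?K \<omega>) (space (?K \<omega>)) \<le> ennreal 1"
      using subprob_space.emeasure_space_le_1[OF subprob_space_kernel[OF KD]] by (intro AE_I2) simp
  qed (use KD in simp_all)
  also have "\<dots> = (LINT \<omega>|M x. indicator A \<omega> * (LINT z|?K \<omega>. f z))"
    using im KI by (subst integral_density) auto
  also have "\<dots> = (LINT \<omega>|M x. indicator A \<omega> * (LINT \<omega>'|M (X s \<omega>). f (X t \<omega>')))"
    by (intro Bochner_Integration.integral_cong refl) (simp add: I)
  finally show ?eq .
qed

end

section \<open>Exit from a ball\<close>

context ball_diffusion
begin

abbreviation stay_below :: "real \<Rightarrow> nat \<Rightarrow> nat \<Rightarrow> 'w set" where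
  "stay_below q m k \<equiv> {\<omega> \<in> space N. \<forall>i\<le>k. norm (X (real i / 2 ^ m) \<omega>) \<le> q}"

abbreviation grid_position :: "real \<Rightarrow> nat \<Rightarrow> nat \<Rightarrow> 'w \<Rightarrow> real ^ 'n" where
  "grid_position q T m \<omega> \<equiv> X (grid_exit (\<lambda>t. X t \<omega>) q T m) \<omega>"

abbreviation level_position :: "real \<Rightarrow> nat \<Rightarrow> 'w \<Rightarrow> real ^ 'n" where
  "level_position q T \<omega> \<equiv> X (exit_above (\<lambda>t. X t \<omega>) q T) \<omega>"

lemma grid_exit_measurable:
  assumes x: "x \<in> ball 0 1"
  shows "(\<lambda>\<omega>. grid_position q T m \<omega>) \<in> borel_measurable (M x)"
proof -
  have [measurable]: "X (real k / 2 ^ m) \<in> borel_measurable (M x)" "X ((1 + real k) / 2 ^ m) \<in> borel_measurable (M x)"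
     "X 0 \<in> borel_measurable (M x)" for k
    by (auto intro!: measurable_X_M[OF x])
  show ?thesis
    by (subst grid_exit_telescope[where h="\<lambda>z. z"]) simp
qed

lemma exit_above_measurable:
  assumes x: "x \<in> ball 0 1"
  shows "(\<lambda>\<omega>. level_position q T \<omega>) \<in> borel_measurable (M x)"
proof (rule borel_measurable_LIMSEQ_metric[OF grid_exit_measurable[OF x]])
  fix \<omega> assume "\<omega> \<in> space (M x)"
  then show "(\<lambda>m. grid_position q T m \<omega>) \<longlonglongrightarrow> level_position q T \<omega>"
    by (intro continuous_on_grid_exit_tendsto continuous_paths) (simp add: space_M[OF x])
qed

text \<open>Dynkin's formula on the grid, as an inequality: if one step of the semigroup raises \<open>f\<close> by at least
  \<open>d 2\<^sup>-\<^sup>m\<close> below the level \<open>q\<close>, then every step made before the exit contributes at least that much.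
  Applied with small negative \<open>d\<close> to \<open>f\<close> and \<open>- f\<close> it gives the mean value property, with positive \<open>d\<close> it
  bounds the time spent below the level.\<close>

lemma expectation_grid_exit_ge:
  fixes f :: "real ^ 'n \<Rightarrow> real"
  assumes x: "x \<in> ball 0 1" and f: "f \<in> borel_measurable borel" and bd: "\<And>z. \<bar>f z\<bar> \<le> C"
    and low: "\<And>z. z \<in> ball 0 1 \<Longrightarrow> norm z \<le> q \<Longrightarrow> d / 2 ^ m \<le> (LINT \<omega>|M z. f (X (1 / 2 ^ m) \<omega>)) - f z"
  shows "f x + d / 2 ^ m * (\<Sum>k<T * 2 ^ m. measure (M x) (stay_below q m k))
     \<le> (LINT \<omega>|M x. f (grid_position q T m \<omega>))"
proof -
  interpret prob_space "M x" by (rule prob_space_M[OF x])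
  let ?A = "\<lambda>k. (stay_below q m k)"
  have [measurable]: "X (real k / 2 ^ m) \<in> borel_measurable (M x)" "X ((1 + real k) / 2 ^ m) \<in> borel_measurable (M x)"
     "X 0 \<in> borel_measurable (M x)" "f \<in> borel_measurable borel" for k
    by (auto intro!: measurable_X_M[OF x] f)
  have A: "?A k \<in> sets (natural_filtration (space N) X (real k / 2 ^ m))" for k
  proof -
    let ?F = "natural_filtration (space N) X (real k / 2 ^ m)"
    have sp: "space ?F = space N"
      by (rule filtration.space_F[OF filtration_natural_filtration])
    have [measurable]: "i \<le> k \<Longrightarrow> X (real i / 2 ^ m) \<in> ?F \<rightarrow>\<^sub>M borel" for i
      by (rule measurable_natural_filtration) (auto simp: divide_right_mono)
    have "?A k = (\<Inter>i\<in>{..k}. {\<omega>\<in>space ?F. norm (X (real i / 2 ^ m) \<omega>) \<le> q})"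
      by (auto simp: sp)
    also have "\<dots> \<in> sets ?F"
      by (intro sets.finite_INT) (auto, measurable)
    finally show ?thesis .
  qed
  have AM [measurable]: "?A k \<in> sets (M x)" for k
    using sets_natural_filtration[OF A] sets_M[OF x] by simp
  have C0: "0 \<le> C" using bd[of 0] by linarith
  have int: "integrable (M x) (\<lambda>\<omega>. indicator (?A k) \<omega> * f (X (real i / 2 ^ m) \<omega>))" for k i
  proof (rule integrable_const_bound[where B=C])
    show "AE \<omega> in M x. norm (indicator (?A k) \<omega> * f (X (real i / 2 ^ m) \<omega>)) \<le> C"
      using bd C0 by (auto simp: indicator_def)
  qed measurable
  have int0: "integrable (M x) (\<lambda>\<omega>. f (X 0 \<omega>))"
    using bd by (intro integrable_const_bound[where B=C]) auto
  have step: "d / 2 ^ m * prob (?A k) \<le>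
     (LINT \<omega>|M x. indicator (?A k) \<omega> * (f (X (real (Suc k) / 2 ^ m) \<omega>) - f (X (real k / 2 ^ m) \<omega>)))" for k
  proof -
    let ?P = "\<lambda>z. LINT \<omega>'|M z. f (X (1 / 2 ^ m) \<omega>')"
    have k: "real (Suc k) / 2 ^ m = real k / 2 ^ m + 1 / 2 ^ m" by (simp add: field_simps)
    have eq: "(LINT \<omega>|M x. indicator (?A k) \<omega> * f (X (real k / 2 ^ m + 1 / 2 ^ m) \<omega>)) =
        (LINT \<omega>|M x. indicator (?A k) \<omega> * ?P (X (real k / 2 ^ m) \<omega>))"
      and Pm: "(\<lambda>\<omega>. ?P (X (real k / 2 ^ m) \<omega>)) \<in> borel_measurable (M x)"
      using Markov_property[where t = "1 / 2 ^ m", OF x _ _ A[of k] f bd] by auto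
    have b: "X (real k / 2 ^ m) \<omega> \<in> ball 0 1" if "\<omega> \<in> space N" for \<omega>
      using X_in_ball[OF _ that, of "real k / 2 ^ m"] by simp
    have Pb: "\<bar>?P z\<bar> \<le> C" if z: "z \<in> ball 0 1" for z
    proof -
      interpret Q: prob_space "M z" by (rule prob_space_M[OF z])
      have [measurable]: "X (1 / 2 ^ m) \<in> M z \<rightarrow>\<^sub>M borel" by (rule measurable_X_M[OF z]) simp
      have "\<bar>?P z\<bar> \<le> (LINT \<omega>'|M z. \<bar>f (X (1 / 2 ^ m) \<omega>')\<bar>)" by (rule integral_abs_bound)
      also have "\<dots> \<le> (LINT \<omega>'|M z. C)"
        using bd C0 by (intro integral_mono Q.integrable_const_bound[where B=C]) auto
      finally show ?thesis by (simp add: Q.prob_space)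
    qed
    have intP: "integrable (M x) (\<lambda>\<omega>. indicator (?A k) \<omega> * ?P (X (real k / 2 ^ m) \<omega>))"
    proof (rule integrable_const_bound[where B=C])
      show "AE \<omega> in M x. norm (indicator (?A k) \<omega> * ?P (X (real k / 2 ^ m) \<omega>)) \<le> C"
        using Pb[OF b] C0 by (intro AE_I2) (auto simp: indicator_def space_M[OF x])
    qed (intro borel_measurable_times borel_measurable_indicator AM Pm)
    have "d / 2 ^ m * prob (?A k) = (LINT \<omega>|M x. indicator (?A k) \<omega> * (d / 2 ^ m))"
      by (simp only: integral_mult_right_zero Bochner_Integration.integral_indicator sets.Int_space_eq2[OF AM] mult.commute)
    also have "\<dots> \<le> (LINT \<omega>|M x. indicator (?A k) \<omega> * ?P (X (real k / 2 ^ m) \<omega>)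
        - indicator (?A k) \<omega> * f (X (real k / 2 ^ m) \<omega>))"
    proof (rule integral_mono)
      show "integrable (M x) (\<lambda>\<omega>. indicator (?A k) \<omega> * (d / 2 ^ m))"
      proof (rule integrable_const_bound[where B="\<bar>d / 2 ^ m\<bar>"])
        show "AE \<omega> in M x. norm (indicator (?A k) \<omega> * (d / 2 ^ m)) \<le> \<bar>d / 2 ^ m\<bar>"
          by (intro AE_I2) (simp split: split_indicator)
      qed (intro borel_measurable_times borel_measurable_indicator AM borel_measurable_const)
      show "integrable (M x) (\<lambda>\<omega>. indicator (?A k) \<omega> * ?P (X (real k / 2 ^ m) \<omega>)
        - indicator (?A k) \<omega> * f (X (real k / 2 ^ m) \<omega>))"
        by (intro Bochner_Integration.integrable_diff intP int)
      fix \<omega> assume "\<omega> \<in> space (M x)"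
      then have "\<omega> \<in> space N" using space_M x by simp
      then show "indicator (?A k) \<omega> * (d / 2 ^ m) \<le> indicator (?A k) \<omega> * ?P (X (real k / 2 ^ m) \<omega>)
        - indicator (?A k) \<omega> * f (X (real k / 2 ^ m) \<omega>)"
        using low[OF b] by (auto simp: indicator_def)
    qed
    also have "\<dots> = (LINT \<omega>|M x. indicator (?A k) \<omega> * ?P (X (real k / 2 ^ m) \<omega>))
        - (LINT \<omega>|M x. indicator (?A k) \<omega> * f (X (real k / 2 ^ m) \<omega>))"
      by (rule Bochner_Integration.integral_diff[OF intP int])
    also have "\<dots> = (LINT \<omega>|M x. indicator (?A k) \<omega> * f (X (real (Suc k) / 2 ^ m) \<omega>))
        - (LINT \<omega>|M x. indicator (?A k) \<omega> * f (X (real k / 2 ^ m) \<omega>))"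
      by (simp only: k eq)
    also have "\<dots> = (LINT \<omega>|M x. indicator (?A k) \<omega> * f (X (real (Suc k) / 2 ^ m) \<omega>)
        - indicator (?A k) \<omega> * f (X (real k / 2 ^ m) \<omega>))"
      by (rule Bochner_Integration.integral_diff[symmetric, OF int int])
    also have "\<dots> = (LINT \<omega>|M x. indicator (?A k) \<omega> * (f (X (real (Suc k) / 2 ^ m) \<omega>) - f (X (real k / 2 ^ m) \<omega>)))"
      by (simp only: right_diff_distrib)
    finally show ?thesis .
  qed
  have "(LINT \<omega>|M x. f (grid_position q T m \<omega>)) = (LINT \<omega>|M x. f (X 0 \<omega>) +
     (\<Sum>k<T * 2 ^ m. indicator (?A k) \<omega> * (f (X (real (Suc k) / 2 ^ m) \<omega>) - f (X (real k / 2 ^ m) \<omega>))))"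
  proof (rule Bochner_Integration.integral_cong[OF refl])
    fix \<omega> assume "\<omega> \<in> space (M x)"
    then have w: "\<omega> \<in> space N" using space_M x by simp
    have e: "(if \<forall>i\<le>k. norm (X (real i / 2 ^ m) \<omega>) \<le> q then 1 else 0) = (indicator (?A k) \<omega> :: real)" for k
      using w by (auto simp: indicator_def)
    show "f (grid_position q T m \<omega>) = f (X 0 \<omega>) +
     (\<Sum>k<T * 2 ^ m. indicator (?A k) \<omega> * (f (X (real (Suc k) / 2 ^ m) \<omega>) - f (X (real k / 2 ^ m) \<omega>)))"
      by (subst grid_exit_telescope[where h=f and c="\<lambda>t. X t \<omega>"]) (simp only: e real_scaleR_def)
  qed
  also have "\<dots> = (LINT \<omega>|M x. f (X 0 \<omega>)) +
     (\<Sum>k<T * 2 ^ m. LINT \<omega>|M x. indicator (?A k) \<omega> * (f (X (real (Suc k) / 2 ^ m) \<omega>) - f (X (real k / 2 ^ m) \<omega>)))"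
  proof -
    have d: "integrable (M x) (\<lambda>\<omega>. indicator (?A k) \<omega> * (f (X (real (Suc k) / 2 ^ m) \<omega>) - f (X (real k / 2 ^ m) \<omega>)))" for k
      unfolding right_diff_distrib by (intro Bochner_Integration.integrable_diff int)
    show ?thesis
      by (subst Bochner_Integration.integral_add[OF int0 Bochner_Integration.integrable_sum[OF d]])
        (simp only: Bochner_Integration.integral_sum[OF d])
  qed
  also have "(LINT \<omega>|M x. f (X 0 \<omega>)) = (LINT \<omega>|M x. f x)"
    using start[OF x] by (intro integral_cong_AE) auto
  also have "\<dots> = f x" by (simp add: prob_space)
  also have "f x + d / 2 ^ m * (\<Sum>k<T * 2 ^ m. prob (?A k)) \<le> f x + (\<Sum>k<T * 2 ^ m. LINT \<omega>|M x.
     indicator (?A k) \<omega> * (f (X (real (Suc k) / 2 ^ m) \<omega>) - f (X (real k / 2 ^ m) \<omega>)))"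
    unfolding sum_distrib_left by (intro add_left_mono sum_mono step)
  finally show ?thesis by simp
qed

end

lemma C2_compact_support_bounded:
  assumes "C2_compact_support f"
  obtains C where "\<And>z. \<bar>f z\<bar> \<le> C"
proof -
  obtain K where K: "compact K" "\<And>x. x \<notin> K \<Longrightarrow> f x = 0" and c: "C2 f"
    using assms unfolding C2_compact_support_def by auto
  have "bounded (f ` K)"
    using C2_regularity(3)[OF c] K(1) by (intro compact_imp_bounded compact_continuous_image) (auto intro: continuous_on_subset)
  then obtain C where C: "\<And>z. z \<in> K \<Longrightarrow> \<bar>f z\<bar> \<le> C" by (auto simp: bounded_iff)
  have "\<bar>f z\<bar> \<le> max C 0" for z using C[of z] K(2)[of z] by (cases "z \<in> K") auto
  then show thesis by (rule that)
qed

lemma C2_measurable: "C2 f \<Longrightarrow> f \<in> borel_measurable borel"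
  by (intro borel_measurable_continuous_onI C2_regularity)

context hyperbolic_Brownian_motion
begin

lemma generator_increment:
  assumes f: "C2_compact_support f" and e: "0 < e"
  shows "\<forall>\<^sub>F m in sequentially. \<forall>z\<in>ball 0 1.
    \<bar>(LINT \<omega>|M z. f (X (1 / 2 ^ m) \<omega>)) - f z - laplace_beltrami f z / 2 ^ m\<bar> \<le> e / 2 ^ m"
proof -
  have 0: "(\<lambda>m. 1 / 2 ^ m :: real) \<longlonglongrightarrow> 0"
    using LIMSEQ_power_zero[of "1/2::real"] by (simp add: power_one_over)
  have lim: "filterlim (\<lambda>m. 1 / 2 ^ m :: real) (at_right 0) sequentially"
    using 0 by (auto simp: filterlim_at)
  have "\<forall>\<^sub>F t in at_right 0. \<forall>z\<in>ball 0 1.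
      dist (((LINT \<omega>|M z. f (X t \<omega>)) - f z) / t) (laplace_beltrami f z) < e"
    using uniform_limitD[OF generator[OF f, unfolded in_generator_def] e] .
  from eventually_compose_filterlim[OF this lim] show ?thesis
  proof eventually_elim
    case (elim m)
    show ?case
    proof
      fix z :: "real ^ 'n" assume z: "z \<in> ball 0 1"
      let ?D = "(LINT \<omega>|M z. f (X (1 / 2 ^ m) \<omega>)) - f z"
      from elim z have *: "\<bar>?D / (1 / 2 ^ m) - laplace_beltrami f z\<bar> < e"
        by (auto simp: dist_real_def)
      have "\<bar>?D - laplace_beltrami f z / 2 ^ m\<bar> =
        \<bar>?D / (1 / 2 ^ m) - laplace_beltrami f z\<bar> / 2 ^ m"
      proof -
        have "D - L / 2 ^ m = (D / (1 / 2 ^ m) - L) / 2 ^ m" for D L :: real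
          by (simp add: field_simps)
        then show ?thesis by (simp only: abs_divide) simp
      qed
      also have "\<dots> \<le> e / 2 ^ m" using * by (simp add: divide_right_mono)
      finally show "\<bar>?D - laplace_beltrami f z / 2 ^ m\<bar> \<le> e / 2 ^ m" .
    qed
  qed
qed

text \<open>A bounded function cannot grow at a rate \<open>c > 0\<close> for ever: the probability of staying in the ball up
  to time \<open>T\<close> is \<open>O (1 / T)\<close>.\<close>

lemma AE_hits_sphere:
  fixes f :: "real ^ 'n \<Rightarrow> real"
  assumes x: "x \<in> ball 0 1" and f: "C2_compact_support f" and c: "0 < c"
    and sub: "\<And>z. z \<in> ball 0 1 \<Longrightarrow> norm z \<le> r \<Longrightarrow> c \<le> laplace_beltrami f z"
  shows "AE \<omega> in M x. \<exists>t\<ge>0. r \<le> norm (X t \<omega>)"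
proof -
  interpret prob_space "M x" by (rule prob_space_M[OF x])
  obtain C where C: "\<bar>f z\<bar> \<le> C" for z using C2_compact_support_bounded[OF f] by blast
  have fm [measurable]: "f \<in> borel_measurable borel"
    using f by (auto simp: C2_compact_support_def intro: C2_measurable)
  \<comment> \<open>The event of being in the ball at all dyadic times up to \<open>T\<close>, measurable as a countable intersection.\<close>
  define B where "B T = {\<omega>\<in>space N. \<forall>m k. real k \<le> real T * 2 ^ m \<longrightarrow> norm (X (real k / 2 ^ m) \<omega>) \<le> r}" for T :: nat
  have [measurable]: "X (real k / 2 ^ m) \<in> borel_measurable (M x)" for k m :: nat
    by (auto intro!: measurable_X_M[OF x])
  have Bm: "B T \<in> sets (M x)" for T
    unfolding B_def space_M[OF x, symmetric] by measurable
  have bound: "c * T * prob (B T) \<le> 4 * C" for T :: nat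
  proof -
    obtain m where m: "\<forall>z\<in>ball 0 1.
      \<bar>(LINT \<omega>|M z. f (X (1 / 2 ^ m) \<omega>)) - f z - laplace_beltrami f z / 2 ^ m\<bar> \<le> (c / 2) / 2 ^ m"
      using generator_increment[OF f, of "c / 2"] c by (auto simp: eventually_sequentially)
    have "f x + (c / 2) / 2 ^ m * (\<Sum>k<T * 2 ^ m. prob (stay_below r m k))
     \<le> (LINT \<omega>|M x. f (grid_position r T m \<omega>))"
    proof (rule expectation_grid_exit_ge[OF x fm C])
      fix z :: "real ^ 'n" assume z: "z \<in> ball 0 1" "norm z \<le> r"
      have "c / 2 ^ m \<le> laplace_beltrami f z / 2 ^ m"
        using sub[OF z] by (simp add: divide_right_mono)
      moreover have "(c / 2) / 2 ^ m = c / 2 ^ m - (c / 2) / 2 ^ m" by (simp add: field_simps)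
      ultimately show "(c / 2) / 2 ^ m \<le> (LINT \<omega>|M z. f (X (1 / 2 ^ m) \<omega>)) - f z"
        using m z by fastforce
    qed
    also have "\<dots> \<le> (LINT \<omega>|M x. C)"
    proof (rule integral_mono)
      show "integrable (M x) (\<lambda>\<omega>. f (grid_position r T m \<omega>))"
        using C by (intro integrable_const_bound[where B=C] measurable_compose[OF grid_exit_measurable[OF x] fm]) auto
    qed (use C in \<open>auto simp: abs_le_iff\<close>)
    also have "\<dots> = C" by (simp add: prob_space)
    finally have 1: "(c / 2) / 2 ^ m * (\<Sum>k<T * 2 ^ m. prob (stay_below r m k)) \<le> 2 * C"
      using C[of x] by (simp add: abs_le_iff)
    have "(\<Sum>k<T * 2 ^ m. prob (B T)) \<le> (\<Sum>k<T * 2 ^ m. prob (stay_below r m k))"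
    proof (intro sum_mono finite_measure_mono)
      fix k assume k: "k \<in> {..<T * 2 ^ m}"
      have "real i \<le> real T * 2 ^ m" if "i \<le> k" for i
      proof -
        have "i \<le> T * 2 ^ m" using that k by auto
        then have "real i \<le> real (T * 2 ^ m)" by (simp only: of_nat_le_iff)
        then show ?thesis by simp
      qed
      then show "B T \<subseteq> (stay_below r m k)"
        by (auto simp: B_def)
      show "stay_below r m k \<in> sets (M x)"
        unfolding space_M[OF x, symmetric] by measurable
    qed
    then have "(c / 2) / 2 ^ m * (\<Sum>k<T * 2 ^ m. prob (B T)) \<le> 2 * C"
      using c 1 by (meson divide_nonneg_nonneg less_imp_le mult_left_mono order.trans zero_le_numeral zero_le_power zero_le_divide_iff)
    then show ?thesis by (simp add: field_simps)
  qed
  have "prob (\<Inter>T. B T) = 0"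
  proof (rule ccontr)
    let ?p = "prob (\<Inter>T. B T)"
    assume "?p \<noteq> 0"
    then have p: "0 < ?p" using measure_nonneg[of "M x"] by (simp add: less_le)
    obtain T :: nat where T: "4 * C / (c * ?p) < real T" using reals_Archimedean2 by blast
    have "?p \<le> prob (B T)" by (intro finite_measure_mono Bm) auto
    then have "c * T * ?p \<le> 4 * C" using bound[of T] c by (meson mult_left_mono order.trans mult_nonneg_nonneg less_imp_le of_nat_0_le_iff)
    with T c p show False by (simp add: field_simps)
  qed
  then have "(\<Inter>T. B T) \<in> null_sets (M x)"
    using Bm by (auto simp: null_sets_def emeasure_eq_measure)
  moreover have "\<omega> \<in> (\<Inter>T. B T)" if "\<omega> \<in> space (M x)" "\<not> (\<exists>t\<ge>0. r \<le> norm (X t \<omega>))" for \<omega>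
  proof -
    have "norm (X (real k / 2 ^ m) \<omega>) \<le> r" for k m :: nat
      using that(2) by (meson divide_nonneg_nonneg linear of_nat_0_le_iff zero_le_numeral zero_le_power)
    then show ?thesis using that(1) by (auto simp: B_def space_M[OF x])
  qed
  ultimately show ?thesis by (auto intro!: AE_I'[of "\<Inter>T. B T"])
qed

text \<open>Defined as a limit of positions at exit times from smaller balls, so that measurability is
  immediate. On the paths that start inside and reach the sphere it is the position at the exit
  time.\<close>

definition exit_position :: "real \<Rightarrow> 'w \<Rightarrow> real ^ 'n" where
  "exit_position r \<omega> = lim (\<lambda>j. level_position (r - 1 / (real j + 1)) j \<omega>)"

lemma exit_position_measurable: "x \<in> ball 0 1 \<Longrightarrow> exit_position r \<in> borel_measurable (M x)"
  unfolding exit_position_def by (intro borel_measurable_lim_metric exit_above_measurable)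

lemma levels_tendsto: "(\<lambda>j. r - 1 / (real j + 1)) \<longlonglongrightarrow> r"
  by real_asymp

lemma exit_above_position_tendsto:
  assumes "\<omega> \<in> space N" "norm (X 0 \<omega>) < r" "\<exists>t\<ge>0. r \<le> norm (X t \<omega>)"
  shows "(\<lambda>j. level_position (r - 1 / (real j + 1)) j \<omega>) \<longlonglongrightarrow> X (exit_time X r \<omega>) \<omega>"
proof -
  note c = continuous_paths[OF assms(1)]
  note e = exit_time_properties[where X = X and \<omega> = \<omega> and r = r, OF c assms(3) less_imp_le[OF assms(2)]]
  have "(\<lambda>j. exit_above (\<lambda>t. X t \<omega>) (r - 1 / (real j + 1)) j) \<longlonglongrightarrow> exit_time X r \<omega>"
    by (rule exit_above_tendsto[OF c e(1) _ e(3) levels_tendsto]) (use e in \<open>auto intro: less_imp_le\<close>)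
  then show ?thesis
    by (rule continuous_on_tendsto_compose[OF c]) (auto simp: e exit_above_bounds)
qed

lemma exit_position_eq:
  assumes "\<omega> \<in> space N" "norm (X 0 \<omega>) < r" "\<exists>t\<ge>0. r \<le> norm (X t \<omega>)"
  shows "exit_position r \<omega> = X (exit_time X r \<omega>) \<omega>"
  unfolding exit_position_def by (rule limI) (rule exit_above_position_tendsto[OF assms])

lemma hits_sphere_measurable:
  assumes x: "x \<in> ball 0 1"
  shows "{\<omega>\<in>space (M x). \<exists>t\<ge>0. r \<le> norm (X t \<omega>)} \<in> sets (M x)"
proof -
  have [measurable]: "X (real k / 2 ^ m) \<in> borel_measurable (M x)" for k m :: nat
    by (auto intro!: measurable_X_M[OF x])
  have "{\<omega>\<in>space (M x). \<exists>t\<ge>0. r \<le> norm (X t \<omega>)} = {\<omega>\<in>space (M x).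
    \<exists>T::nat. \<forall>j::nat. \<exists>m k. real k / 2 ^ m \<le> T \<and> r - 1 / (real j + 1) < norm (X (real k / 2 ^ m) \<omega>)}"
    by (intro Collect_cong conj_cong refl hits_sphere_iff[OF continuous_paths levels_tendsto])
      (simp_all add: space_M[OF x])
  also have "\<dots> \<in> sets (M x)" by measurable
  finally show ?thesis .
qed

text \<open>Below a level \<open>q < r\<close> the generator annihilates \<open>f\<close>, so on the grid the mean value property holds up to
  \<open>T\<close> times the uniform error of the difference quotient. First the mesh tends to 0 at fixed level and time bound,
  then the level to \<open>r\<close> and the time bound to infinity.\<close>

lemma expectation_exit_position:
  assumes x: "norm x < r" and r: "r < 1" and f: "C2_compact_support f"
    and harm: "\<And>z. norm z < r \<Longrightarrow> laplace_beltrami f z = 0"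
    and hit: "AE \<omega> in M x. \<exists>t\<ge>0. r \<le> norm (X t \<omega>)"
  shows "(LINT \<omega>|M x. f (exit_position r \<omega>)) = f x"
proof -
  have xb: "x \<in> ball 0 1" using x r by simp
  interpret prob_space "M x" by (rule prob_space_M[OF xb])
  obtain C where C: "\<bar>f z\<bar> \<le> C" for z using C2_compact_support_bounded[OF f] by blast
  have C2: "C2 f" using f by (simp add: C2_compact_support_def)
  have fm [measurable]: "f \<in> borel_measurable borel" by (rule C2_measurable[OF C2])
  have cont: "isCont f z" for z
    using C2_regularity(3)[OF C2] by (simp add: continuous_on_eq_continuous_at)
  have grid: "\<bar>(LINT \<omega>|M x. f (grid_position q T m \<omega>)) - f x\<bar> \<le> e * T"
    if q: "q < r" and e: "0 < e" and m: "\<forall>z\<in>ball 0 1.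
       \<bar>(LINT \<omega>|M z. f (X (1 / 2 ^ m) \<omega>)) - f z - laplace_beltrami f z / 2 ^ m\<bar> \<le> e / 2 ^ m" for q e T m
  proof -
    let ?S = "\<Sum>k<T * 2 ^ m. prob (stay_below q m k)"
    have "?S \<le> (\<Sum>k<T * 2 ^ m. 1)" by (intro sum_mono prob_le_1)
    then have "e / 2 ^ m * ?S \<le> e / 2 ^ m * (T * 2 ^ m)" using e by (intro mult_left_mono) auto
    then have S: "e / 2 ^ m * ?S \<le> e * T" by simp
    have "f x + (- e) / 2 ^ m * ?S \<le> (LINT \<omega>|M x. f (grid_position q T m \<omega>))"
    proof (rule expectation_grid_exit_ge[OF xb fm C])
      fix z :: "real ^ 'n" assume z: "z \<in> ball 0 1" "norm z \<le> q"
      then show "- e / 2 ^ m \<le> (LINT \<omega>|M z. f (X (1 / 2 ^ m) \<omega>)) - f z"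
        using m harm[of z] q by fastforce
    qed
    moreover have "- f x + (- e) / 2 ^ m * ?S \<le> (LINT \<omega>|M x. - f (grid_position q T m \<omega>))"
    proof (rule expectation_grid_exit_ge[OF xb, of "\<lambda>z. - f z"])
      fix z :: "real ^ 'n" assume z: "z \<in> ball 0 1" "norm z \<le> q"
      then show "- e / 2 ^ m \<le> (LINT \<omega>|M z. - f (X (1 / 2 ^ m) \<omega>)) - (- f z)"
        using m harm[of z] q by fastforce
    qed (use C in auto)
    ultimately show ?thesis using S by (simp add: abs_le_iff)
  qed
  have level: "(LINT \<omega>|M x. f (level_position q T \<omega>)) = f x" if q: "q < r" for q T
  proof (rule LIMSEQ_unique)
    show "(\<lambda>m. LINT \<omega>|M x. f (grid_position q T m \<omega>))
       \<longlonglongrightarrow> (LINT \<omega>|M x. f (level_position q T \<omega>))"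
    proof (rule integral_dominated_convergence[where w="\<lambda>_. C"])
      show "AE \<omega> in M x. (\<lambda>m. f (grid_position q T m \<omega>)) \<longlonglongrightarrow> f (level_position q T \<omega>)"
        by (intro AE_I2 isCont_tendsto_compose[OF cont] continuous_on_grid_exit_tendsto continuous_paths)
          (simp add: space_M[OF xb])
    qed (use C in \<open>auto intro!: measurable_compose[OF grid_exit_measurable[OF xb] fm]
        measurable_compose[OF exit_above_measurable[OF xb] fm]\<close>)
    show "(\<lambda>m. LINT \<omega>|M x. f (grid_position q T m \<omega>)) \<longlonglongrightarrow> f x"
    proof (rule tendstoI)
      fix e :: real assume e: "0 < e"
      define e' where "e' = e / (real T + 1)"
      have e': "0 < e'" "e' * T < e" using e by (auto simp: e'_def field_simps)
      show "\<forall>\<^sub>F m in sequentially. dist (LINT \<omega>|M x. f (grid_position q T m \<omega>)) (f x) < e"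
        using generator_increment[OF f e'(1)]
      proof eventually_elim
        case (elim m)
        from grid[OF q e'(1) elim, of T] e'(2) show ?case by (simp add: dist_real_def)
      qed
    qed
  qed
  show ?thesis
  proof (rule LIMSEQ_unique)
    show "(\<lambda>j. LINT \<omega>|M x. f (level_position (r - 1 / (real j + 1)) j \<omega>))
       \<longlonglongrightarrow> (LINT \<omega>|M x. f (exit_position r \<omega>))"
    proof (rule integral_dominated_convergence[where w="\<lambda>_. C"])
      show "AE \<omega> in M x. (\<lambda>j. f (level_position (r - 1 / (real j + 1)) j \<omega>)) \<longlonglongrightarrow> f (exit_position r \<omega>)"
        using hit start[OF xb]
      proof (rule AE_mp[OF AE_conjI], intro AE_I2 impI)
        fix \<omega> assume w: "\<omega> \<in> space (M x)" and h: "(\<exists>t\<ge>0. r \<le> norm (X t \<omega>)) \<and> X 0 \<omega> = x"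
        then have w': "\<omega> \<in> space N" "norm (X 0 \<omega>) < r" "\<exists>t\<ge>0. r \<le> norm (X t \<omega>)"
          using x space_M[OF xb] by auto
        show "(\<lambda>j. f (level_position (r - 1 / (real j + 1)) j \<omega>)) \<longlonglongrightarrow> f (exit_position r \<omega>)"
          unfolding exit_position_eq[OF w'] by (intro isCont_tendsto_compose[OF cont] exit_above_position_tendsto w')
      qed
    qed (use C in \<open>auto intro!: measurable_compose[OF exit_position_measurable[OF xb] fm]
        measurable_compose[OF exit_above_measurable[OF xb] fm]\<close>)
    show "(\<lambda>j. LINT \<omega>|M x. f (level_position (r - 1 / (real j + 1)) j \<omega>)) \<longlonglongrightarrow> f x"
      by (subst level) auto
  qed
qed

end

section \<open>The surface measure of a sphere\<close>

lemma nn_integral_lborel_translate: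
  fixes g :: "'a::euclidean_space \<Rightarrow> ennreal"
  assumes [measurable]: "g \<in> borel_measurable borel"
  shows "(\<integral>\<^sup>+x. g (c + x) \<partial>lborel) = (\<integral>\<^sup>+x. g x \<partial>lborel)"
proof -
  have "(\<integral>\<^sup>+x. g x \<partial>lborel) = (\<integral>\<^sup>+x. g x \<partial>distr lborel borel ((+) c))"
    by (simp add: lborel_distr_plus)
  also have "\<dots> = (\<integral>\<^sup>+x. g (c + x) \<partial>lborel)"
    by (rule nn_integral_distr) measurable
  finally show ?thesis by simp
qed

text \<open>The uniqueness argument for Haar measure, with the unit ball as reference set. Writing \<open>\<lambda>\<close> for Lebesgue
  measure, \<open>\<nu>\<close> for its image and \<open>B\<close> for the ball, \<open>\<nu> A * \<lambda> B\<close> is the double integral of \<open>1\<^sub>A (f x) 1\<^sub>B y\<close>;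
  translating first \<open>y\<close> by \<open>- f x\<close>, and then \<open>x\<close> by the preimage of \<open>y\<close>, turns it into the double
  integral of \<open>1\<^sub>A (f x + y) 1\<^sub>B (- f x)\<close>, which is \<open>\<lambda> A * \<lambda> B\<close>.\<close>

lemma lborel_orthogonal_invariant:
  fixes f :: "'a::euclidean_space \<Rightarrow> 'a"
  assumes f: "orthogonal_transformation f"
  shows "distr lborel borel f = lborel"
proof (rule measure_eqI)
  fix A assume "A \<in> sets (distr lborel borel f)"
  then have A [measurable]: "A \<in> sets borel" by simp
  have lin: "linear f" by (rule orthogonal_transformation_linear[OF f])
  have [measurable]: "f \<in> borel_measurable borel"
    using lin by (intro borel_measurable_continuous_onI linear_continuous_on) (simp add: linear_conv_bounded_linear)
  define B :: "'a set" where "B = ball 0 1"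
  have [measurable]: "B \<in> sets borel" by (simp add: B_def)
  have "emeasure (distr lborel borel f) A = (\<integral>\<^sup>+x. indicator A x \<partial>distr lborel borel f)"
    by simp
  also have "\<dots> = (\<integral>\<^sup>+x. indicator A (f x) \<partial>lborel)"
    by (rule nn_integral_distr) measurable
  finally have "emeasure (distr lborel borel f) A * emeasure lborel B =
     (\<integral>\<^sup>+x. indicator A (f x) * (\<integral>\<^sup>+y. indicator B y \<partial>lborel) \<partial>lborel)"
    by (simp add: nn_integral_multc)
  also have "\<dots> = (\<integral>\<^sup>+x. (\<integral>\<^sup>+y. indicator A (f x) * indicator B (- f x + y) \<partial>lborel) \<partial>lborel)"
  proof (rule nn_integral_cong)
    fix x
    have t: "(\<integral>\<^sup>+y. indicator B y \<partial>lborel) = (\<integral>\<^sup>+y. indicator B (- f x + y) \<partial>lborel)"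
      by (rule nn_integral_lborel_translate[symmetric]) measurable
    show "indicator A (f x) * (\<integral>\<^sup>+y. indicator B y \<partial>lborel) =
        (\<integral>\<^sup>+y. indicator A (f x) * indicator B (- f x + y) \<partial>lborel)"
      unfolding t by (rule nn_integral_cmult[symmetric]) measurable
  qed
  also have "\<dots> = (\<integral>\<^sup>+y. (\<integral>\<^sup>+x. indicator A (f x) * indicator B (- f x + y) \<partial>lborel) \<partial>lborel)"
    by (rule lborel_pair.Fubini') measurable
  also have "\<dots> = (\<integral>\<^sup>+y. (\<integral>\<^sup>+x. indicator A (y + f x) * indicator B (- f x) \<partial>lborel) \<partial>lborel)"
  proof (rule nn_integral_cong)
    fix y
    obtain w where w: "f w = y" using orthogonal_transformation_surj[OF f] by (metis surjD)
    have "(\<integral>\<^sup>+x. indicator A (f x) * indicator B (- f x + y) \<partial>lborel) =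
       (\<integral>\<^sup>+x. indicator A (f (w + x)) * indicator B (- f (w + x) + y) \<partial>lborel)"
      by (rule nn_integral_lborel_translate[symmetric]) measurable
    then show "(\<integral>\<^sup>+x. indicator A (f x) * indicator B (- f x + y) \<partial>lborel) =
       (\<integral>\<^sup>+x. indicator A (y + f x) * indicator B (- f x) \<partial>lborel)"
      by (simp add: linear_add[OF lin] w)
  qed
  also have "\<dots> = (\<integral>\<^sup>+x. (\<integral>\<^sup>+y. indicator A (y + f x) * indicator B (- f x) \<partial>lborel) \<partial>lborel)"
    by (rule lborel_pair.Fubini') measurable
  also have "\<dots> = (\<integral>\<^sup>+x. emeasure lborel A * indicator B (- f x) \<partial>lborel)"
  proof (rule nn_integral_cong)
    fix x
    have "(\<integral>\<^sup>+y. indicator A (f x + y) \<partial>lborel) = emeasure lborel A"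
      by (subst nn_integral_lborel_translate) auto
    then show "(\<integral>\<^sup>+y. indicator A (y + f x) * indicator B (- f x) \<partial>lborel) = emeasure lborel A * indicator B (- f x)"
      by (simp add: nn_integral_multc add.commute)
  qed
  also have "\<dots> = (\<integral>\<^sup>+x. emeasure lborel A * indicator B x \<partial>lborel)"
    by (intro nn_integral_cong) (simp add: B_def indicator_def orthogonal_transformation_norm[OF f])
  also have "\<dots> = emeasure lborel A * emeasure lborel B"
    by (simp add: nn_integral_cmult)
  finally have "emeasure (distr lborel borel f) A * emeasure lborel B = emeasure lborel A * emeasure lborel B" .
  moreover have "emeasure lborel B \<noteq> 0" "emeasure lborel B \<noteq> \<top>"
    by (simp_all add: B_def emeasure_ball ennreal_eq_0_iff not_le)
  ultimately show "emeasure (distr lborel borel f) A = emeasure lborel A"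
    by (simp add: ennreal_mult_cancel_left mult.commute[of _ "emeasure lborel B"])
qed simp

lemma space_sphere_measure [simp]: "space (sphere_measure r) = sphere 0 r"
  by (simp add: sphere_measure_def space_scale_measure space_restrict_space)

lemma sets_sphere_measure [measurable_cong]: "sets (sphere_measure r) = sets (restrict_space borel (sphere 0 r))"
  by (simp add: sphere_measure_def)

lemma radial_projection_measurable:
  assumes "0 < r"
  shows "(\<lambda>x :: real ^ 'n. (r / norm x) *\<^sub>R x) \<in> restrict_space lborel (cball 0 r - {0}) \<rightarrow>\<^sub>M restrict_space borel (sphere 0 r)"
  using assms by (intro measurable_restrict_space2 measurable_restrict_space1) (auto simp: space_restrict_space)

lemma nn_integral_sphere_measure:
  fixes g :: "real ^ 'n \<Rightarrow> ennreal"
  assumes r: "0 < r" and g: "g \<in> borel_measurable (restrict_space borel (sphere 0 r))"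
  shows "(\<integral>\<^sup>+y. g y \<partial>sphere_measure r) = ennreal (real CARD('n) / r) *
    (\<integral>\<^sup>+x. g ((r / norm x) *\<^sub>R x) * indicator (cball 0 r - {0}) x \<partial>lborel)"
proof -
  have "(\<integral>\<^sup>+y. g y \<partial>sphere_measure r) = ennreal (real CARD('n) / r) *
     (\<integral>\<^sup>+y. g y \<partial>distr (restrict_space lborel (cball 0 r - {0})) (restrict_space borel (sphere 0 r)) (\<lambda>x. (r / norm x) *\<^sub>R x))"
    unfolding sphere_measure_def using g by (intro nn_integral_scale_measure) simp
  also have "(\<integral>\<^sup>+y. g y \<partial>distr (restrict_space lborel (cball 0 r - {0})) (restrict_space borel (sphere 0 r)) (\<lambda>x. (r / norm x) *\<^sub>R x))
     = (\<integral>\<^sup>+x. g ((r / norm x) *\<^sub>R x) \<partial>restrict_space lborel (cball 0 r - {0}))"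
    by (rule nn_integral_distr[OF radial_projection_measurable[OF r]]) (use g in simp)
  also have "\<dots> = (\<integral>\<^sup>+x. g ((r / norm x) *\<^sub>R x) * indicator (cball 0 r - {0}) x \<partial>lborel)"
    by (rule nn_integral_restrict_space) simp
  finally show ?thesis .
qed

lemma emeasure_sphere_measure:
  assumes r: "0 < r"
  shows "emeasure (sphere_measure r :: (real ^ 'n) measure) (sphere 0 r) =
    ennreal (2 * pi powr (real CARD('n) / 2) * r ^ (CARD('n) - 1) / Gamma (real CARD('n) / 2))"
proof -
  let ?n = "real CARD('n)"
  have n: "0 < ?n" by simp
  have "emeasure (sphere_measure r :: (real ^ 'n) measure) (sphere 0 r) = (\<integral>\<^sup>+y. 1 \<partial>(sphere_measure r :: (real ^ 'n) measure))"
    by simp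
  also have "\<dots> = ennreal (?n / r) * (\<integral>\<^sup>+x. indicator (cball 0 r - {0}) x \<partial>(lborel :: (real ^ 'n) measure))"
    by (subst nn_integral_sphere_measure[OF r]) auto
  also have "(\<integral>\<^sup>+x. indicator (cball 0 r - {0}) x \<partial>(lborel :: (real ^ 'n) measure)) = emeasure lborel (cball (0 :: real ^ 'n) r)"
    by (simp add: emeasure_Diff_null_set finite_imp_null_set_lborel)
  also have "\<dots> = ennreal (unit_ball_vol ?n * r ^ CARD('n))"
    using emeasure_cball[of r "0 :: real ^ 'n"] r by simp
  also have "ennreal (?n / r) * \<dots> = ennreal (?n / r * (unit_ball_vol ?n * r ^ CARD('n)))"
    using r by (intro ennreal_mult[symmetric]) auto
  also have "?n / r * (unit_ball_vol ?n * r ^ CARD('n)) = 2 * pi powr (?n / 2) * r ^ (CARD('n) - 1) / Gamma (?n / 2)"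
  proof -
    have 1: "r ^ CARD('n) = r * r ^ (CARD('n) - 1)"
      by (simp add: power_eq_if)
    have 2: "Gamma (?n / 2 + 1) = ?n / 2 * Gamma (?n / 2)"
      using n by (intro Gamma_plus1) (auto dest: nonpos_Ints_nonpos)
    have 3: "Gamma (?n / 2) \<noteq> 0" by (rule less_imp_neq[symmetric], rule Gamma_real_pos) (use n in simp)
    show ?thesis unfolding unit_ball_vol_def 1 2 using r n 3 by (simp add: field_simps)
  qed
  finally show ?thesis .
qed

lemma finite_measure_sphere_measure: "0 < r \<Longrightarrow> finite_measure (sphere_measure r :: (real ^ 'n) measure)"
  by (rule finite_measureI) (simp add: emeasure_sphere_measure)

lemma borel_measurable_sphere_measureI:
  "continuous_on (sphere 0 r) g \<Longrightarrow> g \<in> borel_measurable (sphere_measure r)"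
  using borel_measurable_continuous_on_restrict[of "sphere 0 r" g] measurable_cong_sets[OF sets_sphere_measure refl] by blast

lemma integrable_sphere_measure:
  fixes g :: "real ^ 'n \<Rightarrow> real"
  assumes r: "0 < r" and g: "continuous_on (sphere 0 r) g"
  shows "integrable (sphere_measure r) g"
proof -
  interpret finite_measure "sphere_measure r :: (real ^ 'n) measure" by (rule finite_measure_sphere_measure[OF r])
  have "bounded (g ` sphere 0 r)" by (intro compact_imp_bounded compact_continuous_image g compact_sphere)
  then obtain B where "\<forall>y\<in>sphere 0 r. norm (g y) \<le> B" unfolding bounded_iff by blast
  then show ?thesis
    by (intro integrable_const_bound[where B=B] AE_I2 borel_measurable_sphere_measureI g) simp
qed

text \<open>Rotation invariance of the surface measure: some rotation takes \<open>y\<close> to \<open>z\<close>.\<close>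

lemma nn_integral_sphere_measure_zonal:
  fixes y z :: "real ^ 'n" and k :: "real \<Rightarrow> ennreal"
  assumes n: "2 \<le> CARD('n)" and r: "0 < r" and yz: "norm y = norm z" and k [measurable]: "k \<in> borel_measurable borel"
  shows "(\<integral>\<^sup>+x. k (y \<bullet> x) \<partial>sphere_measure r) = (\<integral>\<^sup>+x. k (z \<bullet> x) \<partial>sphere_measure r)"
proof -
  obtain f where f: "orthogonal_transformation f" "f y = z"
    using rotation_exists[OF n yz] by blast
  have lin: "linear f" by (rule orthogonal_transformation_linear[OF f(1)])
  have [measurable]: "f \<in> borel_measurable borel"
    using lin by (intro borel_measurable_continuous_onI linear_continuous_on) (simp add: linear_conv_bounded_linear)
  have m: "(\<lambda>x. k (w \<bullet> x)) \<in> borel_measurable (restrict_space borel (sphere 0 r))" for w :: "real ^ 'n"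
    by (intro measurable_restrict_space1) measurable
  define C :: "(real ^ 'n) set" where "C = cball 0 r - {0}"
  have [measurable]: "C \<in> sets borel" by (simp add: C_def)
  have "(\<integral>\<^sup>+x. k (z \<bullet> ((r / norm x) *\<^sub>R x)) * indicator (C) x \<partial>lborel)
    = (\<integral>\<^sup>+x. k (z \<bullet> ((r / norm x) *\<^sub>R x)) * indicator (C) x \<partial>distr lborel borel f)"
    by (simp add: lborel_orthogonal_invariant[OF f(1)])
  also have "\<dots> = (\<integral>\<^sup>+x. k (z \<bullet> ((r / norm (f x)) *\<^sub>R f x)) * indicator (C) (f x) \<partial>lborel)"
    by (rule nn_integral_distr) measurable
  also have "\<dots> = (\<integral>\<^sup>+x. k (y \<bullet> ((r / norm x) *\<^sub>R x)) * indicator (C) x \<partial>lborel)"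
  proof (rule nn_integral_cong)
    fix x
    have 1: "z \<bullet> f x = y \<bullet> x"
      using f unfolding orthogonal_transformation_def by metis
    have 2: "norm (f x) = norm x" by (rule orthogonal_transformation_norm[OF f(1)])
    then have "f x = 0 \<longleftrightarrow> x = 0" by (metis norm_eq_zero)
    then have 3: "f x \<in> C \<longleftrightarrow> x \<in> C" using 2 by (auto simp: C_def)
    show "k (z \<bullet> ((r / norm (f x)) *\<^sub>R f x)) * indicator (C) (f x) =
        k (y \<bullet> ((r / norm x) *\<^sub>R x)) * indicator (C) x"
      unfolding indicator_def 3 by (simp add: 1 2)
  qed
  finally show ?thesis
    unfolding nn_integral_sphere_measure[OF r m] C_def[symmetric] by simp
qed

section \<open>The Euclidean Poisson kernel as an approximate identity\<close>

text \<open>Up to normalisation this is the classical Poisson kernel of the unit ball in dimension \<open>2 v + 2\<close>, at a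
  point of norm \<open>h\<close> and a boundary point at an angle of cosine \<open>t\<close>.\<close>

definition euclid_poisson :: "real \<Rightarrow> real \<Rightarrow> real \<Rightarrow> real" where
  "euclid_poisson v h t = (1 - h\<^sup>2) / (1 - 2 * t * h + h\<^sup>2) powr (v + 1)"

lemma euclid_poisson_nonneg: "\<bar>h\<bar> < 1 \<Longrightarrow> 0 \<le> euclid_poisson v h t"
  unfolding euclid_poisson_def by (intro divide_nonneg_nonneg) (auto simp: abs_square_le_1 less_imp_le)

lemma abs_inner_sphere_le:
  assumes "y \<in> sphere 0 r" "z \<in> sphere 0 r" "0 < r"
  shows "\<bar>y \<bullet> z / r\<^sup>2\<bar> \<le> 1"
  using Cauchy_Schwarz_ineq2[of y z] assms by (simp add: power2_eq_square abs_mult field_simps)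

lemma continuous_on_euclid_poisson:
  fixes y :: "real ^ 'n"
  assumes h: "\<bar>h\<bar> < 1" and y: "y \<in> sphere 0 r" and r: "0 < r"
  shows "continuous_on (sphere 0 r) (\<lambda>z. euclid_poisson v h (y \<bullet> z / r\<^sup>2))"
proof -
  have "0 < 1 - 2 * (y \<bullet> z / r\<^sup>2) * h + h\<^sup>2" if "z \<in> sphere 0 r" for z
    by (rule generating_quadratic_pos[OF abs_inner_sphere_le[OF y that r] h])
  then show ?thesis
    unfolding euclid_poisson_def by (intro continuous_intros) (use r in \<open>force+\<close>)
qed

text \<open>The kernel is nonnegative with constant mass \<open>A\<close>, and tends to 0 uniformly at distance at least \<open>d\<close>
  from \<open>y\<close>: there \<open>1 - t \<ge> d\<^sup>2 / (2 r\<^sup>2)\<close>, and \<open>1 - 2 t h + h\<^sup>2 = (1 - h)\<^sup>2 + 2 h (1 - t) \<ge> 1 - t\<close> because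
  \<open>h \<ge> 1 / 2\<close>.\<close>

lemma euclid_poisson_tendsto:
  fixes p :: "real ^ 'n \<Rightarrow> real" and y :: "real ^ 'n"
  assumes v: "0 < v" and r: "0 < r" and p: "continuous_on (sphere 0 r) p" and y: "y \<in> sphere 0 r"
    and total: "\<And>h. 0 \<le> h \<Longrightarrow> h < 1 \<Longrightarrow> (LINT z|sphere_measure r. euclid_poisson v h (y \<bullet> z / r\<^sup>2)) = A"
    and h: "\<And>j::nat. 1 / 2 \<le> h j" "\<And>j. h j < 1" "h \<longlonglongrightarrow> 1"
  shows "(\<lambda>j. LINT z|sphere_measure r. euclid_poisson v (h j) (y \<bullet> z / r\<^sup>2) * p z) \<longlonglongrightarrow> A * p y"
proof (rule tendstoI)
  fix e :: real assume e: "0 < e"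
  interpret finite_measure "sphere_measure r :: (real ^ 'n) measure" by (rule finite_measure_sphere_measure[OF r])
  let ?Q = "\<lambda>j z. euclid_poisson v (h j) (y \<bullet> z / r\<^sup>2)" and ?S = "sphere_measure r :: (real ^ 'n) measure"
  let ?m = "measure ?S (space ?S)"
  have h1: "\<bar>h j\<bar> < 1" "0 \<le> h j" for j using h(1)[of j] h(2)[of j] by (auto simp: abs_less_iff)
  have Q0: "0 \<le> ?Q j z" for j z by (rule euclid_poisson_nonneg[OF h1(1)])
  have cQ: "continuous_on (sphere 0 r) (?Q j)" for j
    by (rule continuous_on_euclid_poisson[OF h1(1) y r])
  have iQ: "integrable ?S (?Q j)" for j by (rule integrable_sphere_measure[OF r cQ])
  have iQp: "integrable ?S (\<lambda>z. ?Q j z * p z)" for j by (rule integrable_sphere_measure[OF r]) (intro continuous_intros cQ p)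
  have A0: "0 \<le> A"
    unfolding total[of 0, simplified, symmetric] by (intro integral_nonneg_AE AE_I2 euclid_poisson_nonneg) simp
  have "bounded (p ` sphere 0 r)" by (intro compact_imp_bounded compact_continuous_image p compact_sphere)
  then obtain B where B: "\<bar>p z\<bar> \<le> B" if "z \<in> sphere 0 r" for z
    unfolding bounded_iff real_norm_def by blast
  define e' where "e' = e / (2 * (A + 1))"
  have e': "0 < e'" "A * e' < e / 2" using e A0 by (auto simp: e'_def field_simps)
  obtain d where d: "0 < d" "\<And>z. z \<in> sphere 0 r \<Longrightarrow> dist z y < d \<Longrightarrow> \<bar>p z - p y\<bar> < e'"
    using p[unfolded continuous_on_iff, rule_format, OF y e'(1)] by (auto simp: dist_real_def)
  \<comment> \<open>A lower bound for \<open>1 - t\<close> at distance \<open>d\<close>, and then an upper bound for the kernel there.\<close>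
  define \<eta> where "\<eta> = d\<^sup>2 / (2 * r\<^sup>2)"
  have \<eta>: "0 < \<eta>" using d r by (simp add: \<eta>_def)
  define c where "c j = (1 - (h j)\<^sup>2) / \<eta> powr (v + 1)" for j
  have "c \<longlonglongrightarrow> (1 - 1\<^sup>2) / \<eta> powr (v + 1)"
    unfolding c_def[abs_def] using \<eta> by (intro tendsto_intros h) auto
  then have c0: "(\<lambda>j. 2 * B * c j * ?m) \<longlonglongrightarrow> 2 * B * 0 * ?m" by (intro tendsto_intros) simp
  have far: "?Q j z \<le> c j" if z: "z \<in> sphere 0 r" "d \<le> dist z y" for j z
  proof -
    have "(dist z y)\<^sup>2 = 2 * r\<^sup>2 - 2 * (y \<bullet> z)"
      using z(1) y by (simp add: dist_norm power2_norm_eq_inner inner_diff inner_commute)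
         (simp add: power2_norm_eq_inner[symmetric])
    moreover have "d\<^sup>2 \<le> (dist z y)\<^sup>2" using z(2) d(1) by (intro power_mono) auto
    ultimately have "d\<^sup>2 / (2 * r\<^sup>2) \<le> (2 * r\<^sup>2 - 2 * (y \<bullet> z)) / (2 * r\<^sup>2)"
      by (intro divide_right_mono) auto
    also have "\<dots> = 1 - y \<bullet> z / r\<^sup>2" using r by (simp add: field_simps)
    finally have t: "\<eta> \<le> 1 - y \<bullet> z / r\<^sup>2" by (simp add: \<eta>_def)
    have "\<eta> \<le> 2 * h j * (1 - y \<bullet> z / r\<^sup>2)"
      using mult_mono[of 1 "2 * h j" \<eta> "1 - y \<bullet> z / r\<^sup>2"] h(1)[of j] t \<eta> by simp
    also have "\<dots> \<le> (1 - h j)\<^sup>2 + 2 * h j * (1 - y \<bullet> z / r\<^sup>2)" by simp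
    also have "\<dots> = 1 - 2 * (y \<bullet> z / r\<^sup>2) * h j + (h j)\<^sup>2" by (simp add: power2_eq_square algebra_simps)
    finally have "\<eta> powr (v + 1) \<le> (1 - 2 * (y \<bullet> z / r\<^sup>2) * h j + (h j)\<^sup>2) powr (v + 1)"
      using \<eta> v by (intro powr_mono2) auto
    then show ?thesis
      unfolding euclid_poisson_def c_def using \<eta> h1[of j]
      by (intro divide_left_mono) (auto simp: abs_square_le_1 less_imp_le intro!: mult_pos_pos powr_gt_zero[THEN iffD2] generating_quadratic_pos abs_inner_sphere_le[OF y z(1) r, simplified] dest: less_le_trans)
  qed
  have c_nonneg: "0 \<le> c j" for j
    unfolding c_def using h1[of j] by (intro divide_nonneg_nonneg) (auto simp: abs_square_le_1 less_imp_le)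
  have B0: "0 \<le> B" using B[OF y] by linarith
  have bound: "\<bar>(LINT z|?S. ?Q j z * p z) - A * p y\<bar> \<le> A * e' + 2 * B * c j * ?m" for j
  proof -
    have "(LINT z|?S. ?Q j z * p z) - A * p y = (LINT z|?S. ?Q j z * p z - ?Q j z * p y)"
      using iQp iQ total[OF h1(2) h(2)] by (simp add: integral_mult_left_zero)
    then have "\<bar>(LINT z|?S. ?Q j z * p z) - A * p y\<bar> \<le> (LINT z|?S. \<bar>?Q j z * p z - ?Q j z * p y\<bar>)"
      by (simp add: integral_abs_bound)
    also have "\<dots> \<le> (LINT z|?S. ?Q j z * e' + 2 * B * c j)"
    proof (rule integral_mono)
      show "integrable ?S (\<lambda>z. \<bar>?Q j z * p z - ?Q j z * p y\<bar>)"
        using iQp iQ by (intro integrable_abs Bochner_Integration.integrable_diff integrable_mult_left) auto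
      show "integrable ?S (\<lambda>z. ?Q j z * e' + 2 * B * c j)"
        using iQ by simp
      fix z assume "z \<in> space ?S"
      then have z: "z \<in> sphere 0 r" by simp
      have eq: "\<bar>?Q j z * p z - ?Q j z * p y\<bar> = ?Q j z * \<bar>p z - p y\<bar>"
        using Q0[of j z] by (simp add: right_diff_distrib[symmetric] abs_mult)
      show "\<bar>?Q j z * p z - ?Q j z * p y\<bar> \<le> ?Q j z * e' + 2 * B * c j"
      proof (cases "dist z y < d")
        case True
        have "?Q j z * \<bar>p z - p y\<bar> \<le> ?Q j z * e'"
          using d(2)[OF z True] Q0 by (intro mult_left_mono) auto
        moreover have "0 \<le> 2 * B * c j" using B0 c_nonneg by simp
        ultimately show ?thesis unfolding eq by linarith
      next
        case False
        have "\<bar>p z - p y\<bar> \<le> 2 * B" using B[OF z] B[OF y] by linarith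
        then have "?Q j z * \<bar>p z - p y\<bar> \<le> c j * (2 * B)"
          using False far[OF z, of j] c_nonneg by (intro mult_mono) auto
        moreover have "0 \<le> ?Q j z * e'" using Q0 e' by simp
        ultimately show ?thesis unfolding eq by (simp add: mult_ac)
      qed
    qed
    also have "\<dots> = A * e' + 2 * B * c j * ?m"
      using iQ total[OF h1(2) h(2)] by simp
    finally show ?thesis .
  qed
  have "\<forall>\<^sub>F j in sequentially. 2 * B * c j * ?m < e / 2"
    using c0 by (rule order_tendstoD) (use e in simp)
  then show "\<forall>\<^sub>F j in sequentially. dist (LINT z|?S. ?Q j z * p z) (A * p y) < e"
  proof eventually_elim
    case (elim j)
    then show ?case using bound[of j] e'(2) by (simp add: dist_real_def)
  qed
qed

section \<open>Harmonic measure and its moments\<close>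

context hyperbolic_Brownian_motion
begin

lemma AE_exits:
  assumes x: "x \<in> ball 0 1" and r: "0 < r" "r < 1" and n: "2 < CARD('n)"
  shows "AE \<omega> in M x. \<exists>t\<ge>0. r \<le> norm (X t \<omega>)"
proof -
  obtain f :: "real ^ 'n \<Rightarrow> real" and c where "C2_compact_support f" "0 < c" "\<And>x. norm x \<le> r \<Longrightarrow> c \<le> laplace_beltrami f x"
    using ex_subharmonic_test_function[OF r n] by blast
  then show ?thesis by (intro AE_hits_sphere[OF x]) auto
qed

lemma AE_exit_position:
  assumes x: "norm x < r" and r: "r < 1" and n: "2 < CARD('n)"
  shows "AE \<omega> in M x. (\<exists>t\<ge>0. r \<le> norm (X t \<omega>)) \<and> exit_position r \<omega> = X (exit_time X r \<omega>) \<omega> \<and> norm (exit_position r \<omega>) = r"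
proof -
  have r0: "0 < r" using x norm_ge_zero[of x] by linarith
  have xb: "x \<in> ball 0 1" using x r by simp
  show ?thesis using AE_exits[OF xb r0 r n] start[OF xb]
  proof (rule AE_mp[OF AE_conjI], intro AE_I2 impI)
    fix \<omega> assume w: "\<omega> \<in> space (M x)" and h: "(\<exists>t\<ge>0. r \<le> norm (X t \<omega>)) \<and> X 0 \<omega> = x"
    then have w': "\<omega> \<in> space N" "norm (X 0 \<omega>) < r" "\<exists>t\<ge>0. r \<le> norm (X t \<omega>)"
      using x space_M[OF xb] by auto
    show "(\<exists>t\<ge>0. r \<le> norm (X t \<omega>)) \<and> exit_position r \<omega> = X (exit_time X r \<omega>) \<omega> \<and> norm (exit_position r \<omega>) = r"
      using exit_position_eq[OF w'] exit_time_properties(2)[where X = X and \<omega> = \<omega> and r = r, OF continuous_paths[OF w'(1)] w'(3) less_imp_le[OF w'(2)]] w'(3)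
      by simp
  qed
qed

text \<open>The harmonic measure is the law of the exit position, moved into the sphere on the null set where it
  fails to lie on it.\<close>

lemma expectation_eq_poisson_integral:
  fixes f :: "real ^ 'n \<Rightarrow> real"
  assumes P: "poisson_kernel M X r P" and x: "norm x < r" and r: "r < 1" and n: "2 < CARD('n)"
    and f: "f \<in> borel_measurable borel"
  shows "(LINT \<omega>|M x. f (exit_position r \<omega>)) = (LINT y|sphere_measure r. P x y * f y)"
proof -
  have r0: "0 < r" using x norm_ge_zero[of x] by linarith
  have xb: "x \<in> ball 0 1" using x r by simp
  interpret prob_space "M x" by (rule prob_space_M[OF xb])
  obtain e :: "real ^ 'n" where e: "norm e = r" using vector_choose_size[of r] r0 by auto
  define Y where "Y \<omega> = (if norm (exit_position r \<omega>) = r then exit_position r \<omega> else e)" for \<omega>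
  have Ym0 [measurable]: "Y \<in> borel_measurable (M x)"
    unfolding Y_def[abs_def] using exit_position_measurable[OF xb, of r] by measurable
  have Ym: "Y \<in> M x \<rightarrow>\<^sub>M restrict_space borel (sphere 0 r)"
    by (rule measurable_restrict_space2[OF _ Ym0]) (auto simp: Y_def e)
  have AE_Y: "AE \<omega> in M x. (\<exists>t\<ge>0. r \<le> norm (X t \<omega>)) \<and> Y \<omega> = X (exit_time X r \<omega>) \<omega> \<and> Y \<omega> = exit_position r \<omega>"
    using AE_exit_position[OF x r n] by eventually_elim (auto simp: Y_def)
  have Pc: "continuous_on (sphere 0 r) (P x)" and P0: "\<And>y. y \<in> sphere 0 r \<Longrightarrow> 0 \<le> P x y"
    and Ph: "\<And>A. A \<in> sets borel \<Longrightarrow> A \<subseteq> sphere 0 r \<Longrightarrow>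
      ennreal (harmonic_measure M X r x A) = (\<integral>\<^sup>+y\<in>A. ennreal (P x y) \<partial>sphere_measure r)"
    using P x unfolding poisson_kernel_def by auto
  have Pm [measurable]: "P x \<in> borel_measurable (sphere_measure r)" by (rule borel_measurable_sphere_measureI[OF Pc])
  let ?D = "distr (M x) (restrict_space borel (sphere 0 r)) Y"
  have "?D = density (sphere_measure r) (P x)"
  proof (rule measure_eqI)
    show "sets ?D = sets (density (sphere_measure r) (P x))"
      by (simp add: sets_sphere_measure)
    fix A assume "A \<in> sets ?D"
    then have A: "A \<in> sets (restrict_space borel (sphere 0 r))" by simp
    then have A': "A \<in> sets borel" "A \<subseteq> sphere 0 r" by (auto simp: sets_restrict_space)
    let ?H = "{\<omega> \<in> space (M x). (\<exists>t\<ge>0. r \<le> norm (X t \<omega>)) \<and> X (exit_time X r \<omega>) \<omega> \<in> A}"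
    have "emeasure ?D A = emeasure (M x) (Y -` A \<inter> space (M x))"
      by (rule emeasure_distr[OF Ym A])
    also have "\<dots> = emeasure (M x) ?H"
    proof (rule emeasure_eq_AE)
      show "AE \<omega> in M x. (\<omega> \<in> Y -` A \<inter> space (M x)) =
        (\<omega> \<in> ?H)"
        using AE_Y by eventually_elim auto
      show "Y -` A \<inter> space (M x) \<in> sets (M x)" using measurable_sets[OF Ym A] .
      show "?H \<in> sets (M x)"
      proof -
        have [measurable]: "X 0 \<in> borel_measurable (M x)" "exit_position r \<in> borel_measurable (M x)" "A \<in> sets borel"
          by (auto intro!: measurable_X_M[OF xb] exit_position_measurable[OF xb] A')
        \<comment> \<open>Paths that do not start at \<open>x\<close> form a null set, but they belong to the event all the same; those
            starting outside the ball have exit time 0.\<close>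
        have "?H =
          {\<omega> \<in> space (M x). \<exists>t\<ge>0. r \<le> norm (X t \<omega>)} \<inter> {\<omega> \<in> space (M x). norm (X 0 \<omega>) < r \<and> exit_position r \<omega> \<in> A}
          \<union> {\<omega> \<in> space (M x). r \<le> norm (X 0 \<omega>) \<and> X 0 \<omega> \<in> A}" (is "_ = ?E")
        proof -
          have "((\<exists>t\<ge>0. r \<le> norm (X t \<omega>)) \<and> X (exit_time X r \<omega>) \<omega> \<in> A) \<longleftrightarrow>
             (\<exists>t\<ge>0. r \<le> norm (X t \<omega>)) \<and> norm (X 0 \<omega>) < r \<and> exit_position r \<omega> \<in> A \<or> r \<le> norm (X 0 \<omega>) \<and> X 0 \<omega> \<in> A"
            if w: "\<omega> \<in> space (M x)" for \<omega>
          proof (cases "norm (X 0 \<omega>) < r")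
            case True
            have "exit_position r \<omega> = X (exit_time X r \<omega>) \<omega>" if "\<exists>t\<ge>0. r \<le> norm (X t \<omega>)"
              using exit_position_eq[OF _ True that] w space_M[OF xb] by simp
            note e = this
            have nle: "\<not> r \<le> norm (X 0 \<omega>)" using True by simp
            have taut: "(Q \<and> a \<longleftrightarrow> Q \<and> p \<and> b \<or> s \<and> c)" if "p" "\<not> s" "Q \<Longrightarrow> a \<longleftrightarrow> b" for Q a p b s c
              using that by blast
            show ?thesis by (rule taut[OF True nle]) (simp only: e)
          next
            case False
            then have "exit_time X r \<omega> = 0"
              unfolding exit_time_def by (intro cInf_eq_minimum) auto
            then show ?thesis using False by auto
          qed
          then show ?thesis by blast
        qed
        also have "?E \<in> sets (M x)"
        proof (intro sets.Un sets.Int hits_sphere_measurable[OF xb])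
          show "{\<omega> \<in> space (M x). norm (X 0 \<omega>) < r \<and> exit_position r \<omega> \<in> A} \<in> sets (M x)" by measurable
          show "{\<omega> \<in> space (M x). r \<le> norm (X 0 \<omega>) \<and> X 0 \<omega> \<in> A} \<in> sets (M x)" by measurable
        qed
        finally show ?thesis .
      qed
    qed
    also have "\<dots> = ennreal (harmonic_measure M X r x A)"
      by (simp add: harmonic_measure_def emeasure_eq_measure)
    also have "\<dots> = (\<integral>\<^sup>+y\<in>A. ennreal (P x y) \<partial>sphere_measure r)" by (rule Ph[OF A'])
    also have "\<dots> = emeasure (density (sphere_measure r) (P x)) A"
      using A by (subst emeasure_density) (auto simp: sets_sphere_measure)
    finally show "emeasure ?D A = emeasure (density (sphere_measure r) (P x)) A" .
  qed
  note D = this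
  have fm: "f \<in> borel_measurable (restrict_space borel (sphere 0 r))"
    using f by (rule measurable_restrict_space1)
  have "(LINT \<omega>|M x. f (exit_position r \<omega>)) = (LINT \<omega>|M x. f (Y \<omega>))"
    using AE_Y by (intro integral_cong_AE measurable_compose[OF _ f] exit_position_measurable[OF xb] Ym0) auto
  also have "\<dots> = (LINT y|?D. f y)"
    by (rule integral_distr[OF Ym fm, symmetric])
  also have "\<dots> = (LINT y|density (sphere_measure r) (P x). f y)" unfolding D ..
  also have "\<dots> = (LINT y|sphere_measure r. P x y *\<^sub>R f y)"
    using fm P0 by (intro integral_density Pm AE_I2) (auto simp: measurable_cong_sets[OF sets_sphere_measure refl])
  finally show ?thesis by simp
qed

text \<open>The moments of the harmonic measure against the zonal harmonics with pole \<open>y\<close>: evaluate the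
  expectation of the eigenfunction at the exit position, where \<open>|z|\<close> is constantly \<open>r\<close>.\<close>

lemma poisson_kernel_zonal_integral:
  fixes x y :: "real ^ 'n"
  assumes P: "poisson_kernel M X r P" and x: "norm x < r" and r: "r < 1" and n: "2 < CARD('n)" and y: "norm y = r"
    and t: "x \<bullet> y = norm x * r * t" and \<rho>: "\<rho> = (real CARD('n) - 2) / 2"
    and F: "\<And>k z. F k z = hypergeometric (real k) (- \<rho>) (real k + real CARD('n) / 2) z"
  shows "F k (r\<^sup>2) * (LINT z|sphere_measure r. P x z * gegenbauer \<rho> k (y \<bullet> z / r\<^sup>2)) =
    (norm x / r) ^ k * F k ((norm x)\<^sup>2) * gegenbauer \<rho> k t"
proof -
  let ?I = "LINT z|sphere_measure r. P x z * gegenbauer \<rho> k (y \<bullet> z / r\<^sup>2)"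
  have r0: "0 < r" using x norm_ge_zero[of x] by linarith
  have xb: "x \<in> ball 0 1" using x r by simp
  have \<rho>2: "2 * \<rho> = real CARD('n) - 2" by (simp add: \<rho>)
  obtain f where f: "C2_compact_support f" "\<And>x. norm x < r \<Longrightarrow> laplace_beltrami f x = 0"
    "\<And>x. norm x \<le> r \<Longrightarrow> f x = F k ((norm x)\<^sup>2) * zonal \<rho> y k x"
    using ex_harmonic_test_function[OF r0 r \<rho>2, of k y] F by metis
  have fm: "f \<in> borel_measurable borel" using f(1) by (auto simp: C2_compact_support_def intro: C2_measurable)
  have "(LINT z|sphere_measure r. P x z * f z) = f x"
    using expectation_eq_poisson_integral[OF P x r n fm] expectation_exit_position[OF x r f(1,2) AE_exits[OF xb r0 r n]] by simp
  also have "f x = F k ((norm x)\<^sup>2) * ((norm x * r) ^ k * gegenbauer \<rho> k t)"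
    using x t y by (subst f(3)) (simp_all add: zonal_eq_gegenbauer[of x y t])
  also have "(LINT z|sphere_measure r. P x z * f z) =
     (LINT z|sphere_measure r. r ^ (2 * k) * F k (r\<^sup>2) * (P x z * gegenbauer \<rho> k (y \<bullet> z / r\<^sup>2)))"
  proof (rule Bochner_Integration.integral_cong[OF refl])
    fix z :: "real ^ 'n" assume "z \<in> space (sphere_measure r)"
    then have z: "norm z = r" by simp
    have "f z = F k (r\<^sup>2) * zonal \<rho> y k z" using z by (subst f(3)) simp_all
    also have "zonal \<rho> y k z = (norm z * norm y) ^ k * gegenbauer \<rho> k (y \<bullet> z / r\<^sup>2)"
      by (rule zonal_eq_gegenbauer) (use z y r0 in \<open>simp add: power2_eq_square inner_commute\<close>)
    also have "(norm z * norm y) ^ k = r ^ (2 * k)" using z y by (simp add: power_mult power2_eq_square)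
    finally show "P x z * f z = r ^ (2 * k) * F k (r\<^sup>2) * (P x z * gegenbauer \<rho> k (y \<bullet> z / r\<^sup>2))"
      by (simp add: mult_ac)
  qed
  also have "\<dots> = r ^ (2 * k) * F k (r\<^sup>2) * ?I"
    by simp
  finally have "r ^ (2 * k) * (F k (r\<^sup>2) * ?I) =
    r ^ (2 * k) * ((norm x / r) ^ k * F k ((norm x)\<^sup>2) * gegenbauer \<rho> k t)"
    using r0 by (simp add: power_mult_distrib power_divide mult_ac power_mult power2_eq_square)
  then show ?thesis using r0 by simp
qed

text \<open>Were \<open>F\<^sub>k\<close> to vanish at \<open>r\<^sup>2\<close>, the eigenfunction would vanish on the sphere, hence inside by the mean
  value property; but along the pole \<open>Z\<^sub>k\<close> is positive and \<open>F\<^sub>k\<close> is 1 at the centre.\<close>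

lemma hypergeometric_radius_nonzero:
  assumes P: "poisson_kernel M X r P" and r: "0 < r" "r < 1" and n: "2 < CARD('n)"
    and \<rho>: "\<rho> = (real CARD('n) - 2) / 2"
    and F: "\<And>k z. F k z = hypergeometric (real k) (- \<rho>) (real k + real CARD('n) / 2) z"
  shows "F k (r\<^sup>2) \<noteq> 0"
proof
  assume 0: "F k (r\<^sup>2) = 0"
  obtain y :: "real ^ 'n" where y: "norm y = r" using vector_choose_size[of r] r by auto
  have \<rho>0: "0 < \<rho>" using n by (simp add: \<rho>)
  have "F k (s\<^sup>2) = 0" if s: "0 < s" "s < r" for s
  proof -
    let ?x = "(s / r) *\<^sub>R y"
    have nx: "norm ?x = s" using s y by simp
    have "(norm ?x / r) ^ k * F k ((norm ?x)\<^sup>2) * gegenbauer \<rho> k 1 = 0"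
      using poisson_kernel_zonal_integral[OF P _ r(2) n y _ \<rho> F, of ?x 1 k] nx s y r 0
      by (simp add: power2_norm_eq_inner[symmetric] power2_eq_square)
    moreover have "y \<noteq> 0" using y r by auto
    ultimately show ?thesis using nx s r gegenbauer_one_pos[OF \<rho>0, of k] by simp
  qed
  then have "\<forall>\<^sub>F s in at_right 0. F k (s\<^sup>2) = 0"
    using r by (auto simp: eventually_at_right_field intro!: exI[of _ r])
  then have "((\<lambda>s. F k (s\<^sup>2)) \<longlongrightarrow> 0) (at_right 0)" by (rule tendsto_eventually)
  moreover have "((\<lambda>s. F k (s\<^sup>2)) \<longlongrightarrow> F k (0\<^sup>2)) (at_right 0)"
  proof -
    let ?H = "hyp_fps (real k) (- \<rho>) (real k + real CARD('n) / 2)"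
    have "ereal (norm (0 :: real)) < fps_conv_radius ?H"
      by (rule hyp_conv_radius_less(1)) (simp_all add: add_nonneg_pos)
    then have "isCont (eval_fps ?H) (0\<^sup>2)" using DERIV_isCont[OF has_field_derivative_eval_fps[of "0\<^sup>2" ?H UNIV]] by simp
    then have "((\<lambda>s. eval_fps ?H (s\<^sup>2)) \<longlongrightarrow> eval_fps ?H (0\<^sup>2)) (at_right 0)"
      by (rule isCont_tendsto_compose) (intro tendsto_intros)
    then show ?thesis by (simp add: F hypergeometric_eq_eval)
  qed
  ultimately have "F k (0\<^sup>2) = 0" by (intro tendsto_unique[of "at_right 0"]) simp_all
  then show False by (simp add: F)
qed

text \<open>Integrate the expansion of the Euclidean Poisson kernel against \<open>P x\<close> term by term. For \<open>h < 1\<close> the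
  expansion is dominated by its values at cosine 1.\<close>

lemma poisson_kernel_abel_sums:
  fixes x y :: "real ^ 'n"
  assumes P: "poisson_kernel M X r P" and x: "norm x < r" and r: "r < 1" and n: "2 < CARD('n)" and y: "norm y = r"
    and t: "x \<bullet> y = norm x * r * t" and \<rho>: "\<rho> = (real CARD('n) - 2) / 2"
    and F: "\<And>k z. F k z = hypergeometric (real k) (- \<rho>) (real k + real CARD('n) / 2) z"
    and h: "0 \<le> h" "h < 1"
  shows "(\<lambda>k. (real k + \<rho>) / \<rho> * (norm x / r) ^ k * (F k ((norm x)\<^sup>2) / F k (r\<^sup>2)) * gegenbauer \<rho> k t * h ^ k) sums
    (LINT z|sphere_measure r. euclid_poisson \<rho> h (y \<bullet> z / r\<^sup>2) * P x z)"
proof -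
  have r0: "0 < r" using x norm_ge_zero[of x] by linarith
  have \<rho>0: "0 < \<rho>" using n by (simp add: \<rho>)
  let ?S = "sphere_measure r :: (real ^ 'n) measure"
  interpret finite_measure ?S by (rule finite_measure_sphere_measure[OF r0])
  have Pc: "continuous_on (sphere 0 r) (P x)" and P0: "\<And>y. y \<in> sphere 0 r \<Longrightarrow> 0 \<le> P x y"
    using P x unfolding poisson_kernel_def by auto
  have y': "y \<in> sphere 0 r" using y by simp
  let ?c = "\<lambda>k z. (real k + \<rho>) / \<rho> * h ^ k * gegenbauer \<rho> k (y \<bullet> z / r\<^sup>2)"
  let ?m = "\<lambda>k. (real k + \<rho>) / \<rho> * gegenbauer \<rho> k 1 * h ^ k"
  have le: "norm (?c k z) \<le> ?m k" if "z \<in> sphere 0 r" for k z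
  proof -
    have "norm (?c k z) = (real k + \<rho>) / \<rho> * h ^ k * \<bar>gegenbauer \<rho> k (y \<bullet> z / r\<^sup>2)\<bar>"
      using \<rho>0 h by (simp add: abs_mult)
    also have "\<dots> \<le> (real k + \<rho>) / \<rho> * h ^ k * gegenbauer \<rho> k 1"
      using \<rho>0 h by (intro mult_left_mono abs_gegenbauer_le abs_inner_sphere_le[OF y' that r0]) auto
    finally show ?thesis by (simp add: mult_ac)
  qed
  have m: "summable ?m" by (rule gegenbauer_majorant_summable[OF \<rho>0 h])
  have cg: "continuous_on (sphere 0 r) (\<lambda>z. gegenbauer \<rho> k (y \<bullet> z / r\<^sup>2))" for k
    by (rule continuous_on_compose2[OF continuous_on_gegenbauer]) (use r0 in \<open>auto intro!: continuous_intros\<close>)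
  have cc: "continuous_on (sphere 0 r) (\<lambda>z. ?c k z * P x z)" for k
    by (intro continuous_intros Pc cg)
  have int: "integrable ?S (\<lambda>z. ?c k z * P x z)" for k by (rule integrable_sphere_measure[OF r0 cc])
  have intP: "integrable ?S (P x)" by (rule integrable_sphere_measure[OF r0 Pc])
  have "(\<lambda>k. LINT z|?S. ?c k z * P x z) sums (LINT z|?S. (\<Sum>k. ?c k z * P x z))"
  proof (rule sums_integral[OF int])
    show "AE z in ?S. summable (\<lambda>k. norm (?c k z * P x z))"
    proof (rule AE_I2)
      fix z assume "z \<in> space ?S"
      then have z: "z \<in> sphere 0 r" by simp
      show "summable (\<lambda>k. norm (?c k z * P x z))"
        unfolding norm_mult[of _ "P x z"]
        by (intro summable_mult2 summable_comparison_test'[OF m]) (use le[OF z] in simp)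
    qed
    show "summable (\<lambda>k. LINT z|?S. norm (?c k z * P x z))"
    proof (rule summable_comparison_test'[OF summable_mult2[OF m, of "LINT z|?S. P x z"]])
      fix k
      have "(LINT z|?S. norm (?c k z * P x z)) \<le> (LINT z|?S. ?m k * P x z)"
      proof (rule integral_mono[OF integrable_norm[OF int]])
        fix z assume "z \<in> space ?S"
        then have z: "z \<in> sphere 0 r" by simp
        show "norm (?c k z * P x z) \<le> ?m k * P x z"
          unfolding norm_mult[of _ "P x z"]
          by (rule mult_mono[OF le[OF z] _ order.trans[OF norm_ge_zero le[OF z]]]) (use P0[OF z] in simp_all)
      qed (intro integrable_mult_right intP)
      then show "norm (LINT z|?S. norm (?c k z * P x z)) \<le> ?m k * (LINT z|?S. P x z)"
        by simp
    qed
  qed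
  also have "(LINT z|?S. (\<Sum>k. ?c k z * P x z)) = (LINT z|?S. euclid_poisson \<rho> h (y \<bullet> z / r\<^sup>2) * P x z)"
  proof (rule Bochner_Integration.integral_cong[OF refl])
    fix z assume "z \<in> space ?S"
    then have z: "z \<in> sphere 0 r" by simp
    have "(\<lambda>k. ?c k z) sums euclid_poisson \<rho> h (y \<bullet> z / r\<^sup>2)"
      unfolding euclid_poisson_def
      by (rule gegenbauer_poisson_sums[OF \<rho>0 abs_inner_sphere_le[OF y' z r0]]) (use h in simp)
    then have "(\<lambda>k. ?c k z * P x z) sums (euclid_poisson \<rho> h (y \<bullet> z / r\<^sup>2) * P x z)"
      by (rule sums_mult2)
    then show "(\<Sum>k. ?c k z * P x z) = euclid_poisson \<rho> h (y \<bullet> z / r\<^sup>2) * P x z"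
      by (rule sums_unique[symmetric])
  qed
  also have "(\<lambda>k. LINT z|?S. ?c k z * P x z) =
     (\<lambda>k. (real k + \<rho>) / \<rho> * (norm x / r) ^ k * (F k ((norm x)\<^sup>2) / F k (r\<^sup>2)) * gegenbauer \<rho> k t * h ^ k)"
  proof
    fix k
    let ?I = "LINT z|?S. P x z * gegenbauer \<rho> k (y \<bullet> z / r\<^sup>2)"
    have "(LINT z|?S. ?c k z * P x z) = (LINT z|?S. ((real k + \<rho>) / \<rho> * h ^ k) * (P x z * gegenbauer \<rho> k (y \<bullet> z / r\<^sup>2)))"
      by (intro Bochner_Integration.integral_cong) (simp_all add: mult_ac)
    also have "\<dots> = ((real k + \<rho>) / \<rho> * h ^ k) * ?I" by (rule integral_mult_right_zero)
    also have "?I = (norm x / r) ^ k * F k ((norm x)\<^sup>2) * gegenbauer \<rho> k t / F k (r\<^sup>2)"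
      unfolding nonzero_eq_divide_eq[OF hypergeometric_radius_nonzero[OF P r0 r n \<rho> F, of k]]
      using poisson_kernel_zonal_integral[OF P x r n y t \<rho> F, of k] by (simp only: mult.commute)
    finally show "(LINT z|?S. ?c k z * P x z) =
       (real k + \<rho>) / \<rho> * (norm x / r) ^ k * (F k ((norm x)\<^sup>2) / F k (r\<^sup>2)) * gegenbauer \<rho> k t * h ^ k"
      by (simp add: mult_ac)
  qed
  finally show ?thesis .
qed

text \<open>At \<open>x = 0\<close> only the term \<open>k = 0\<close> of the expansion survives, so \<open>P 0\<close> integrates the kernel to 1 for
  every pole. The mass \<open>I\<close> with respect to the surface measure is the same for all poles; integrating it
  against the probability density \<open>P 0\<close> over the pole and exchanging the integrals yields the area.\<close>

lemma euclid_poisson_total: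
  fixes y :: "real ^ 'n"
  assumes P: "poisson_kernel M X r P" and r: "0 < r" "r < 1" and n: "2 < CARD('n)" and y: "norm y = r"
    and \<rho>: "\<rho> = (real CARD('n) - 2) / 2" and h: "0 \<le> h" "h < 1"
  shows "(LINT z|sphere_measure r. euclid_poisson \<rho> h (y \<bullet> z / r\<^sup>2)) =
    measure (sphere_measure r :: (real ^ 'n) measure) (sphere 0 r)"
proof -
  let ?S = "sphere_measure r :: (real ^ 'n) measure"
  let ?F = "\<lambda>k z. hypergeometric (real k) (- \<rho>) (real k + real CARD('n) / 2) z"
  have \<rho>0: "0 < \<rho>" using n by (simp add: \<rho>)
  interpret finite_measure ?S by (rule finite_measure_sphere_measure[OF r(1)])
  interpret pair_sigma_finite ?S ?S ..
  have P0c: "continuous_on (sphere 0 r) (P 0)" and P0: "\<And>y. y \<in> sphere 0 r \<Longrightarrow> 0 \<le> P 0 y"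
    using P r unfolding poisson_kernel_def by auto
  have [measurable]: "P 0 \<in> borel_measurable ?S" by (rule borel_measurable_sphere_measureI[OF P0c])
  have [measurable]: "(\<lambda>y. y) \<in> borel_measurable ?S" by (rule borel_measurable_sphere_measureI) (rule continuous_on_id)
  have Qc: "continuous_on (sphere 0 r) (\<lambda>z. euclid_poisson \<rho> g (w \<bullet> z / r\<^sup>2))"
    if w: "w \<in> sphere 0 r" and g: "0 \<le> g" "g < 1" for w :: "real ^ 'n" and g
    by (rule continuous_on_euclid_poisson[OF _ w r(1)]) (use g in auto)
  have Q0: "0 \<le> euclid_poisson \<rho> h t" for t using h by (intro euclid_poisson_nonneg) auto
  have Qm [measurable]: "euclid_poisson \<rho> h \<in> borel_measurable borel"
    unfolding euclid_poisson_def[abs_def] by measurable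
  have one: "(\<integral>\<^sup>+z. ennreal (euclid_poisson \<rho> g (w \<bullet> z / r\<^sup>2) * P 0 z) \<partial>?S) = 1"
    if w: "w \<in> sphere 0 r" and g: "0 \<le> g" "g < 1" for w :: "real ^ 'n" and g
  proof -
    have 0: "norm (0 :: real ^ 'n) < r" using r by simp
    let ?a = "\<lambda>k. (real k + \<rho>) / \<rho> * (norm (0 :: real ^ 'n) / r) ^ k * (?F k ((norm (0 :: real ^ 'n))\<^sup>2) / ?F k (r\<^sup>2)) * gegenbauer \<rho> k 0 * g ^ k"
    have "?a sums
      (LINT z|?S. euclid_poisson \<rho> g (w \<bullet> z / r\<^sup>2) * P 0 z)"
      by (rule poisson_kernel_abel_sums[OF P 0 r(2) n _ _ \<rho> refl g]) (use w in simp_all)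
    also have "?a
       = (\<lambda>k. if k = 0 then 1 else 0)"
      using \<rho>0 by (auto simp: fun_eq_iff hypergeometric_0_left power_0_left)
    finally have "(LINT z|?S. euclid_poisson \<rho> g (w \<bullet> z / r\<^sup>2) * P 0 z) = 1"
      using sums_unique2[OF sums_single[of 0 "\<lambda>_. 1 :: real"]] by simp
    moreover have "(\<integral>\<^sup>+z. ennreal (euclid_poisson \<rho> g (w \<bullet> z / r\<^sup>2) * P 0 z) \<partial>?S) =
      ennreal (LINT z|?S. euclid_poisson \<rho> g (w \<bullet> z / r\<^sup>2) * P 0 z)"
    proof (rule nn_integral_eq_integral)
      show "integrable ?S (\<lambda>z. euclid_poisson \<rho> g (w \<bullet> z / r\<^sup>2) * P 0 z)"
        by (intro integrable_sphere_measure r continuous_intros Qc w g P0c)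
      show "AE z in ?S. 0 \<le> euclid_poisson \<rho> g (w \<bullet> z / r\<^sup>2) * P 0 z"
        using g P0 by (intro AE_I2 mult_nonneg_nonneg euclid_poisson_nonneg) auto
    qed
    ultimately show ?thesis by simp
  qed
  define I where "I = (\<integral>\<^sup>+z. ennreal (euclid_poisson \<rho> h (y \<bullet> z / r\<^sup>2)) \<partial>?S)"
  have I: "(\<integral>\<^sup>+z. ennreal (euclid_poisson \<rho> h (w \<bullet> z / r\<^sup>2)) \<partial>?S) = I" if w: "w \<in> sphere 0 r" for w
    unfolding I_def
    by (rule nn_integral_sphere_measure_zonal[where k = "\<lambda>s. ennreal (euclid_poisson \<rho> h (s / r\<^sup>2))"])
      (use n r w y in auto)
  \<comment> \<open>For \<open>h = 0\<close> the kernel is constantly 1.\<close>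
  have P1: "(\<integral>\<^sup>+w. ennreal (P 0 w) \<partial>?S) = 1"
    using one[of y 0] y by (simp add: euclid_poisson_def)
  have "I = (\<integral>\<^sup>+w. ennreal (P 0 w) * I \<partial>?S)"
    by (subst nn_integral_multc) (simp_all add: P1)
  also have "\<dots> = (\<integral>\<^sup>+w. (\<integral>\<^sup>+z. ennreal (P 0 w) * ennreal (euclid_poisson \<rho> h (w \<bullet> z / r\<^sup>2)) \<partial>?S) \<partial>?S)"
  proof (rule nn_integral_cong)
    fix w assume "w \<in> space ?S"
    then have w: "w \<in> sphere 0 r" by simp
    have "(\<lambda>z. ennreal (euclid_poisson \<rho> h (w \<bullet> z / r\<^sup>2))) \<in> borel_measurable ?S"
      using borel_measurable_sphere_measureI[OF Qc[OF w h]] by measurable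
    from nn_integral_cmult[OF this, of "ennreal (P 0 w)"]
    show "ennreal (P 0 w) * I = (\<integral>\<^sup>+z. ennreal (P 0 w) * ennreal (euclid_poisson \<rho> h (w \<bullet> z / r\<^sup>2)) \<partial>?S)"
      by (simp add: I[OF w])
  qed
  also have "\<dots> = (\<integral>\<^sup>+z. (\<integral>\<^sup>+w. ennreal (P 0 w) * ennreal (euclid_poisson \<rho> h (w \<bullet> z / r\<^sup>2)) \<partial>?S) \<partial>?S)"
    by (rule Fubini'[symmetric]) measurable
  also have "\<dots> = (\<integral>\<^sup>+z. 1 \<partial>?S)"
  proof (rule nn_integral_cong)
    fix z assume "z \<in> space ?S"
    then have z: "z \<in> sphere 0 r" by simp
    let ?J = "\<integral>\<^sup>+w. ennreal (P 0 w) * ennreal (euclid_poisson \<rho> h (w \<bullet> z / r\<^sup>2)) \<partial>?S"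
    have "?J =
      (\<integral>\<^sup>+w. ennreal (euclid_poisson \<rho> h (z \<bullet> w / r\<^sup>2) * P 0 w) \<partial>?S)"
      using P0 Q0 by (intro nn_integral_cong) (simp add: ennreal_mult' mult.commute inner_commute)
    then show "?J = 1"
      using one[OF z h] by simp
  qed
  also have "\<dots> = ennreal (measure ?S (sphere 0 r))"
    by (simp add: emeasure_eq_measure)
  finally have "I = ennreal (measure ?S (sphere 0 r))" .
  moreover have "I = ennreal (LINT z|?S. euclid_poisson \<rho> h (y \<bullet> z / r\<^sup>2))"
    unfolding I_def using y h Q0
    by (intro nn_integral_eq_integral integrable_sphere_measure r Qc AE_I2) auto
  moreover have "0 \<le> (LINT z|?S. euclid_poisson \<rho> h (y \<bullet> z / r\<^sup>2))"
    using Q0 by (intro integral_nonneg_AE AE_I2) auto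
  ultimately show ?thesis by simp
qed

text \<open>Let \<open>h\<close> tend to 1 in the expansion. The coefficients are absolutely summable, since the quotients of
  the hypergeometric factors converge and \<open>|x| < r\<close>.\<close>

lemma poisson_kernel_series:
  fixes x y :: "real ^ 'n"
  assumes P: "poisson_kernel M X r P" and x: "norm x < r" and r: "r < 1" and n: "2 < CARD('n)" and y: "norm y = r"
    and t: "x \<bullet> y = norm x * r * t" "\<bar>t\<bar> \<le> 1" and \<rho>: "\<rho> = (real CARD('n) - 2) / 2"
    and F: "\<And>k z. F k z = hypergeometric (real k) (- \<rho>) (real k + real CARD('n) / 2) z"
  defines "a \<equiv> \<lambda>k. (real k + \<rho>) / \<rho> * (norm x / r) ^ k * (F k ((norm x)\<^sup>2) / F k (r\<^sup>2)) * gegenbauer \<rho> k t"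
  shows "summable a" "measure (sphere_measure r :: (real ^ 'n) measure) (sphere 0 r) * P x y = (\<Sum>k. a k)"
proof -
  have r0: "0 < r" using x norm_ge_zero[of x] by linarith
  have \<rho>0: "0 < \<rho>" using n by (simp add: \<rho>)
  let ?q = "norm x / r"
  have q: "0 \<le> ?q" "?q < 1" using x r0 by (auto simp: field_simps)
  have x1: "(norm x)\<^sup>2 < 1" "r\<^sup>2 < 1" using x r r0 by (simp_all add: abs_square_less_1)
  have "(\<lambda>k. F k ((norm x)\<^sup>2) / F k (r\<^sup>2)) \<longlonglongrightarrow> (1 - (norm x)\<^sup>2) powr (- (- \<rho>)) / (1 - r\<^sup>2) powr (- (- \<rho>))"
    unfolding F using x1 by (intro tendsto_divide hypergeometric_large_parameter) auto
  then have "Bseq (\<lambda>k. F k ((norm x)\<^sup>2) / F k (r\<^sup>2))" by (rule convergent_imp_Bseq[OF convergentI])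
  then obtain K where K: "\<And>k. norm (F k ((norm x)\<^sup>2) / F k (r\<^sup>2)) \<le> K" unfolding Bseq_def by blast
  have sn: "summable (\<lambda>k. norm (a k))"
  proof (rule summable_comparison_test'[OF summable_mult[OF gegenbauer_majorant_summable[OF \<rho>0 q], of K]])
    fix k :: nat
    let ?m = "(real k + \<rho>) / \<rho> * gegenbauer \<rho> k 1 * ?q ^ k" and ?g = "(real k + \<rho>) / \<rho> * \<bar>gegenbauer \<rho> k t\<bar> * ?q ^ k"
    have "norm (norm (a k)) = norm (F k ((norm x)\<^sup>2) / F k (r\<^sup>2)) * ?g"
      unfolding a_def using \<rho>0 q by (simp add: abs_mult mult_ac)
    also have "\<dots> \<le> K * ?m"
    proof (rule mult_mono[OF K])
      show "?g \<le> ?m"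
        using \<rho>0 q(1) abs_gegenbauer_le[of \<rho> t k] t(2) by (intro mult_right_mono mult_left_mono) auto
      show "0 \<le> K" using K[of 0] norm_ge_zero order.trans by blast
      show "0 \<le> ?g" using \<rho>0 q by simp
    qed
    finally show "norm (norm (a k)) \<le> K * ?m" .
  qed
  then show "summable a" by (rule summable_norm_cancel)
  define h where "h j = 1 - 1 / (real j + 2)" for j
  have h: "1 / 2 \<le> h j" "h j < 1" for j by (auto simp: h_def field_simps)
  have h1: "h \<longlonglongrightarrow> 1" unfolding h_def[abs_def] by real_asymp
  have Pc: "continuous_on (sphere 0 r) (P x)" using P x unfolding poisson_kernel_def by auto
  let ?S = "sphere_measure r :: (real ^ 'n) measure"
  have "(\<lambda>j. LINT z|?S. euclid_poisson \<rho> (h j) (y \<bullet> z / r\<^sup>2) * P x z) \<longlonglongrightarrow> measure ?S (sphere 0 r) * P x y"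
    by (rule euclid_poisson_tendsto[OF \<rho>0 r0 Pc _ euclid_poisson_total[OF P r0 r n y \<rho>] h h1])
      (use y in auto)
  moreover have "(LINT z|?S. euclid_poisson \<rho> (h j) (y \<bullet> z / r\<^sup>2) * P x z) = (\<Sum>k. a k * h j ^ k)" for j
  proof -
    have "0 \<le> h j" using h(1)[of j] by linarith
    from poisson_kernel_abel_sums[OF P x r n y t(1) \<rho> F this h(2)] show ?thesis
      by (simp add: a_def sums_unique)
  qed
  moreover have "((\<lambda>j. \<Sum>k. a k * h j ^ k) \<longlongrightarrow> (\<Sum>k. a k)) sequentially"
  proof (rule tannerys_theorem[THEN conjunct2, THEN conjunct2])
    show "(\<lambda>j. a k * h j ^ k) \<longlonglongrightarrow> a k" for k
      using tendsto_mult_left[OF tendsto_power[OF h1, of k], of "a k"] by simp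
    show "summable (\<lambda>k. norm (a k))" by (rule sn)
    have "norm (a k * h j ^ k) \<le> norm (a k)" for k j
    proof -
      have "norm (h j ^ k) \<le> 1" using h[of j] by (simp add: norm_power power_le_one)
      then show ?thesis unfolding norm_mult by (intro mult_right_le_one_le) auto
    qed
    then show "\<forall>\<^sub>F (k, j) in at_top \<times>\<^sub>F sequentially. norm (a k * h j ^ k) \<le> norm (a k)"
      by (intro always_eventually) auto
  qed simp
  ultimately show "measure ?S (sphere 0 r) * P x y = (\<Sum>k. a k)"
    using LIMSEQ_unique by auto
qed

end

theorem theorem3p2:
  fixes N :: "'w measure"
    and M :: "real ^ 'n \<Rightarrow> 'w measure"
    and X :: "real \<Rightarrow> 'w \<Rightarrow> real ^ 'n"
    and P :: "real ^ 'n \<Rightarrow> real ^ 'n \<Rightarrow> real"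
    and r :: real
    and x y u :: "real ^ 'n"
  assumes "2 < CARD('n)"
    and "0 < r" and "r < 1"
    and "hyperbolic_Brownian_motion N M X"
    and "poisson_kernel M X r P"
    and "norm x < r" and "norm y = r"
    and "u \<noteq> 0"
  shows "let n = CARD('n);
             \<rho> = (real n - 2) / 2;
             F = (\<lambda>k z. hypergeometric (real k) (- \<rho>) (real k + real n / 2) z);
             \<theta> = angle (if x = 0 then u else x) y;
             a = (\<lambda>k. (real k + \<rho>) / \<rho> * (norm x / r) ^ k * (F k ((norm x)\<^sup>2) / F k (r\<^sup>2))
                        * gegenbauer \<rho> k (cos \<theta>))
         in summable a \<and>
            P x y = Gamma (real n / 2) / (2 * pi powr (real n / 2) * r ^ (n - 1)) * (\<Sum>k. a k)"
proof -
  interpret hyperbolic_Brownian_motion N M X by fact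
  define \<rho> where "\<rho> = (real CARD('n) - 2) / 2"
  define F where "F k z = hypergeometric (real k) (- \<rho>) (real k + real CARD('n) / 2) z" for k z
  define t where "t = cos (angle (if x = 0 then u else x) y)"
  define a where "a k = (real k + \<rho>) / \<rho> * (norm x / r) ^ k * (F k ((norm x)\<^sup>2) / F k (r\<^sup>2)) * gegenbauer \<rho> k t" for k
  let ?A = "2 * pi powr (real CARD('n) / 2) * r ^ (CARD('n) - 1) / Gamma (real CARD('n) / 2)"
  have t: "x \<bullet> y = norm x * r * t" "\<bar>t\<bar> \<le> 1"
  proof -
    show "\<bar>t\<bar> \<le> 1" by (simp add: t_def)
    show "x \<bullet> y = norm x * r * t"
    proof (cases "x = 0")
      case False
      have "\<bar>x \<bullet> y / (norm x * norm y)\<bar> \<le> 1"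
        using Cauchy_Schwarz_ineq2[of x y] False \<open>norm y = r\<close> \<open>0 < r\<close> by (simp add: abs_mult)
      then show ?thesis using False \<open>norm y = r\<close> \<open>0 < r\<close> by (simp add: t_def angle_def cos_arccos_abs)
    qed simp
  qed
  have G: "0 < Gamma (real CARD('n) / 2)" by (rule Gamma_real_pos) simp
  have A: "measure (sphere_measure r :: (real ^ 'n) measure) (sphere 0 r) = ?A"
    using emeasure_sphere_measure[where 'n = 'n, OF \<open>0 < r\<close>] G \<open>0 < r\<close> by (simp add: measure_def)
  have A0: "0 < ?A" using G \<open>0 < r\<close> by simp
  note * = poisson_kernel_series[OF \<open>poisson_kernel M X r P\<close> \<open>norm x < r\<close> \<open>r < 1\<close> \<open>2 < CARD('n)\<close> \<open>norm y = r\<close> t \<rho>_def F_def, folded a_def]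
  have "P x y = (\<Sum>k. a k) / ?A"
    using *(2) A0 unfolding A by (metis less_irrefl nonzero_mult_div_cancel_left)
  then have "P x y = Gamma (real CARD('n) / 2) / (2 * pi powr (real CARD('n) / 2) * r ^ (CARD('n) - 1)) * (\<Sum>k. a k)"
    by (simp add: field_simps)
  with *(1) show ?thesis
    unfolding Let_def \<rho>_def[symmetric] F_def[symmetric] t_def[symmetric] a_def[symmetric] by simp
qed

end
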